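(* Fix $\chi\in\mathcal{E}$ and $\ell\in[0,1]$. Assume: (1) $r$ and $\sigma_\varepsilon^2$ are continuous on a neighborhood of $\chi$, $F(0)=0$, and $\varphi(t):=E[r(\mathcal{X})-r(\chi)\mid \|\mathcal{X}-\chi\|=t]$ is differentiable at $t=0$; (2) $K$ is a nonnegative bounded kernel with support $[0,1]$ and $\inf_{t\in[0,1]}K(t)>0$; (3) for every $s\in[0,1]$, $\tau_h(s):=F(hs)/F(h)\to\tau_0(s)<\infty$ as $h\to0$; (4) as $n\to\infty$, $h_n\to0$, $nF(h_n)\to\infty$, $A_{n,\ell}:=\frac1n\sum_{i=1}^n\frac{h_i}{h_n}\left[\frac{F(h_i)}{F(h_n)}\right]^{1-\ell}\to\alpha_{[\ell]}<\infty$, and for every real $q\le 2$, $B_{n,q}:=\frac1n\sum_{i=1}^n\left[\frac{F(h_i)}{F(h_n)}\right]^q\to\beta_{[q]}<\infty$. If there exists a constant $c>0$ such that $nF(h_n)h_n^2\to c$ as $n\to\infty$, then $$\lim_{n\to\infty}nF(h_n)E\left[\left(r_n^{[\ell]}(\chi)-r(\chi)\right)^2\right]=\frac{\beta_{[1-2\ell]}}{\beta_{[1-\ell]}^2}\frac{M_2\sigma_\varepsilon^2(\chi)}{M_1^2}+\frac{c\,\alpha_{[\ell]}^2}{\beta_{[1-\ell]}^2}\frac{\varphi'(0)^2M_0^2}{M_1^2}.$$ In particular, if $F(t)\sim c'_\chi t^\kappa$ as $t\to0$ with constants $c'_\chi,\kappa>0$ (fractal or geometric process), then the choice $h_n=An^{-\frac{1}{\kappa+2}}$,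 $A>0$, implies $$\lim_{n\to\infty}n^{\frac{2}{2+\kappa}}E\left[\left(r_n^{[\ell]}(\chi)-r(\chi)\right)^2\right]=\frac{\beta_{[1-2\ell]}}{\beta_{[1-\ell]}^2}\frac{M_2\sigma_\varepsilon^2(\chi)}{c'_\chi A^\kappa M_1^2}+\frac{\alpha_{[\ell]}^2}{\beta_{[1-\ell]}^2}\frac{\varphi'(0)^2M_0^2A^2}{M_1^2}.$$
   Context: $\mathcal{E}$ is a Banach space endowed with a semi-norm $\|\cdot\|$ (neighborhoods and balls are taken with respect to $\|\cdot\|$). $(\mathcal{X},Y)$ is a random pair with values in $\mathcal{E}\times\mathbb{R}$ and $(\mathcal{X}_i,Y_i)_{i\ge1}$ are i.i.d. copies of it. The model is $Y_i=r(\mathcal{X}_i)+\varepsilon_i$ with $r(\chi)=E(Y\mid\mathcal{X}=\chi)$, $E(\varepsilon_i\mid\mathcal{X}_i)=0$ and $E(\varepsilon_i^2\mid\mathcal{X}_i)=\sigma_\varepsilon^2(\mathcal{X}_i)<\infty$. $F(t)=P(\|\chi-\mathcal{X}\|\le t)$, and $(h_n)$ is a sequence of positive bandwidths. The estimator is $$r_n^{[\ell]}(\chi)=\frac{\sum_{i=1}^n\frac{Y_i}{F(h_i)^\ell}K\left(\frac{\|\chi-\mathcal{X}_i\|}{h_i}\right)}{\sum_{i=1}^n\frac{1}{F(h_i)^\ell}K\left(\frac{\|\chi-\mathcal{X}_i\|}{h_i}\right)}$$ (with $0/0=0$). $K$ is differentiable on $[0,1]$ with integrable derivative, and $M_0=K(1)-\int_0^1(sK(s))'\tau_0(s)\,ds$,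 $M_1=K(1)-\int_0^1K'(s)\tau_0(s)\,ds$, $M_2=K^2(1)-\int_0^1(K^2(s))'\tau_0(s)\,ds$.
   Formalization: The formal theorem also assumes that E[Y²; ‖X−χ‖ ≤ h_i] is finite for every i ≥ 1; if this fails for some i, the mean squared error is infinite for all n ≥ i, so the stated limit is false. *)

theory Defs
  imports "HOL-Probability.Probability"
begin

definition is_seminorm :: "('e::real_vector \<Rightarrow> real) \<Rightarrow> bool" where
  "is_seminorm p \<longleftrightarrow> (\<forall>x y. p (x + y) \<le> p x + p y) \<and> (\<forall>a x. p (a *\<^sub>R x) = \<bar>a\<bar> * p x)"

text \<open>Neighbourhoods and continuity refer to the seminorm, not to the Banach space norm.\<close>

definition seminorm_continuous_near ::
    "('e::real_vector \<Rightarrow> real) \<Rightarrow> 'e \<Rightarrow> ('e \<Rightarrow> real) \<Rightarrow> bool" where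
  "seminorm_continuous_near p chi f \<longleftrightarrow>
     (\<exists>U. (\<exists>\<delta>>0. {x. p (x - chi) < \<delta>} \<subseteq> U) \<and>
          (\<forall>x\<in>U. \<forall>e>0. \<exists>d>0. \<forall>y\<in>U. p (y - x) < d \<longrightarrow> \<bar>f y - f x\<bar> < e))"

abbreviation sigma_of :: "'w measure \<Rightarrow> 's measure \<Rightarrow> ('w \<Rightarrow> 's) \<Rightarrow> 'w measure" where
  "sigma_of M N Z \<equiv> vimage_algebra (space M) Z N"

text \<open>\<open>regression_fun M N Z W g\<close>: the measurable function \<open>g\<close> is a version of
  $z \mapsto E(W \mid Z = z)$, where \<open>Z\<close> takes values in \<open>N\<close>.  Such a \<open>g\<close> is
  determined only almost everywhere with respect to the law of \<open>Z\<close>.\<close>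

definition regression_fun ::
    "'w measure \<Rightarrow> 's measure \<Rightarrow> ('w \<Rightarrow> 's) \<Rightarrow> ('w \<Rightarrow> real) \<Rightarrow> ('s \<Rightarrow> real) \<Rightarrow> bool" where
  "regression_fun M N Z W g \<longleftrightarrow>
     Z \<in> measurable M N \<and> integrable M W \<and> g \<in> borel_measurable N \<and>
     (AE \<omega> in M. real_cond_exp M (sigma_of M N Z) W \<omega> = g (Z \<omega>))"

definition small_ball :: "'w measure \<Rightarrow> ('e::real_vector \<Rightarrow> real) \<Rightarrow> ('w \<Rightarrow> 'e) \<Rightarrow> 'e \<Rightarrow> real \<Rightarrow> real" where
  "small_ball M p X chi t = measure M {\<omega> \<in> space M. p (chi - X \<omega>) \<le> t}"

text \<open>The convention $0/0 = 0$ is the one of HOL.\<close>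

definition rec_estimator ::
    "(real \<Rightarrow> real) \<Rightarrow> ('e::real_vector \<Rightarrow> real) \<Rightarrow> (real \<Rightarrow> real) \<Rightarrow> (nat \<Rightarrow> real) \<Rightarrow> real \<Rightarrow>
     (nat \<Rightarrow> 'w \<Rightarrow> 'e) \<Rightarrow> (nat \<Rightarrow> 'w \<Rightarrow> real) \<Rightarrow> 'e \<Rightarrow> nat \<Rightarrow> 'w \<Rightarrow> real" where
  "rec_estimator K p F h l Xs Ys chi n \<omega> =
     (\<Sum>i=1..n. Ys i \<omega> / F (h i) powr l * K (p (chi - Xs i \<omega>) / h i)) /
     (\<Sum>i=1..n. 1 / F (h i) powr l * K (p (chi - Xs i \<omega>) / h i))"

definition A_seq :: "(real \<Rightarrow> real) \<Rightarrow> (nat \<Rightarrow> real) \<Rightarrow> real \<Rightarrow> nat \<Rightarrow> real" where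
  "A_seq F h l n = (1 / real n) * (\<Sum>i=1..n. h i / h n * (F (h i) / F (h n)) powr (1 - l))"

definition B_seq :: "(real \<Rightarrow> real) \<Rightarrow> (nat \<Rightarrow> real) \<Rightarrow> real \<Rightarrow> nat \<Rightarrow> real" where
  "B_seq F h q n = (1 / real n) * (\<Sum>i=1..n. (F (h i) / F (h n)) powr q)"

text \<open>Derivative relative to $[0,1]$ (one-sided at the end points: kernels may jump there).\<close>

definition deriv01 :: "(real \<Rightarrow> real) \<Rightarrow> real \<Rightarrow> real" where
  "deriv01 f s = vector_derivative f (at s within {0..1})"

definition M0 :: "(real \<Rightarrow> real) \<Rightarrow> (real \<Rightarrow> real) \<Rightarrow> real" where
  "M0 K \<tau>\<^sub>0 = K 1 - (LINT s:{0..1}|lborel. deriv01 (\<lambda>u. u * K u) s * \<tau>\<^sub>0 s)"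

definition M1 :: "(real \<Rightarrow> real) \<Rightarrow> (real \<Rightarrow> real) \<Rightarrow> real" where
  "M1 K \<tau>\<^sub>0 = K 1 - (LINT s:{0..1}|lborel. deriv01 K s * \<tau>\<^sub>0 s)"

definition M2 :: "(real \<Rightarrow> real) \<Rightarrow> (real \<Rightarrow> real) \<Rightarrow> real" where
  "M2 K \<tau>\<^sub>0 = (K 1)\<^sup>2 - (LINT s:{0..1}|lborel. deriv01 (\<lambda>u. (K u)\<^sup>2) s * \<tau>\<^sub>0 s)"

end

theory Submission
  imports Defs
begin

text \<open>Put \<open>Z\<^sub>i\<close> for the normalised weight of the \<open>i\<close>-th observation, so that the estimation error is
  \<open>S / D\<close> with \<open>D = \<Sum> Z\<^sub>i\<close> and \<open>S = \<Sum> Z\<^sub>i (Y\<^sub>i - r \<chi>)\<close>, except on the event \<open>D = 0\<close>. The limit is that of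
  \<open>E S\<^sup>2 / (E D)\<^sup>2\<close>, whose variance and squared bias parts follow from the moments of the kernel on
  small balls and a Toeplitz argument for the weights. To replace \<open>D\<close> by \<open>E D\<close> one has to be careful because
  only second moments of the response are available. On \<open>D > E D / 2\<close> the error is controlled by
  \<open>E (S (D - E D))\<^sup>2\<close>, which involves only second moments of the response since the \<open>Z\<^sub>i\<close> are bounded. On
  \<open>D \<le> E D / 2\<close> convexity gives \<open>(S / D)\<^sup>2 \<le> \<Sum> (Y\<^sub>i - r \<chi>)\<^sup>2\<close> over the observations with positive weight, and
  the Laplace transform of \<open>D\<close> without the \<open>i\<close>-th summand is exponentially small in \<open>n F(h\<^sub>n)\<close>.\<close>

section \<open>Mixed moments of sums of independent pairs\<close>

text \<open>The obstacle is that \<open>N = n F(h_n)\<close> may grow very slowly compared with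
  \<open>n\<close>, so an estimate \<open>n * exp (- const * N)\<close> for the bad event would be
  useless. The responses are therefore cut to the ball of radius \<open>h i\<close>: no weighted
  response changes, since the kernel vanishes off the ball, and the second moments of the cut
  responses sum to order \<open>N\<close>, which the exponential does beat. The positive lower bound
  of the kernel on [0,1] transfers moment bounds from weighted to cut responses. The weights carry
  the common factor \<open>F(h_n)^l / N\<close>, which cancels in the ratio and makes
  \<open>E D\<close> converge. The power \<open>j + 1\<close> of a weight times
  \<open>N^j * F(h_i)\<close> is a summand of the average \<open>B\<close> with exponent
  \<open>1 - (j + 1) l\<close>; fourth moments bring in \<open>1 - 4 l\<close>, so negative
  exponents can occur. The bias sum uses other triangular weights, containing the ratio of
  bandwidths, and the positivity of \<open>c\<close> makes each of them vanish. On the event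
  \<open>D = 0\<close> the estimator is 0 by convention; this adds \<open>r(chi)^2\<close> times an
  exponentially small probability.\<close>

lemma (in prob_space) indep_vars_sum_pair:
  fixes W :: "'i \<Rightarrow> 'a \<Rightarrow> real \<times> real"
  assumes "finite A" "i \<notin> A" and indep: "indep_vars (\<lambda>_. borel) W (insert i A)"
  shows "indep_var borel (\<lambda>\<omega>. \<Sum>j\<in>A. W j \<omega>) borel (W i)"
proof -
  have "indep_var
    borel ((\<lambda>f. \<Sum>j\<in>A. f j) \<circ> (\<lambda>\<omega>. restrict (\<lambda>i. W i \<omega>) A))
    borel ((\<lambda>f. f i) \<circ> (\<lambda>\<omega>. restrict (\<lambda>i. W i \<omega>) {i}))"
    using assms by (intro indep_var_compose[OF indep_var_restrict[OF indep]]) auto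
  also have "((\<lambda>f. f i) \<circ> (\<lambda>\<omega>. restrict (\<lambda>i. W i \<omega>) {i})) = W i"
    by auto
  also have "((\<lambda>f. \<Sum>j\<in>A. f j) \<circ> (\<lambda>\<omega>. restrict (\<lambda>i. W i \<omega>) A)) = (\<lambda>\<omega>. \<Sum>j\<in>A. W j \<omega>)"
    by (auto cong: rev_conj_cong)
  finally show ?thesis .
qed

text \<open>Only different indices are independent; the two coordinates of one pair may depend on
  each other. Summing the pairs, and not each coordinate separately, keeps their joint law, so
  functions of both partial sums can be separated from functions of both new coordinates.\<close>

lemma (in prob_space) indep_vars_sum_pair_integral:
  fixes u v :: "'i \<Rightarrow> 'a \<Rightarrow> real" and f g :: "real \<Rightarrow> real \<Rightarrow> real"
  assumes A: "finite A" "i \<notin> A"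
    and indep: "indep_vars (\<lambda>_. borel) (\<lambda>i \<omega>. (u i \<omega>, v i \<omega>)) (insert i A)"
    and [measurable]: "case_prod f \<in> borel_measurable borel" "case_prod g \<in> borel_measurable borel"
    and int: "integrable M (\<lambda>\<omega>. f (\<Sum>j\<in>A. u j \<omega>) (\<Sum>j\<in>A. v j \<omega>))"
      "integrable M (\<lambda>\<omega>. g (u i \<omega>) (v i \<omega>))"
  shows "integrable M (\<lambda>\<omega>. f (\<Sum>j\<in>A. u j \<omega>) (\<Sum>j\<in>A. v j \<omega>) * g (u i \<omega>) (v i \<omega>))" (is ?A)
    and "expectation (\<lambda>\<omega>. f (\<Sum>j\<in>A. u j \<omega>) (\<Sum>j\<in>A. v j \<omega>) * g (u i \<omega>) (v i \<omega>))
      = expectation (\<lambda>\<omega>. f (\<Sum>j\<in>A. u j \<omega>) (\<Sum>j\<in>A. v j \<omega>)) * expectation (\<lambda>\<omega>. g (u i \<omega>) (v i \<omega>))" (is ?B)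
proof -
  have *: "(\<Sum>j\<in>A. (u j \<omega>, v j \<omega>)) = ((\<Sum>j\<in>A. u j \<omega>), (\<Sum>j\<in>A. v j \<omega>))" for \<omega>
    using A(1) by (induction A) (auto simp: zero_prod_def)
  have "indep_var borel (case_prod f \<circ> (\<lambda>\<omega>. \<Sum>j\<in>A. (u j \<omega>, v j \<omega>))) borel (case_prod g \<circ> (\<lambda>\<omega>. (u i \<omega>, v i \<omega>)))"
    by (intro indep_var_compose[OF indep_vars_sum_pair[OF A indep]]) auto
  then have iv: "indep_var borel (\<lambda>\<omega>. f (\<Sum>j\<in>A. u j \<omega>) (\<Sum>j\<in>A. v j \<omega>)) borel (\<lambda>\<omega>. g (u i \<omega>) (v i \<omega>))"
    by (simp add: comp_def *)
  show ?A by (rule indep_var_integrable[OF iv int])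
  show ?B by (rule indep_var_lebesgue_integral[OF iv int])
qed

lemma (in finite_measure) integrable_sq_mult_bounded:
  fixes f g :: "'a \<Rightarrow> real"
  assumes [measurable]: "f \<in> borel_measurable M" "g \<in> borel_measurable M"
    and "integrable M (\<lambda>\<omega>. (f \<omega>)\<^sup>2)" and "\<And>\<omega>. \<omega> \<in> space M \<Longrightarrow> \<bar>g \<omega>\<bar> \<le> c"
  shows "integrable M (\<lambda>\<omega>. (f \<omega>)\<^sup>2 * g \<omega>)"
proof (rule Bochner_Integration.integrable_bound[OF integrable_mult_left[OF assms(3), of c]])
  show "AE \<omega> in M. norm ((f \<omega>)\<^sup>2 * g \<omega>) \<le> norm ((f \<omega>)\<^sup>2 * c)"
  proof (rule AE_I2)
    fix \<omega> assume "\<omega> \<in> space M"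
    then have "\<bar>g \<omega>\<bar> \<le> \<bar>c\<bar>" using assms(4) by fastforce
    then show "norm ((f \<omega>)\<^sup>2 * g \<omega>) \<le> norm ((f \<omega>)\<^sup>2 * c)"
      by (simp add: abs_mult mult_left_mono)
  qed
qed measurable

lemma (in finite_measure) integrable_mult_bounded_of_sq:
  fixes f g :: "'a \<Rightarrow> real"
  assumes [measurable]: "f \<in> borel_measurable M" "g \<in> borel_measurable M"
    and "integrable M (\<lambda>\<omega>. (f \<omega>)\<^sup>2)" and "\<And>\<omega>. \<omega> \<in> space M \<Longrightarrow> \<bar>g \<omega>\<bar> \<le> c"
  shows "integrable M (\<lambda>\<omega>. f \<omega> * g \<omega>)"
proof (rule Bochner_Integration.integrable_bound)
  show "integrable M (\<lambda>\<omega>. f \<omega> * c)"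
    using square_integrable_imp_integrable[OF assms(1,3)] by simp
  show "AE \<omega> in M. norm (f \<omega> * g \<omega>) \<le> norm (f \<omega> * c)"
  proof (rule AE_I2)
    fix \<omega> assume "\<omega> \<in> space M"
    then have "\<bar>g \<omega>\<bar> \<le> \<bar>c\<bar>" using assms(4) by fastforce
    then show "norm (f \<omega> * g \<omega>) \<le> norm (f \<omega> * c)"
      by (simp add: abs_mult mult_left_mono)
  qed
qed measurable

text \<open>The full expansion contains \<open>4 * U * V * u * v\<close>, whose expectation need not
  vanish because \<open>u\<close> and \<open>v\<close> are dependent. The square of
  \<open>U * v - V * u\<close> absorbs it, which raises the coefficients of the two mixed squares
  from 1 to 3. Each of the last four terms is linear in a factor that will be centred and
  independent of the rest.\<close>

lemma fourth_moment_pointwise: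
  fixes U V u v :: real
  shows "((U + u) * (V + v))\<^sup>2 \<le> (U * V)\<^sup>2 + 3 * (U\<^sup>2 * v\<^sup>2) + 3 * (V\<^sup>2 * u\<^sup>2) + (u * v)\<^sup>2
    + 2 * (U\<^sup>2 * V * v) + 2 * (U * V\<^sup>2 * u) + 2 * (U * (u * v\<^sup>2)) + 2 * (V * (u\<^sup>2 * v))"
proof -
  have "0 \<le> 2 * (U * v - V * u)\<^sup>2" by simp
  then show ?thesis by (simp add: power2_eq_square algebra_simps)
qed

text \<open>Induction on the index set. The conclusions are bundled because the step for the mixed
  fourth moment uses the bound, the zero means and both variances of the partial sums. Since
  \<open>u\<close> enters at most squared and \<open>v\<close> is bounded, second moments of
  \<open>u\<close> are enough.\<close>

lemma (in prob_space) indep_sum_mixed_fourth_moment: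
  fixes u v :: "'i \<Rightarrow> 'a \<Rightarrow> real" and c :: "'i \<Rightarrow> real"
  assumes "finite A" "indep_vars (\<lambda>_. borel) (\<lambda>i \<omega>. (u i \<omega>, v i \<omega>)) A"
    and "\<And>i. i \<in> A \<Longrightarrow> integrable M (\<lambda>\<omega>. (u i \<omega>)\<^sup>2)"
    and "\<And>i \<omega>. i \<in> A \<Longrightarrow> \<omega> \<in> space M \<Longrightarrow> \<bar>v i \<omega>\<bar> \<le> c i"
    and "\<And>i. i \<in> A \<Longrightarrow> expectation (u i) = 0" "\<And>i. i \<in> A \<Longrightarrow> expectation (v i) = 0"
  shows "(\<lambda>\<omega>. \<Sum>i\<in>A. u i \<omega>) \<in> borel_measurable M \<and> (\<lambda>\<omega>. \<Sum>i\<in>A. v i \<omega>) \<in> borel_measurable M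
    \<and> integrable M (\<lambda>\<omega>. (\<Sum>i\<in>A. u i \<omega>)\<^sup>2)
    \<and> (\<forall>\<omega>\<in>space M. \<bar>\<Sum>i\<in>A. v i \<omega>\<bar> \<le> sum c A)
    \<and> expectation (\<lambda>\<omega>. \<Sum>i\<in>A. u i \<omega>) = 0 \<and> expectation (\<lambda>\<omega>. \<Sum>i\<in>A. v i \<omega>) = 0
    \<and> expectation (\<lambda>\<omega>. (\<Sum>i\<in>A. u i \<omega>)\<^sup>2) = (\<Sum>i\<in>A. expectation (\<lambda>\<omega>. (u i \<omega>)\<^sup>2))
    \<and> expectation (\<lambda>\<omega>. (\<Sum>i\<in>A. v i \<omega>)\<^sup>2) = (\<Sum>i\<in>A. expectation (\<lambda>\<omega>. (v i \<omega>)\<^sup>2))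
    \<and> expectation (\<lambda>\<omega>. ((\<Sum>i\<in>A. u i \<omega>) * (\<Sum>i\<in>A. v i \<omega>))\<^sup>2)
       \<le> 3 * (\<Sum>i\<in>A. expectation (\<lambda>\<omega>. (u i \<omega>)\<^sup>2)) * (\<Sum>i\<in>A. expectation (\<lambda>\<omega>. (v i \<omega>)\<^sup>2))
         + (\<Sum>i\<in>A. expectation (\<lambda>\<omega>. (u i \<omega> * v i \<omega>)\<^sup>2))"
  using assms
proof (induction A rule: finite_induct)
  case empty
  then show ?case by simp
next
  case (insert i A)
  define U where "U = (\<lambda>\<omega>. \<Sum>i\<in>A. u i \<omega>)"
  define V where "V = (\<lambda>\<omega>. \<Sum>i\<in>A. v i \<omega>)"
  define C where "C = sum c A"
  note ind = insert.prems(1)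
  have rvp: "(\<lambda>\<omega>. (u j \<omega>, v j \<omega>)) \<in> borel_measurable M" if "j \<in> insert i A" for j
    using ind that by (auto simp: indep_vars_def)
  have rv: "u j \<in> borel_measurable M" "v j \<in> borel_measurable M" if "j \<in> insert i A" for j
    using measurable_compose[OF rvp[OF that] borel_measurable_continuous_onI[OF continuous_on_fst[OF continuous_on_id]]]
      measurable_compose[OF rvp[OF that] borel_measurable_continuous_onI[OF continuous_on_snd[OF continuous_on_id]]]
    by simp_all
  have [measurable]: "u i \<in> borel_measurable M" "v i \<in> borel_measurable M"
    using rv by auto
  have indA: "indep_vars (\<lambda>_. borel) (\<lambda>i \<omega>. (u i \<omega>, v i \<omega>)) A"
    by (rule indep_vars_subset[OF ind]) auto
  have IH: "U \<in> borel_measurable M" "V \<in> borel_measurable M" "integrable M (\<lambda>\<omega>. (U \<omega>)\<^sup>2)"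
    "\<And>\<omega>. \<omega> \<in> space M \<Longrightarrow> \<bar>V \<omega>\<bar> \<le> C" "expectation U = 0" "expectation V = 0"
    "expectation (\<lambda>\<omega>. (U \<omega>)\<^sup>2) = (\<Sum>i\<in>A. expectation (\<lambda>\<omega>. (u i \<omega>)\<^sup>2))"
    "expectation (\<lambda>\<omega>. (V \<omega>)\<^sup>2) = (\<Sum>i\<in>A. expectation (\<lambda>\<omega>. (v i \<omega>)\<^sup>2))"
    "expectation (\<lambda>\<omega>. (U \<omega> * V \<omega>)\<^sup>2)
       \<le> 3 * (\<Sum>i\<in>A. expectation (\<lambda>\<omega>. (u i \<omega>)\<^sup>2)) * (\<Sum>i\<in>A. expectation (\<lambda>\<omega>. (v i \<omega>)\<^sup>2))
         + (\<Sum>i\<in>A. expectation (\<lambda>\<omega>. (u i \<omega> * v i \<omega>)\<^sup>2))"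
    using insert.IH[OF indA] insert.prems(2-) unfolding U_def V_def C_def by auto
  note [measurable] = IH(1,2)
  have prod: "integrable M (\<lambda>\<omega>. f (U \<omega>) (V \<omega>) * g (u i \<omega>) (v i \<omega>))" (is ?A)
    "expectation (\<lambda>\<omega>. f (U \<omega>) (V \<omega>) * g (u i \<omega>) (v i \<omega>))
      = expectation (\<lambda>\<omega>. f (U \<omega>) (V \<omega>)) * expectation (\<lambda>\<omega>. g (u i \<omega>) (v i \<omega>))" (is ?B)
    if "continuous_on UNIV (\<lambda>p. f (fst p) (snd p))" "continuous_on UNIV (\<lambda>p. g (fst p) (snd p))"
      "integrable M (\<lambda>\<omega>. f (U \<omega>) (V \<omega>))" "integrable M (\<lambda>\<omega>. g (u i \<omega>) (v i \<omega>))"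
    for f g :: "real \<Rightarrow> real \<Rightarrow> real"
  proof -
    have m: "case_prod f \<in> borel_measurable borel" "case_prod g \<in> borel_measurable borel"
      using that(1,2)[THEN borel_measurable_continuous_onI] by (simp_all add: split_beta')
    show ?A ?B using indep_vars_sum_pair_integral[OF insert.hyps(1,2) ind m] that(3,4)
      unfolding U_def V_def by auto
  qed
  have ct: "continuous_on UNIV (\<lambda>p::real\<times>real. fst p)" "continuous_on UNIV (\<lambda>p::real\<times>real. snd p)"
    "continuous_on UNIV (\<lambda>p::real\<times>real. (fst p)\<^sup>2)" "continuous_on UNIV (\<lambda>p::real\<times>real. (snd p)\<^sup>2)"
    "continuous_on UNIV (\<lambda>p::real\<times>real. (fst p)\<^sup>2 * snd p)" "continuous_on UNIV (\<lambda>p::real\<times>real. fst p * (snd p)\<^sup>2)"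
    by (auto intro!: continuous_intros)
  have vb: "\<bar>v i \<omega>\<bar> \<le> c i" if "\<omega> \<in> space M" for \<omega> using insert.prems(3) that by auto
  have u2: "integrable M (\<lambda>\<omega>. (u i \<omega>)\<^sup>2)" using insert.prems(2) by auto
  have u0: "expectation (u i) = 0" and v0: "expectation (v i) = 0" using insert.prems by auto
  have sqb: "\<bar>x\<^sup>2\<bar> \<le> k\<^sup>2" if "\<bar>x\<bar> \<le> k" for x k :: real
    using that power_mono[OF that, of 2] by simp
  have iU: "integrable M U" using square_integrable_imp_integrable[OF IH(1,3)] .
  have iu: "integrable M (u i)" by (rule square_integrable_imp_integrable[OF _ u2]) auto
  have iV: "integrable M V" using IH(4) by (intro integrable_const_bound[where B=C]) (auto)
  have iv: "integrable M (v i)" using vb by (intro integrable_const_bound[where B="c i"]) (auto)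
  have iV2: "integrable M (\<lambda>\<omega>. (V \<omega>)\<^sup>2)"
    using sqb[OF IH(4)] by (intro integrable_const_bound[where B="C\<^sup>2"]) auto
  have iv2: "integrable M (\<lambda>\<omega>. (v i \<omega>)\<^sup>2)"
    using sqb[OF vb] by (intro integrable_const_bound[where B="(c i)\<^sup>2"]) auto
  have iU2V: "integrable M (\<lambda>\<omega>. (U \<omega>)\<^sup>2 * V \<omega>)"
    by (rule integrable_sq_mult_bounded[OF _ _ IH(3) IH(4)]) auto
  have iUV2: "integrable M (\<lambda>\<omega>. U \<omega> * (V \<omega>)\<^sup>2)"
    by (rule integrable_mult_bounded_of_sq[OF _ _ IH(3) sqb[OF IH(4)]]) auto
  have iU2V2: "integrable M (\<lambda>\<omega>. (U \<omega> * V \<omega>)\<^sup>2)"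
    unfolding power_mult_distrib by (rule integrable_sq_mult_bounded[OF _ _ IH(3) sqb[OF IH(4)]]) auto
  have iu2v: "integrable M (\<lambda>\<omega>. (u i \<omega>)\<^sup>2 * v i \<omega>)"
    by (rule integrable_sq_mult_bounded[OF _ _ u2 vb]) auto
  have iuv2: "integrable M (\<lambda>\<omega>. u i \<omega> * (v i \<omega>)\<^sup>2)"
    by (rule integrable_mult_bounded_of_sq[OF _ _ u2 sqb[OF vb]]) auto
  have iu2v2: "integrable M (\<lambda>\<omega>. (u i \<omega> * v i \<omega>)\<^sup>2)"
    unfolding power_mult_distrib by (rule integrable_sq_mult_bounded[OF _ _ u2 sqb[OF vb]]) auto
  have P1: "integrable M (\<lambda>\<omega>. (U \<omega>)\<^sup>2 * (v i \<omega>)\<^sup>2)"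
     "expectation (\<lambda>\<omega>. (U \<omega>)\<^sup>2 * (v i \<omega>)\<^sup>2) = expectation (\<lambda>\<omega>. (U \<omega>)\<^sup>2) * expectation (\<lambda>\<omega>. (v i \<omega>)\<^sup>2)"
    using prod[of "\<lambda>a b. a\<^sup>2" "\<lambda>a b. b\<^sup>2"] IH(3) iv2 by (simp_all add: ct)
  have P2: "integrable M (\<lambda>\<omega>. (V \<omega>)\<^sup>2 * (u i \<omega>)\<^sup>2)"
     "expectation (\<lambda>\<omega>. (V \<omega>)\<^sup>2 * (u i \<omega>)\<^sup>2) = expectation (\<lambda>\<omega>. (V \<omega>)\<^sup>2) * expectation (\<lambda>\<omega>. (u i \<omega>)\<^sup>2)"
    using prod[of "\<lambda>a b. b\<^sup>2" "\<lambda>a b. a\<^sup>2"] iV2 u2 by (simp_all add: ct)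
  have P3: "integrable M (\<lambda>\<omega>. (U \<omega>)\<^sup>2 * V \<omega> * v i \<omega>)"
     "expectation (\<lambda>\<omega>. (U \<omega>)\<^sup>2 * V \<omega> * v i \<omega>) = 0"
    using prod[of "\<lambda>a b. a\<^sup>2 * b" "\<lambda>a b. b"] iU2V iv v0 by (simp_all add: ct)
  have P4: "integrable M (\<lambda>\<omega>. U \<omega> * (V \<omega>)\<^sup>2 * u i \<omega>)"
     "expectation (\<lambda>\<omega>. U \<omega> * (V \<omega>)\<^sup>2 * u i \<omega>) = 0"
    using prod[of "\<lambda>a b. a * b\<^sup>2" "\<lambda>a b. a"] iUV2 iu u0 by (simp_all add: ct)
  have P5: "integrable M (\<lambda>\<omega>. U \<omega> * (u i \<omega> * (v i \<omega>)\<^sup>2))"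
     "expectation (\<lambda>\<omega>. U \<omega> * (u i \<omega> * (v i \<omega>)\<^sup>2)) = 0"
    using prod[of "\<lambda>a b. a" "\<lambda>a b. a * b\<^sup>2"] iU iuv2 IH(5) by (simp_all add: ct)
  have P6: "integrable M (\<lambda>\<omega>. V \<omega> * ((u i \<omega>)\<^sup>2 * v i \<omega>))"
     "expectation (\<lambda>\<omega>. V \<omega> * ((u i \<omega>)\<^sup>2 * v i \<omega>)) = 0"
    using prod[of "\<lambda>a b. b" "\<lambda>a b. a\<^sup>2 * b"] iV iu2v IH(6) by (simp_all add: ct)
  have P7: "integrable M (\<lambda>\<omega>. U \<omega> * u i \<omega>)" "expectation (\<lambda>\<omega>. U \<omega> * u i \<omega>) = 0"
    using prod[of "\<lambda>a b. a" "\<lambda>a b. a"] iU iu u0 by (simp_all add: ct)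
  have P8: "integrable M (\<lambda>\<omega>. V \<omega> * v i \<omega>)" "expectation (\<lambda>\<omega>. V \<omega> * v i \<omega>) = 0"
    using prod[of "\<lambda>a b. b" "\<lambda>a b. b"] iV iv v0 by (simp_all add: ct)
  have sU: "(\<Sum>j\<in>insert i A. u j \<omega>) = U \<omega> + u i \<omega>" for \<omega>
    using insert.hyps by (simp add: U_def)
  have sV: "(\<Sum>j\<in>insert i A. v j \<omega>) = V \<omega> + v i \<omega>" for \<omega>
    using insert.hyps by (simp add: V_def)
  have sq: "(x + y)\<^sup>2 = x\<^sup>2 + 2 * (x * y) + y\<^sup>2" for x y :: real
    by (simp add: power2_eq_square algebra_simps)
  have Vb: "\<bar>V \<omega> + v i \<omega>\<bar> \<le> C + c i" if "\<omega> \<in> space M" for \<omega>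
    using IH(4)[OF that] vb[OF that] by linarith
  have i1: "integrable M (\<lambda>\<omega>. (U \<omega> + u i \<omega>)\<^sup>2)"
    unfolding sq using P7 IH(3) u2 by auto
  have i2: "integrable M (\<lambda>\<omega>. ((U \<omega> + u i \<omega>) * (V \<omega> + v i \<omega>))\<^sup>2)"
    unfolding power_mult_distrib by (rule integrable_sq_mult_bounded[OF _ _ i1 sqb[OF Vb]]) auto
  define R where "R = (\<lambda>\<omega>. (U \<omega> * V \<omega>)\<^sup>2 + 3 * ((U \<omega>)\<^sup>2 * (v i \<omega>)\<^sup>2) + 3 * ((V \<omega>)\<^sup>2 * (u i \<omega>)\<^sup>2) + (u i \<omega> * v i \<omega>)\<^sup>2
    + 2 * ((U \<omega>)\<^sup>2 * V \<omega> * v i \<omega>) + 2 * (U \<omega> * (V \<omega>)\<^sup>2 * u i \<omega>) + 2 * (U \<omega> * (u i \<omega> * (v i \<omega>)\<^sup>2)) + 2 * (V \<omega> * ((u i \<omega>)\<^sup>2 * v i \<omega>)))"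
  have iR: "integrable M R" unfolding R_def
    using P1 P2 P3 P4 P5 P6 iU2V2 iu2v2 by (intro Bochner_Integration.integrable_add integrable_mult_right) auto
  have "expectation (\<lambda>\<omega>. ((U \<omega> + u i \<omega>) * (V \<omega> + v i \<omega>))\<^sup>2) \<le> expectation R"
    unfolding R_def by (intro integral_mono i2 iR[unfolded R_def] fourth_moment_pointwise)
  also have "expectation R = expectation (\<lambda>\<omega>. (U \<omega> * V \<omega>)\<^sup>2)
     + 3 * (expectation (\<lambda>\<omega>. (U \<omega>)\<^sup>2) * expectation (\<lambda>\<omega>. (v i \<omega>)\<^sup>2))
     + 3 * (expectation (\<lambda>\<omega>. (V \<omega>)\<^sup>2) * expectation (\<lambda>\<omega>. (u i \<omega>)\<^sup>2)) + expectation (\<lambda>\<omega>. (u i \<omega> * v i \<omega>)\<^sup>2)"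
    unfolding R_def using P1 P2 P3 P4 P5 P6 iU2V2 iu2v2 by simp
  finally have F: "expectation (\<lambda>\<omega>. ((U \<omega> + u i \<omega>) * (V \<omega> + v i \<omega>))\<^sup>2) \<le> \<dots>" .
  \<comment> \<open>A new index adds to the product of the two variance sums also the product of the
    two new variances, which the expansion does not supply. It is nonnegative, so the bound
    persists.\<close>
  have uv0: "0 \<le> expectation (\<lambda>\<omega>. (u i \<omega>)\<^sup>2) * expectation (\<lambda>\<omega>. (v i \<omega>)\<^sup>2)"
    by (intro mult_nonneg_nonneg integral_nonneg_AE) auto
  have E1: "expectation (\<lambda>\<omega>. (U \<omega> + u i \<omega>)\<^sup>2) = expectation (\<lambda>\<omega>. (U \<omega>)\<^sup>2) + expectation (\<lambda>\<omega>. (u i \<omega>)\<^sup>2)"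
    unfolding sq using P7 IH(3) u2 by simp
  have E2: "expectation (\<lambda>\<omega>. (V \<omega> + v i \<omega>)\<^sup>2) = expectation (\<lambda>\<omega>. (V \<omega>)\<^sup>2) + expectation (\<lambda>\<omega>. (v i \<omega>)\<^sup>2)"
    unfolding sq using P8 iV2 iv2 by simp
  have sums: "sum f (insert i A) = f i + sum f A" for f :: "'i \<Rightarrow> real" using insert.hyps by simp
  have fin: "3 * (a + x) * (b + y) = 3 * (a * b) + 3 * (x * b) + 3 * (y * a) + 3 * x * y" for a b x y :: real
    by (simp add: algebra_simps)
  show ?case
    unfolding sU sV sums
    apply (intro conjI)
    subgoal by measurable
    subgoal by measurable
    subgoal by (rule i1)
    subgoal using Vb by (auto simp: C_def add.commute)
    subgoal using iU iu IH(5) u0 by simp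
    subgoal using iV iv IH(6) v0 by simp
    subgoal using E1 IH(7) by simp
    subgoal using E2 IH(8) by simp
    subgoal using F IH(9) uv0 unfolding IH(7,8) fin
        by linarith
    done
qed

section \<open>Second moment of a ratio of weighted sums\<close>

text \<open>The identity \<open>(1 - x + x^2 / 2) * (1 + x + x^2 / 2) = 1 + x^4 / 4\<close> and the
  Taylor lower bound of \<open>exp x\<close> show that the right-hand side times
  \<open>exp x\<close> is at least 1.\<close>

lemma exp_minus_le_quadratic:
  fixes x :: real
  assumes "0 \<le> x"
  shows "exp (- x) \<le> 1 - x + x\<^sup>2 / 2"
proof -
  have "1 \<le> 1 + x ^ 4 / 4" by simp
  also have "\<dots> = (1 - x + x\<^sup>2 / 2) * (1 + x + x\<^sup>2 / 2)"
    by (simp add: field_simps power2_eq_square power4_eq_xxxx)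
  also have "\<dots> \<le> (1 - x + x\<^sup>2 / 2) * exp x"
  proof (intro mult_left_mono exp_lower_Taylor_quadratic assms)
    have "0 \<le> (1 - x)\<^sup>2 + 1" by simp
    then show "0 \<le> 1 - x + x\<^sup>2 / 2" by (simp add: power2_eq_square algebra_simps)
  qed
  finally show ?thesis by (simp add: exp_minus field_simps)
qed

text \<open>The quadratic bound is integrated and followed by \<open>1 + y \<le> exp y\<close>. With
  the second moment in the exponent, and not the bound \<open>c\<close>, a product over independent
  summands collects into the sum of their second moments.\<close>

lemma (in prob_space) expectation_exp_minus_le:
  fixes Z :: "'a \<Rightarrow> real"
  assumes [measurable]: "Z \<in> borel_measurable M" and Z: "\<And>\<omega>. \<omega> \<in> space M \<Longrightarrow> 0 \<le> Z \<omega> \<and> Z \<omega> \<le> c" and "0 \<le> \<theta>"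
  shows "expectation (\<lambda>\<omega>. exp (- \<theta> * Z \<omega>)) \<le> exp (- \<theta> * expectation Z + \<theta>\<^sup>2 * expectation (\<lambda>\<omega>. (Z \<omega>)\<^sup>2) / 2)"
proof -
  have i1: "integrable M Z" using Z by (intro integrable_const_bound[where B=c]) auto
  have i2: "integrable M (\<lambda>\<omega>. (Z \<omega>)\<^sup>2)"
    using Z by (intro integrable_const_bound[where B="c\<^sup>2"]) (auto intro!: power_mono)
  have i3: "integrable M (\<lambda>\<omega>. exp (- \<theta> * Z \<omega>))"
    using Z assms(3) by (intro integrable_const_bound[where B=1]) auto
  have "expectation (\<lambda>\<omega>. exp (- \<theta> * Z \<omega>)) \<le> expectation (\<lambda>\<omega>. 1 - \<theta> * Z \<omega> + \<theta>\<^sup>2 * (Z \<omega>)\<^sup>2 / 2)"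
    using i1 i2 i3 Z assms(3) exp_minus_le_quadratic[of "\<theta> * Z _"]
    by (intro integral_mono) (auto simp: power_mult_distrib)
  also have "\<dots> = 1 + (- \<theta> * expectation Z + \<theta>\<^sup>2 * expectation (\<lambda>\<omega>. (Z \<omega>)\<^sup>2) / 2)"
    using i1 i2 by (simp add: prob_space)
  also have "\<dots> \<le> exp (- \<theta> * expectation Z + \<theta>\<^sup>2 * expectation (\<lambda>\<omega>. (Z \<omega>)\<^sup>2) / 2)"
    by (rule exp_ge_add_one_self)
  finally show ?thesis .
qed

text \<open>If \<open>D \<le> d / 2\<close>, then \<open>\<bar>D - d\<bar>\<close> is at least
  \<open>d / 2\<close>, so \<open>S^2 / d^2\<close> is paid for by the mixed square, while
  \<open>(S / D)^2\<close> is left to the dominating \<open>g\<close>. Otherwise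
  \<open>1 / D^2 - 1 / d^2\<close> is at most \<open>6 / d^3\<close> times
  \<open>\<bar>D - d\<bar>\<close>, and the linear deviation is split as
  \<open>\<eta> + (D - d)^2 / \<eta>\<close>. The free \<open>\<eta>\<close> plays the role of
  Cauchy-Schwarz: only the second moment of \<open>S\<close> and the mixed moment appear after
  integration.\<close>

lemma ratio_sq_deviation:
  fixes S D d \<eta> g :: real
  assumes "0 < d" "0 < \<eta>" "0 \<le> g" "(S / D)\<^sup>2 \<le> g"
  shows "\<bar>(S / D)\<^sup>2 - S\<^sup>2 / d\<^sup>2\<bar> \<le> 6 / d ^ 3 * (\<eta> * S\<^sup>2 + (S * (D - d))\<^sup>2 / \<eta>)
    + 4 / d ^ 4 * (S * (D - d))\<^sup>2 + g * (if D \<le> d / 2 then 1 else 0)"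
proof (cases "D \<le> d / 2")
  case True
  have "(d / 2)\<^sup>2 \<le> (D - d)\<^sup>2"
    using True assms(1) abs_le_square_iff[of "d / 2" "D - d"] by auto
  then have "S\<^sup>2 * (d / 2)\<^sup>2 \<le> S\<^sup>2 * (D - d)\<^sup>2" by (intro mult_left_mono) auto
  then have "4 / d ^ 4 * (S\<^sup>2 * (d / 2)\<^sup>2) \<le> 4 / d ^ 4 * (S\<^sup>2 * (D - d)\<^sup>2)"
    by (rule mult_left_mono) auto
  moreover have "4 / d ^ 4 * (S\<^sup>2 * (d / 2)\<^sup>2) = S\<^sup>2 / d\<^sup>2"
    using assms(1) by (simp add: field_simps power2_eq_square power4_eq_xxxx)
  ultimately have 1: "S\<^sup>2 / d\<^sup>2 \<le> 4 / d ^ 4 * (S * (D - d))\<^sup>2" by (simp add: power_mult_distrib)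
  have "0 \<le> 6 / d ^ 3 * (\<eta> * S\<^sup>2 + (S * (D - d))\<^sup>2 / \<eta>)" using assms by simp
  moreover have "\<bar>(S / D)\<^sup>2 - S\<^sup>2 / d\<^sup>2\<bar> \<le> (S / D)\<^sup>2 + S\<^sup>2 / d\<^sup>2"
    using zero_le_power2[of "S / D"] zero_le_divide_iff[of "S\<^sup>2" "d\<^sup>2"] by (simp add: abs_le_iff)
  ultimately show ?thesis using True 1 assms(4) by simp
next
  case False
  then have D: "D > d / 2" "D > 0" using assms(1) by auto
  have a: "1 / D \<le> 2 / d" using D assms(1) by (simp add: field_simps)
  then have b: "1 / D\<^sup>2 \<le> 4 / d\<^sup>2"
    using power_mono[OF a, of 2] D by (simp add: power_divide)
  have "\<bar>(S / D)\<^sup>2 - S\<^sup>2 / d\<^sup>2\<bar> = S\<^sup>2 * (\<bar>D - d\<bar> * (1 / D\<^sup>2 * (1 / d) + 1 / D * (1 / d\<^sup>2)))"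
  proof -
    have "(S / D)\<^sup>2 - S\<^sup>2 / d\<^sup>2 = S\<^sup>2 * ((d - D) * (1 / D\<^sup>2 * (1 / d) + 1 / D * (1 / d\<^sup>2)))"
      using D assms(1) by (simp add: field_simps power2_eq_square)
    moreover have "\<bar>1 / D\<^sup>2 * (1 / d) + 1 / D * (1 / d\<^sup>2)\<bar> = 1 / D\<^sup>2 * (1 / d) + 1 / D * (1 / d\<^sup>2)"
      using D assms(1) by simp
    ultimately show ?thesis by (simp add: abs_mult abs_minus_commute)
  qed
  also have "\<dots> \<le> S\<^sup>2 * (\<bar>D - d\<bar> * (4 / d\<^sup>2 * (1 / d) + 2 / d * (1 / d\<^sup>2)))"
    using a b assms(1) by (intro mult_left_mono add_mono mult_right_mono) auto
  also have "\<dots> = 6 / d ^ 3 * (S\<^sup>2 * \<bar>D - d\<bar>)"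
    using assms(1) by (simp add: field_simps power2_eq_square power3_eq_cube)
  also have "\<dots> \<le> 6 / d ^ 3 * (S\<^sup>2 * (\<eta> + (D - d)\<^sup>2 / \<eta>))"
  proof (intro mult_left_mono)
    have "0 \<le> (\<bar>D - d\<bar> - \<eta>)\<^sup>2 + \<eta> * \<bar>D - d\<bar>" using assms by simp
    then have "\<eta> * \<bar>D - d\<bar> \<le> \<eta> * \<eta> + \<bar>D - d\<bar>\<^sup>2" by (simp add: power2_diff power2_eq_square algebra_simps)
    then show "\<bar>D - d\<bar> \<le> \<eta> + (D - d)\<^sup>2 / \<eta>" using assms by (simp add: field_simps)
  qed (use assms in auto)
  also have "\<dots> = 6 / d ^ 3 * (\<eta> * S\<^sup>2 + (S * (D - d))\<^sup>2 / \<eta>)"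
    by (simp add: algebra_simps power2_eq_square add_divide_distrib diff_divide_distrib)
  finally show ?thesis using False by (simp add: add_increasing2)
qed

text \<open>Cauchy-Schwarz, with each weight split into two square roots, gives one factor
  \<open>D\<close>; bounding each weight by \<open>D\<close> gives the other. The right-hand side is
  free of the denominator, so it serves where \<open>D\<close> is close to 0. For
  \<open>D = 0\<close> the quotient is 0 by convention.\<close>

lemma weighted_mean_sq_le:
  fixes Z G :: "'i \<Rightarrow> real"
  assumes "finite A" "\<And>i. i \<in> A \<Longrightarrow> 0 \<le> Z i"
  shows "((\<Sum>i\<in>A. Z i * G i) / (\<Sum>i\<in>A. Z i))\<^sup>2 \<le> (\<Sum>i\<in>A. (G i)\<^sup>2)"
proof (cases "(\<Sum>i\<in>A. Z i) = 0")
  case True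
  then show ?thesis by (simp add: sum_nonneg)
next
  case False
  define D where "D = (\<Sum>i\<in>A. Z i)"
  have D: "D > 0" using False sum_nonneg[of A Z] assms unfolding D_def by auto
  have le: "Z i / D \<le> 1" if "i \<in> A" for i
    using member_le_sum[OF that, of Z] assms D by (simp add: D_def[symmetric] field_simps)
  have "(\<Sum>i\<in>A. Z i * G i)\<^sup>2 = (\<Sum>i\<in>A. sqrt (Z i) * (sqrt (Z i) * G i))\<^sup>2"
    using assms by (intro arg_cong[where f="\<lambda>x. x\<^sup>2"] sum.cong) (auto simp flip: mult.assoc)
  also have "\<dots> \<le> (\<Sum>i\<in>A. (sqrt (Z i))\<^sup>2) * (\<Sum>i\<in>A. (sqrt (Z i) * G i)\<^sup>2)"
    by (rule Cauchy_Schwarz_ineq_sum)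
  also have "\<dots> = D * (\<Sum>i\<in>A. Z i * (G i)\<^sup>2)"
    using assms by (simp add: D_def power_mult_distrib)
  also have "\<dots> \<le> D * (\<Sum>i\<in>A. D * (G i)\<^sup>2)"
    using D le by (intro mult_left_mono sum_mono mult_right_mono) (auto simp: field_simps)
  finally have "(\<Sum>i\<in>A. Z i * G i)\<^sup>2 \<le> D\<^sup>2 * (\<Sum>i\<in>A. (G i)\<^sup>2)"
    by (simp add: sum_distrib_left power2_eq_square mult.assoc)
  then show ?thesis using D by (simp add: D_def[symmetric] power_divide field_simps)
qed

text \<open>One row of the triangular array, with the sample size fixed. All estimates here are
  explicit and the limit is taken later. Weight and response of the same index may be
  dependent.\<close>

locale bounded_weight_array = prob_space M for M :: "'a measure" +
  fixes Z G :: "'i \<Rightarrow> 'a \<Rightarrow> real" and A :: "'i set" and c :: "'i \<Rightarrow> real"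
  assumes finite_index: "finite A"
    and indep: "indep_vars (\<lambda>_. borel) (\<lambda>i \<omega>. (Z i \<omega>, G i \<omega>)) A"
    and weight_bounds: "i \<in> A \<Longrightarrow> \<omega> \<in> space M \<Longrightarrow> 0 \<le> Z i \<omega> \<and> Z i \<omega> \<le> c i"
    and square_integrable: "i \<in> A \<Longrightarrow> integrable M (\<lambda>\<omega>. (G i \<omega>)\<^sup>2)"
begin

definition "num \<omega> = (\<Sum>i\<in>A. Z i \<omega> * G i \<omega>)"
definition "den \<omega> = (\<Sum>i\<in>A. Z i \<omega>)"
definition "mean_den = (\<Sum>i\<in>A. expectation (Z i))"
definition "mean_num = (\<Sum>i\<in>A. expectation (\<lambda>\<omega>. Z i \<omega> * G i \<omega>))"
definition "sq_num = (\<Sum>i\<in>A. expectation (\<lambda>\<omega>. (Z i \<omega> * G i \<omega>)\<^sup>2))"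
definition "sq_den = (\<Sum>i\<in>A. expectation (\<lambda>\<omega>. (Z i \<omega>)\<^sup>2))"

lemma rv:
  assumes "i \<in> A"
  shows "Z i \<in> borel_measurable M" "G i \<in> borel_measurable M"
proof -
  have "(\<lambda>\<omega>. (Z i \<omega>, G i \<omega>)) \<in> borel_measurable M"
    using indep assms by (auto simp: indep_vars_def)
  from measurable_compose[OF this borel_measurable_continuous_onI[OF continuous_on_fst[OF continuous_on_id]]]
    measurable_compose[OF this borel_measurable_continuous_onI[OF continuous_on_snd[OF continuous_on_id]]]
  show "Z i \<in> borel_measurable M" "G i \<in> borel_measurable M" by simp_all
qed

lemma num_den_measurable [measurable]: "num \<in> borel_measurable M" "den \<in> borel_measurable M"
  unfolding num_def[abs_def] den_def[abs_def] using rv by auto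

lemma summand_integrable:
  assumes i: "i \<in> A"
  shows "integrable M (Z i)" "integrable M (\<lambda>\<omega>. (Z i \<omega>)\<^sup>2)" "integrable M (\<lambda>\<omega>. Z i \<omega> * G i \<omega>)"
    "integrable M (\<lambda>\<omega>. (Z i \<omega> * G i \<omega>)\<^sup>2)"
proof -
  note [measurable] = rv[OF i]
  show "integrable M (Z i)" using weight_bounds[OF i] by (intro integrable_const_bound[where B="c i"]) auto
  show "integrable M (\<lambda>\<omega>. (Z i \<omega>)\<^sup>2)"
    using weight_bounds[OF i] by (intro integrable_const_bound[where B="(c i)\<^sup>2"]) (auto intro!: power_mono)
  have "integrable M (\<lambda>\<omega>. G i \<omega> * Z i \<omega>)"
    using weight_bounds[OF i] by (intro integrable_mult_bounded_of_sq[OF _ _ square_integrable[OF i], where c="c i"]) auto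
  then show "integrable M (\<lambda>\<omega>. Z i \<omega> * G i \<omega>)" by (simp add: mult.commute)
  have "integrable M (\<lambda>\<omega>. (G i \<omega>)\<^sup>2 * (Z i \<omega>)\<^sup>2)"
    using weight_bounds[OF i]
    by (intro integrable_sq_mult_bounded[OF _ _ square_integrable[OF i], where c="(c i)\<^sup>2"]) (auto intro!: power_mono)
  then show "integrable M (\<lambda>\<omega>. (Z i \<omega> * G i \<omega>)\<^sup>2)" by (simp add: mult.commute power_mult_distrib)
qed

text \<open>Centring turns \<open>num\<close> into \<open>U + mean_num\<close> and
  \<open>den - mean_den\<close> into \<open>V\<close>, sums of independent centred variables to
  which the mixed fourth moment bound applies. The deterministic part \<open>mean_num\<close>
  contributes only through the variance of \<open>V\<close>. Variances are finally bounded by raw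
  second moments.\<close>

lemma num_moments:
  shows "integrable M (\<lambda>\<omega>. (num \<omega>)\<^sup>2)"
    and "expectation (\<lambda>\<omega>. (num \<omega>)\<^sup>2)
      = mean_num\<^sup>2 + sq_num - (\<Sum>i\<in>A. (expectation (\<lambda>\<omega>. Z i \<omega> * G i \<omega>))\<^sup>2)"
    and "integrable M (\<lambda>\<omega>. (num \<omega> * (den \<omega> - mean_den))\<^sup>2)"
    and "expectation (\<lambda>\<omega>. (num \<omega> * (den \<omega> - mean_den))\<^sup>2)
      \<le> 2 * mean_num\<^sup>2 * sq_den + 6 * sq_num * sq_den
        + 2 * (\<Sum>i\<in>A. (c i)\<^sup>2 * expectation (\<lambda>\<omega>. (Z i \<omega> * G i \<omega>)\<^sup>2))"
proof -
  define t where "t = (\<lambda>i. expectation (\<lambda>\<omega>. Z i \<omega> * G i \<omega>))"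
  define z where "z = (\<lambda>i. expectation (Z i))"
  define u where "u = (\<lambda>i \<omega>. Z i \<omega> * G i \<omega> - t i)"
  define v where "v = (\<lambda>i \<omega>. Z i \<omega> - z i)"
  define U where "U = (\<lambda>\<omega>. \<Sum>i\<in>A. u i \<omega>)"
  define V where "V = (\<lambda>\<omega>. \<Sum>i\<in>A. v i \<omega>)"
  have z: "0 \<le> z i \<and> z i \<le> c i" if "i \<in> A" for i
  proof -
    have "expectation (Z i) \<le> expectation (\<lambda>_. c i)"
      using weight_bounds[OF that] summand_integrable[OF that] by (intro integral_mono) auto
    then show ?thesis using weight_bounds[OF that] by (auto simp: z_def prob_space intro!: integral_nonneg_AE AE_I2)
  qed
  have v: "\<bar>v i \<omega>\<bar> \<le> c i" if "i \<in> A" "\<omega> \<in> space M" for i \<omega>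
    using z[OF that(1)] weight_bounds[OF that] unfolding v_def by linarith
  have [measurable]: "u i \<in> borel_measurable M" "v i \<in> borel_measurable M" if "i \<in> A" for i
    using rv[OF that] unfolding u_def v_def by auto
  have u2: "integrable M (\<lambda>\<omega>. (u i \<omega>)\<^sup>2)" if "i \<in> A" for i
    unfolding u_def power2_diff using summand_integrable[OF that] by auto
  have ind: "indep_vars (\<lambda>_. borel) (\<lambda>i \<omega>. (u i \<omega>, v i \<omega>)) A"
  proof -
    have "(\<lambda>p. (fst p * snd p - t i, fst p - z i)) \<in> borel_measurable borel" for i
      by (intro borel_measurable_continuous_onI continuous_intros)
    from indep_vars_compose2[OF indep, of "\<lambda>i p. (fst p * snd p - t i, fst p - z i)" "\<lambda>_. borel"] this
    show ?thesis by (simp add: u_def v_def)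
  qed
  have u0: "expectation (u i) = 0" if "i \<in> A" for i
    using summand_integrable[OF that] by (simp add: u_def t_def prob_space)
  have v0: "expectation (v i) = 0" if "i \<in> A" for i
    using summand_integrable[OF that] by (simp add: v_def z_def prob_space)
  have eu2: "expectation (\<lambda>\<omega>. (u i \<omega>)\<^sup>2) = expectation (\<lambda>\<omega>. (Z i \<omega> * G i \<omega>)\<^sup>2) - (t i)\<^sup>2" if "i \<in> A" for i
    unfolding u_def power2_diff using summand_integrable[OF that]
    by (simp add: prob_space t_def power2_eq_square)
  have ev2: "expectation (\<lambda>\<omega>. (v i \<omega>)\<^sup>2) = expectation (\<lambda>\<omega>. (Z i \<omega>)\<^sup>2) - (z i)\<^sup>2" if "i \<in> A" for i
    unfolding v_def power2_diff using summand_integrable[OF that]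
    by (simp add: prob_space z_def power2_eq_square)
  have UV: "(\<Sum>i\<in>A. u i \<omega>) = U \<omega>" "(\<Sum>i\<in>A. v i \<omega>) = V \<omega>" for \<omega> by (simp_all add: U_def V_def)
  note M4 = indep_sum_mixed_fourth_moment[OF finite_index ind u2 v u0 v0, unfolded UV]
  have [measurable]: "U \<in> borel_measurable M" "V \<in> borel_measurable M" using M4 by auto
  have U2: "integrable M (\<lambda>\<omega>. (U \<omega>)\<^sup>2)" using M4 by auto
  have U1: "integrable M U" by (rule square_integrable_imp_integrable[OF _ U2]) measurable
  have num: "num \<omega> = U \<omega> + mean_num" for \<omega>
    by (simp add: num_def U_def u_def mean_num_def t_def sum_subtractf)
  have den: "den \<omega> - mean_den = V \<omega>" for \<omega>
    by (simp add: den_def V_def v_def mean_den_def z_def sum_subtractf)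
  show i1: "integrable M (\<lambda>\<omega>. (num \<omega>)\<^sup>2)"
    unfolding num power2_sum using U1 U2 by auto
  show "expectation (\<lambda>\<omega>. (num \<omega>)\<^sup>2)
      = mean_num\<^sup>2 + sq_num - (\<Sum>i\<in>A. (expectation (\<lambda>\<omega>. Z i \<omega> * G i \<omega>))\<^sup>2)"
    unfolding num power2_sum using U1 U2 M4
    by (simp add: prob_space eu2 sum_subtractf sq_num_def t_def)
  have Vb: "\<bar>V \<omega>\<bar> \<le> sum c A" if "\<omega> \<in> space M" for \<omega> using M4 that by auto
  have V2b: "\<bar>(V \<omega>)\<^sup>2\<bar> \<le> (sum c A)\<^sup>2" if "\<omega> \<in> space M" for \<omega>
    using power_mono[OF Vb[OF that], of 2] by simp
  have V2: "integrable M (\<lambda>\<omega>. (V \<omega>)\<^sup>2)"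
    using V2b by (intro integrable_const_bound[where B="(sum c A)\<^sup>2"]) auto
  have UV2: "integrable M (\<lambda>\<omega>. (U \<omega> * V \<omega>)\<^sup>2)"
    unfolding power_mult_distrib using V2b by (intro integrable_sq_mult_bounded[OF _ _ U2]) auto
  show i3: "integrable M (\<lambda>\<omega>. (num \<omega> * (den \<omega> - mean_den))\<^sup>2)"
    unfolding den power_mult_distrib using V2b by (intro integrable_sq_mult_bounded[OF _ _ i1]) auto
  have x0: "sum f A \<ge> 0" if "\<And>i. i \<in> A \<Longrightarrow> 0 \<le> f i" for f :: "'i \<Rightarrow> real" using that by (rule sum_nonneg)
  have "(num \<omega> * (den \<omega> - mean_den))\<^sup>2 \<le> 2 * mean_num\<^sup>2 * (V \<omega>)\<^sup>2 + 2 * (U \<omega> * V \<omega>)\<^sup>2" for \<omega>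
  proof -
    have "0 \<le> ((U \<omega> - mean_num) * V \<omega>)\<^sup>2" by simp
    then show ?thesis unfolding num den by (simp add: power2_eq_square algebra_simps)
  qed
  then have "expectation (\<lambda>\<omega>. (num \<omega> * (den \<omega> - mean_den))\<^sup>2)
    \<le> expectation (\<lambda>\<omega>. 2 * mean_num\<^sup>2 * (V \<omega>)\<^sup>2 + 2 * (U \<omega> * V \<omega>)\<^sup>2)"
    using V2 UV2 by (intro integral_mono i3) auto
  also have "\<dots> = 2 * mean_num\<^sup>2 * expectation (\<lambda>\<omega>. (V \<omega>)\<^sup>2) + 2 * expectation (\<lambda>\<omega>. (U \<omega> * V \<omega>)\<^sup>2)"
    using V2 UV2 by simp
  also have "\<dots> \<le> 2 * mean_num\<^sup>2 * sq_den + 2 * (3 * sq_num * sq_den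
        + (\<Sum>i\<in>A. (c i)\<^sup>2 * expectation (\<lambda>\<omega>. (Z i \<omega> * G i \<omega>)\<^sup>2)))"
  proof (intro add_mono mult_left_mono)
    have 1: "(\<Sum>i\<in>A. expectation (\<lambda>\<omega>. (v i \<omega>)\<^sup>2)) \<le> sq_den"
      unfolding sq_den_def by (intro sum_mono) (simp add: ev2)
    have 2: "(\<Sum>i\<in>A. expectation (\<lambda>\<omega>. (u i \<omega>)\<^sup>2)) \<le> sq_num"
      unfolding sq_num_def by (intro sum_mono) (simp add: eu2)
    show "expectation (\<lambda>\<omega>. (V \<omega>)\<^sup>2) \<le> sq_den" using 1 M4 by auto
    have 3: "expectation (\<lambda>\<omega>. (u i \<omega> * v i \<omega>)\<^sup>2) \<le> (c i)\<^sup>2 * expectation (\<lambda>\<omega>. (Z i \<omega> * G i \<omega>)\<^sup>2)"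
      if i: "i \<in> A" for i
    proof -
      have vb2: "(v i \<omega>)\<^sup>2 \<le> (c i)\<^sup>2" if "\<omega> \<in> space M" for \<omega>
        using power_mono[OF v[OF i that], of 2] by simp
      have "expectation (\<lambda>\<omega>. (u i \<omega> * v i \<omega>)\<^sup>2) \<le> expectation (\<lambda>\<omega>. (u i \<omega>)\<^sup>2 * (c i)\<^sup>2)"
        unfolding power_mult_distrib using vb2 i
        by (intro integral_mono integrable_sq_mult_bounded[OF _ _ u2[OF i]] mult_left_mono integrable_mult_left u2) auto
      also have "\<dots> \<le> expectation (\<lambda>\<omega>. (Z i \<omega> * G i \<omega>)\<^sup>2) * (c i)\<^sup>2"
        using i by (simp add: eu2 mult_right_mono)
      finally show ?thesis by (simp add: mult.commute)
    qed
    have "expectation (\<lambda>\<omega>. (U \<omega> * V \<omega>)\<^sup>2)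
       \<le> 3 * (\<Sum>i\<in>A. expectation (\<lambda>\<omega>. (u i \<omega>)\<^sup>2)) * (\<Sum>i\<in>A. expectation (\<lambda>\<omega>. (v i \<omega>)\<^sup>2))
         + (\<Sum>i\<in>A. expectation (\<lambda>\<omega>. (u i \<omega> * v i \<omega>)\<^sup>2))" using M4 by auto
    also have "\<dots> \<le> 3 * sq_num * sq_den + (\<Sum>i\<in>A. (c i)\<^sup>2 * expectation (\<lambda>\<omega>. (Z i \<omega> * G i \<omega>)\<^sup>2))"
      using 1 2 by (intro add_mono sum_mono 3 mult_mono mult_nonneg_nonneg sum_nonneg integral_nonneg_AE) (auto simp: sq_num_def intro!: sum_nonneg integral_nonneg_AE)
    finally show "expectation (\<lambda>\<omega>. (U \<omega> * V \<omega>)\<^sup>2) \<le> \<dots>" .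
  qed auto
  finally show "expectation (\<lambda>\<omega>. (num \<omega> * (den \<omega> - mean_den))\<^sup>2)
      \<le> 2 * mean_num\<^sup>2 * sq_den + 6 * sq_num * sq_den
        + 2 * (\<Sum>i\<in>A. (c i)\<^sup>2 * expectation (\<lambda>\<omega>. (Z i \<omega> * G i \<omega>)\<^sup>2))" by simp
qed

text \<open>Independence factorises the Laplace transform over \<open>B\<close>. Two choices of
  \<open>B\<close> are used: the whole index set, and the index set without one element. The
  quadratic term is enlarged to \<open>sq_den\<close> so that both have the same form.\<close>

lemma laplace_den:
  assumes "B \<subseteq> A" "0 \<le> \<theta>"
  shows "integrable M (\<lambda>\<omega>. exp (- \<theta> * (\<Sum>i\<in>B. Z i \<omega>)))"
    and "expectation (\<lambda>\<omega>. exp (- \<theta> * (\<Sum>i\<in>B. Z i \<omega>)))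
      \<le> exp (- \<theta> * (\<Sum>i\<in>B. expectation (Z i)) + \<theta>\<^sup>2 * sq_den / 2)"
proof -
  have fin: "finite B" using assms(1) finite_index finite_subset by blast
  have eq: "exp (- \<theta> * (\<Sum>i\<in>B. Z i \<omega>)) = (\<Prod>i\<in>B. exp (- \<theta> * Z i \<omega>))" for \<omega>
    using fin by (simp add: sum_distrib_left sum_negf[symmetric] exp_sum)
  have indB: "indep_vars (\<lambda>_. borel) (\<lambda>i \<omega>. exp (- \<theta> * Z i \<omega>)) B"
  proof -
    have "(\<lambda>p::real\<times>real. exp (- \<theta> * fst p)) \<in> borel_measurable borel"
      by (intro borel_measurable_continuous_onI continuous_intros)
    from indep_vars_compose2[OF indep_vars_subset[OF indep assms(1)], of "\<lambda>i p. exp (- \<theta> * fst p)" "\<lambda>_. borel"] this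
    show ?thesis by simp
  qed
  have int: "integrable M (\<lambda>\<omega>. exp (- \<theta> * Z i \<omega>))" if "i \<in> B" for i
    using that assms weight_bounds rv by (intro integrable_const_bound[where B=1]) auto
  show "integrable M (\<lambda>\<omega>. exp (- \<theta> * (\<Sum>i\<in>B. Z i \<omega>)))"
    unfolding eq by (rule indep_vars_integrable[OF fin indB int])
  have "expectation (\<lambda>\<omega>. exp (- \<theta> * (\<Sum>i\<in>B. Z i \<omega>))) = (\<Prod>i\<in>B. expectation (\<lambda>\<omega>. exp (- \<theta> * Z i \<omega>)))"
    unfolding eq by (rule indep_vars_lebesgue_integral[OF fin indB int])
  also have "\<dots> \<le> (\<Prod>i\<in>B. exp (- \<theta> * expectation (Z i) + \<theta>\<^sup>2 * expectation (\<lambda>\<omega>. (Z i \<omega>)\<^sup>2) / 2))"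
  proof (intro prod_mono conjI integral_nonneg_AE AE_I2)
    fix i assume "i \<in> B"
    then have "i \<in> A" using assms by auto
    then show "expectation (\<lambda>\<omega>. exp (- \<theta> * Z i \<omega>))
        \<le> exp (- \<theta> * expectation (Z i) + \<theta>\<^sup>2 * expectation (\<lambda>\<omega>. (Z i \<omega>)\<^sup>2) / 2)"
      using rv weight_bounds assms(2) by (intro expectation_exp_minus_le[where c="c i"]) auto
  qed auto
  also have "\<dots> = exp (- \<theta> * (\<Sum>i\<in>B. expectation (Z i)) + \<theta>\<^sup>2 * (\<Sum>i\<in>B. expectation (\<lambda>\<omega>. (Z i \<omega>)\<^sup>2)) / 2)"
    using fin by (simp add: exp_sum[symmetric] sum.distrib sum_distrib_left sum_negf sum_divide_distrib sum_subtractf)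
  also have "\<dots> \<le> exp (- \<theta> * (\<Sum>i\<in>B. expectation (Z i)) + \<theta>\<^sup>2 * sq_den / 2)"
    unfolding sq_den_def using assms finite_index
    by (auto intro!: mult_left_mono divide_right_mono sum_mono2 integral_nonneg_AE)
  finally show "expectation (\<lambda>\<omega>. exp (- \<theta> * (\<Sum>i\<in>B. Z i \<omega>)))
      \<le> exp (- \<theta> * (\<Sum>i\<in>B. expectation (Z i)) + \<theta>\<^sup>2 * sq_den / 2)" .
qed

text \<open>Chernoff's method for the lower tail: the indicator of the event is at most
  \<open>exp (\<theta> * mean_den / 2)\<close> times the exponential of
  \<open>- \<theta> * den\<close>.\<close>

lemma prob_den_small:
  assumes "0 \<le> \<theta>"
  shows "prob {\<omega> \<in> space M. den \<omega> \<le> mean_den / 2} \<le> exp (\<theta>\<^sup>2 * sq_den / 2 - \<theta> * mean_den / 2)"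
proof -
  have "prob {\<omega> \<in> space M. den \<omega> \<le> mean_den / 2}
    = expectation (indicator {\<omega> \<in> space M. den \<omega> \<le> mean_den / 2})" by simp
  also have "\<dots> \<le> expectation (\<lambda>\<omega>. exp (\<theta> * mean_den / 2) * exp (- \<theta> * (\<Sum>i\<in>A. Z i \<omega>)))"
  proof (intro integral_mono integrable_mult_right laplace_den assms)
    fix \<omega>
    show "indicator {\<omega> \<in> space M. den \<omega> \<le> mean_den / 2} \<omega> \<le> exp (\<theta> * mean_den / 2) * exp (- \<theta> * (\<Sum>i\<in>A. Z i \<omega>))"
      using mult_left_mono[OF _ assms, of "den \<omega>" "mean_den / 2"]
      by (auto simp: indicator_def exp_add[symmetric] den_def)
  qed (auto simp: emeasure_eq_measure intro!: integrable_real_indicator)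
  also have "\<dots> \<le> exp (\<theta> * mean_den / 2) * exp (- \<theta> * mean_den + \<theta>\<^sup>2 * sq_den / 2)"
    using laplace_den[OF order_refl assms] by (simp add: mean_den_def)
  also have "\<dots> = exp (\<theta>\<^sup>2 * sq_den / 2 - \<theta> * mean_den / 2)"
    by (simp add: exp_add[symmetric] field_simps)
  finally show ?thesis .
qed

text \<open>\<open>G i\<close> is dependent on the \<open>i\<close>-th weight but independent of the
  other ones. Leaving this weight out of the exponential majorant of the indicator makes the
  expectation factorise, at the price of \<open>exp (\<theta> * \<rho>)\<close> for the mean that is
  lost.\<close>

lemma response_den_small:
  assumes "0 \<le> \<theta>" "\<And>i. i \<in> A \<Longrightarrow> expectation (Z i) \<le> \<rho>"
  shows "integrable M (\<lambda>\<omega>. (\<Sum>i\<in>A. (G i \<omega>)\<^sup>2) * (if den \<omega> \<le> mean_den / 2 then 1 else 0))" (is ?A)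
    and "expectation (\<lambda>\<omega>. (\<Sum>i\<in>A. (G i \<omega>)\<^sup>2) * (if den \<omega> \<le> mean_den / 2 then 1 else 0))
      \<le> (\<Sum>i\<in>A. expectation (\<lambda>\<omega>. (G i \<omega>)\<^sup>2)) * exp (\<theta> * \<rho> + \<theta>\<^sup>2 * sq_den / 2 - \<theta> * mean_den / 2)" (is ?B)
proof -
  define I where "I = (\<lambda>\<omega>. if den \<omega> \<le> mean_den / 2 then 1 else 0 :: real)"
  have [measurable]: "I \<in> borel_measurable M" unfolding I_def by measurable
  have int: "integrable M (\<lambda>\<omega>. (G i \<omega>)\<^sup>2 * I \<omega>)" if "i \<in> A" for i
    using rv[OF that] by (intro integrable_sq_mult_bounded[OF _ _ square_integrable[OF that], where c=1]) (auto simp: I_def)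
  have iI: "integrable M (\<lambda>\<omega>. (\<Sum>i\<in>A. (G i \<omega>)\<^sup>2) * I \<omega>)"
    unfolding sum_distrib_right by (intro Bochner_Integration.integrable_sum int)
  then show ?A unfolding I_def .
  have one: "expectation (\<lambda>\<omega>. (G i \<omega>)\<^sup>2 * I \<omega>)
    \<le> expectation (\<lambda>\<omega>. (G i \<omega>)\<^sup>2) * exp (\<theta> * \<rho> + \<theta>\<^sup>2 * sq_den / 2 - \<theta> * mean_den / 2)" if i: "i \<in> A" for i
  proof -
    define B where "B = A - {i}"
    have B: "finite B" "i \<notin> B" "insert i B = A" "B \<subseteq> A" using finite_index i by (auto simp: B_def)
    have m1: "(\<lambda>(x, y). exp (- \<theta> * x)) \<in> borel_measurable (borel :: (real \<times> real) measure)"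
      unfolding split_beta' by (intro borel_measurable_continuous_onI continuous_intros)
    have m2: "(\<lambda>(x, y). y\<^sup>2) \<in> borel_measurable (borel :: (real \<times> real) measure)"
      unfolding split_beta' by (intro borel_measurable_continuous_onI continuous_intros)
    note L = laplace_den[OF B(4) assms(1)]
    note P = indep_vars_sum_pair_integral[OF B(1,2) indep[folded B(3)] m1 m2 L(1) square_integrable[OF i]]
    have "expectation (\<lambda>\<omega>. (G i \<omega>)\<^sup>2 * I \<omega>)
      \<le> expectation (\<lambda>\<omega>. exp (\<theta> * mean_den / 2) * (exp (- \<theta> * (\<Sum>i\<in>B. Z i \<omega>)) * (G i \<omega>)\<^sup>2))"
    proof (intro integral_mono int i integrable_mult_right P)
      fix \<omega> assume \<omega>: "\<omega> \<in> space M"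
      have "I \<omega> \<le> exp (\<theta> * mean_den / 2) * exp (- \<theta> * (\<Sum>i\<in>B. Z i \<omega>))"
      proof (cases "den \<omega> \<le> mean_den / 2")
        case True
        \<comment> \<open>Nonnegative weights: omitting one of them can only decrease the sum, so
          the smaller sum also lies below half the mean.\<close>
        have "(\<Sum>i\<in>B. Z i \<omega>) \<le> den \<omega>"
          unfolding den_def using B weight_bounds[OF _ \<omega>] finite_index by (intro sum_mono2) auto
        with True have "\<theta> * (\<Sum>i\<in>B. Z i \<omega>) \<le> \<theta> * (mean_den / 2)"
          using assms(1) by (intro mult_left_mono) auto
        then show ?thesis using True by (simp add: I_def exp_add[symmetric])
      qed (simp add: I_def)
      from mult_right_mono[OF this, of "(G i \<omega>)\<^sup>2"]
      show "(G i \<omega>)\<^sup>2 * I \<omega> \<le> exp (\<theta> * mean_den / 2) * (exp (- \<theta> * (\<Sum>i\<in>B. Z i \<omega>)) * (G i \<omega>)\<^sup>2)"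
        by (simp add: mult_ac)
    qed
    also have "\<dots> = exp (\<theta> * mean_den / 2) * (expectation (\<lambda>\<omega>. exp (- \<theta> * (\<Sum>i\<in>B. Z i \<omega>))) * expectation (\<lambda>\<omega>. (G i \<omega>)\<^sup>2))"
      using P(2) by simp
    also have "\<dots> \<le> exp (\<theta> * mean_den / 2) * (exp (\<theta> * \<rho> - \<theta> * mean_den + \<theta>\<^sup>2 * sq_den / 2) * expectation (\<lambda>\<omega>. (G i \<omega>)\<^sup>2))"
    proof (intro mult_left_mono mult_right_mono order_trans[OF L(2)])
      have "mean_den = (\<Sum>i\<in>B. expectation (Z i)) + expectation (Z i)"
        using sum.insert[OF B(1,2), of "\<lambda>i. expectation (Z i)"] by (simp add: mean_den_def B(3))
      then have "mean_den - (\<Sum>i\<in>B. expectation (Z i)) \<le> \<rho>" using assms(2)[OF i] by simp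
      then have "\<theta> * (mean_den - (\<Sum>i\<in>B. expectation (Z i))) \<le> \<theta> * \<rho>" using assms(1) by (rule mult_left_mono)
      then show "exp (- \<theta> * (\<Sum>i\<in>B. expectation (Z i)) + \<theta>\<^sup>2 * sq_den / 2) \<le> exp (\<theta> * \<rho> - \<theta> * mean_den + \<theta>\<^sup>2 * sq_den / 2)"
        by (simp add: algebra_simps)
    qed (auto intro!: integral_nonneg_AE)
    also have "\<dots> = expectation (\<lambda>\<omega>. (G i \<omega>)\<^sup>2) * (exp (\<theta> * mean_den / 2) * exp (\<theta> * \<rho> - \<theta> * mean_den + \<theta>\<^sup>2 * sq_den / 2))"
      by simp
    also have "exp (\<theta> * mean_den / 2) * exp (\<theta> * \<rho> - \<theta> * mean_den + \<theta>\<^sup>2 * sq_den / 2)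
       = exp (\<theta> * \<rho> + \<theta>\<^sup>2 * sq_den / 2 - \<theta> * mean_den / 2)"
      by (simp add: exp_add[symmetric] field_simps)
    finally show ?thesis .
  qed
  have "expectation (\<lambda>\<omega>. (\<Sum>i\<in>A. (G i \<omega>)\<^sup>2) * I \<omega>)
      \<le> (\<Sum>i\<in>A. expectation (\<lambda>\<omega>. (G i \<omega>)\<^sup>2)) * exp (\<theta> * \<rho> + \<theta>\<^sup>2 * sq_den / 2 - \<theta> * mean_den / 2)"
    unfolding sum_distrib_right using int
    by (subst Bochner_Integration.integral_sum) (auto intro!: sum_mono one)
  then show ?B unfolding I_def .
qed

text \<open>Integrates \<open>ratio_sq_deviation\<close> with the dominating function from
  \<open>weighted_mean_sq_le\<close>. The parameters \<open>\<eta>\<close> and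
  \<open>\<theta>\<close> remain free because both must be tuned to the sample size.\<close>

lemma ratio_second_moment:
  assumes "0 < mean_den" "0 < \<eta>" "0 \<le> \<theta>" "\<And>i. i \<in> A \<Longrightarrow> expectation (Z i) \<le> \<rho>"
  defines "Q \<equiv> expectation (\<lambda>\<omega>. (num \<omega> * (den \<omega> - mean_den))\<^sup>2)"
  shows "integrable M (\<lambda>\<omega>. (num \<omega> / den \<omega>)\<^sup>2)"
    and "\<bar>expectation (\<lambda>\<omega>. (num \<omega> / den \<omega>)\<^sup>2) - expectation (\<lambda>\<omega>. (num \<omega>)\<^sup>2) / mean_den\<^sup>2\<bar>
      \<le> 6 / mean_den ^ 3 * (\<eta> * expectation (\<lambda>\<omega>. (num \<omega>)\<^sup>2) + Q / \<eta>) + 4 / mean_den ^ 4 * Q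
        + (\<Sum>i\<in>A. expectation (\<lambda>\<omega>. (G i \<omega>)\<^sup>2)) * exp (\<theta> * \<rho> + \<theta>\<^sup>2 * sq_den / 2 - \<theta> * mean_den / 2)"
proof -
  have le: "(num \<omega> / den \<omega>)\<^sup>2 \<le> (\<Sum>i\<in>A. (G i \<omega>)\<^sup>2)" if "\<omega> \<in> space M" for \<omega>
    unfolding num_def den_def using that weight_bounds by (intro weighted_mean_sq_le finite_index) auto
  have iG: "integrable M (\<lambda>\<omega>. \<Sum>i\<in>A. (G i \<omega>)\<^sup>2)"
    by (intro Bochner_Integration.integrable_sum square_integrable)
  show i1: "integrable M (\<lambda>\<omega>. (num \<omega> / den \<omega>)\<^sup>2)"
    by (rule Bochner_Integration.integrable_bound[OF iG])
       (auto intro!: AE_I2 le simp: sum_nonneg)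
  note i2 = num_moments(1,3)
  note T = response_den_small[OF assms(3,4)]
  define R where "R = (\<lambda>\<omega>. 6 / mean_den ^ 3 * (\<eta> * (num \<omega>)\<^sup>2 + (num \<omega> * (den \<omega> - mean_den))\<^sup>2 / \<eta>)
    + 4 / mean_den ^ 4 * (num \<omega> * (den \<omega> - mean_den))\<^sup>2
    + (\<Sum>i\<in>A. (G i \<omega>)\<^sup>2) * (if den \<omega> \<le> mean_den / 2 then 1 else 0))"
  have iR: "integrable M R"
    unfolding R_def using i2 T(1) by (intro Bochner_Integration.integrable_add integrable_mult_right integrable_divide) auto
  have "\<bar>expectation (\<lambda>\<omega>. (num \<omega> / den \<omega>)\<^sup>2) - expectation (\<lambda>\<omega>. (num \<omega>)\<^sup>2) / mean_den\<^sup>2\<bar>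
    = \<bar>expectation (\<lambda>\<omega>. (num \<omega> / den \<omega>)\<^sup>2 - (num \<omega>)\<^sup>2 / mean_den\<^sup>2)\<bar>"
    using i1 i2 by simp
  also have "\<dots> \<le> expectation (\<lambda>\<omega>. \<bar>(num \<omega> / den \<omega>)\<^sup>2 - (num \<omega>)\<^sup>2 / mean_den\<^sup>2\<bar>)"
    by (rule integral_abs_bound)
  also have "\<dots> \<le> expectation R"
    unfolding R_def using i1 i2 iR[unfolded R_def] assms(1,2) le
    by (intro integral_mono ratio_sq_deviation) (auto simp: sum_nonneg)
  also have "expectation R = 6 / mean_den ^ 3 * (\<eta> * expectation (\<lambda>\<omega>. (num \<omega>)\<^sup>2) + Q / \<eta>) + 4 / mean_den ^ 4 * Q
    + expectation (\<lambda>\<omega>. (\<Sum>i\<in>A. (G i \<omega>)\<^sup>2) * (if den \<omega> \<le> mean_den / 2 then 1 else 0))"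
    unfolding R_def Q_def using i2 T(1)
    by (subst Bochner_Integration.integral_add; (subst Bochner_Integration.integral_add)?) auto
  finally show "\<bar>expectation (\<lambda>\<omega>. (num \<omega> / den \<omega>)\<^sup>2) - expectation (\<lambda>\<omega>. (num \<omega>)\<^sup>2) / mean_den\<^sup>2\<bar>
      \<le> 6 / mean_den ^ 3 * (\<eta> * expectation (\<lambda>\<omega>. (num \<omega>)\<^sup>2) + Q / \<eta>) + 4 / mean_den ^ 4 * Q
        + (\<Sum>i\<in>A. expectation (\<lambda>\<omega>. (G i \<omega>)\<^sup>2)) * exp (\<theta> * \<rho> + \<theta>\<^sup>2 * sq_den / 2 - \<theta> * mean_den / 2)"
    using T(2) by simp
qed

end

section \<open>Averages with triangular weights\<close>

text \<open>A Toeplitz lemma with limiting total mass \<open>\<beta>\<close> in place of 1. Finitely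
  many early terms die because each of their weights does; the remaining \<open>x i\<close> are
  uniformly close to \<open>L\<close> and carry bounded mass.\<close>

lemma weighted_average_tendsto:
  fixes a :: "nat \<Rightarrow> nat \<Rightarrow> real" and x :: "nat \<Rightarrow> real"
  assumes nonneg: "\<And>n i. 0 \<le> a n i"
    and total: "(\<lambda>n. \<Sum>i=1..n. a n i) \<longlonglongrightarrow> \<beta>"
    and single: "\<And>i. i \<ge> 1 \<Longrightarrow> (\<lambda>n. a n i) \<longlonglongrightarrow> 0"
    and lim: "x \<longlonglongrightarrow> L"
  shows "(\<lambda>n. \<Sum>i=1..n. a n i * x i) \<longlonglongrightarrow> \<beta> * L"
proof -
  have "(\<lambda>n. \<Sum>i=1..n. a n i * (x i - L)) \<longlonglongrightarrow> 0"
  proof (rule LIMSEQ_I)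
    fix e :: real assume e: "0 < e"
    \<comment> \<open>The total mass is eventually below \<open>\<bar>\<beta>\<bar> + 1\<close>, so
      the late terms contribute at most \<open>e / 2\<close>. Adding 1 also avoids division by
      0.\<close>
    define \<eta> where "\<eta> = e / (2 * (\<bar>\<beta>\<bar> + 1))"
    have \<eta>: "0 < \<eta>" using e by (simp add: \<eta>_def add_nonneg_pos)
    obtain m where m: "\<And>i. i \<ge> m \<Longrightarrow> \<bar>x i - L\<bar> < \<eta>"
      using LIMSEQ_D[OF lim \<eta>] by auto
    have "(\<lambda>n. \<Sum>i\<in>{1..<m}. a n i * \<bar>x i - L\<bar>) \<longlonglongrightarrow> (\<Sum>i\<in>{1..<m}. 0 * \<bar>x i - L\<bar>)"
      by (intro tendsto_sum tendsto_mult single tendsto_const) auto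
    then have "eventually (\<lambda>n. (\<Sum>i\<in>{1..<m}. a n i * \<bar>x i - L\<bar>) < e / 2) sequentially"
      using e by (intro order_tendstoD(2)) auto
    moreover have "eventually (\<lambda>n. (\<Sum>i=1..n. a n i) < \<bar>\<beta>\<bar> + 1) sequentially"
      by (intro order_tendstoD(2)[OF total]) auto
    ultimately have "eventually (\<lambda>n. norm ((\<Sum>i=1..n. a n i * (x i - L)) - 0) < e) sequentially"
    proof eventually_elim
      case (elim n)
      have "\<bar>\<Sum>i=1..n. a n i * (x i - L)\<bar> \<le> (\<Sum>i=1..n. a n i * \<bar>x i - L\<bar>)"
        using nonneg by (intro order_trans[OF sum_abs]) (simp add: abs_mult)
      also have "\<dots> \<le> (\<Sum>i=1..n. (if i \<in> {1..<m} then a n i * \<bar>x i - L\<bar> else 0) + a n i * \<eta>)"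
        using nonneg m \<eta> by (intro sum_mono) (auto simp: not_less less_imp_le intro!: mult_left_mono)
      also have "\<dots> = (\<Sum>i\<in>{1..n} \<inter> {1..<m}. a n i * \<bar>x i - L\<bar>) + (\<Sum>i=1..n. a n i) * \<eta>"
        by (simp add: sum.distrib sum_distrib_right sum.inter_restrict)
      also have "\<dots> \<le> (\<Sum>i\<in>{1..<m}. a n i * \<bar>x i - L\<bar>) + (\<bar>\<beta>\<bar> + 1) * \<eta>"
        using nonneg elim \<eta> by (intro add_mono sum_mono2 mult_right_mono) auto
      also have "\<dots> = (\<Sum>i\<in>{1..<m}. a n i * \<bar>x i - L\<bar>) + e / 2"
      proof -
        have "x * (e / (2 * x)) = e / 2" if "x \<noteq> 0" for x :: real using that by simp
        moreover have "\<bar>\<beta>\<bar> + 1 \<noteq> 0" using abs_ge_zero[of \<beta>] by linarith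
        ultimately show ?thesis unfolding \<eta>_def by metis
      qed
      finally show ?case using elim by simp
    qed
    then show "\<exists>no. \<forall>n\<ge>no. norm ((\<Sum>i=1..n. a n i * (x i - L)) - 0) < e"
      by (simp add: eventually_sequentially)
  qed
  from tendsto_add[OF this tendsto_mult_right[OF total, of L]]
  show ?thesis by (simp add: right_diff_distrib sum_subtractf sum_distrib_right)
qed

section \<open>Kernel moments on small balls\<close>

lemma deriv01_has_vector_derivative:
  assumes "f differentiable_on {0..1}" "s \<in> {0..1}"
  shows "(f has_vector_derivative deriv01 f s) (at s within {0..1})"
  using assms unfolding deriv01_def differentiable_on_def by (simp add: vector_derivative_works[symmetric])

lemma deriv01_eqI:
  assumes "(f has_vector_derivative d) (at s within {0..1})" "s \<in> {0..1}"
  shows "deriv01 f s = d"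
  unfolding deriv01_def using vector_derivative_within_cbox[of 0 1 s f d] assms by simp

text \<open>The derivative need not be continuous. The fundamental theorem for the gauge integral
  needs differentiability only, and the integrability hypothesis identifies that integral with the
  Lebesgue one.\<close>

lemma LINT_deriv01:
  assumes f: "f differentiable_on {0..1}" and int: "set_integrable lborel {0..1} (deriv01 f)" and t: "0 \<le> t" "t \<le> 1"
  shows "(LINT s:{t..1}|lborel. deriv01 f s) = f 1 - f t"
proof -
  have "set_integrable lborel {t..1} (deriv01 f)"
    by (rule set_integrable_subset[OF int]) (use t in auto)
  then have "(LINT s:{t..1}|lborel. deriv01 f s) = integral {t..1} (deriv01 f)"
    by (rule set_borel_integral_eq_integral)
  also have "(deriv01 f has_integral f 1 - f t) {t..1}"
    using t by (intro fundamental_theorem_of_calculus has_vector_derivative_within_subset[OF deriv01_has_vector_derivative[OF f]]) auto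
  then have "integral {t..1} (deriv01 f) = f 1 - f t" by (rule integral_unique)
  finally show ?thesis .
qed

text \<open>On the ball, \<open>f (R / h)\<close> is \<open>f 1\<close> minus the integral of the
  derivative from \<open>R / h\<close> to 1. Exchanging that integral with the expectation by Fubini
  turns the condition \<open>R / h \<le> s\<close> into the small ball probability at
  \<open>h * s\<close>: an integration by parts against the law of \<open>R\<close>.\<close>

lemma (in prob_space) kernel_moment_eq:
  fixes R :: "'a \<Rightarrow> real"
  assumes [measurable]: "R \<in> borel_measurable M" and R0: "\<And>\<omega>. \<omega> \<in> space M \<Longrightarrow> 0 \<le> R \<omega>" and h: "0 < h"
    and f: "f differentiable_on {0..1}" and int: "set_integrable lborel {0..1} (deriv01 f)"
  shows "expectation (\<lambda>\<omega>. indicator {..h} (R \<omega>) * f (R \<omega> / h))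
    = f 1 * prob {\<omega> \<in> space M. R \<omega> \<le> h}
      - (LINT s:{0..1}|lborel. deriv01 f s * prob {\<omega> \<in> space M. R \<omega> \<le> h * s})"
proof -
  interpret P: pair_sigma_finite M lborel ..
  define D where "D = (\<lambda>s. indicator {0..1} s * deriv01 f s)"
  have D: "integrable lborel D" using int by (simp add: D_def set_integrable_def)
  have [measurable]: "D \<in> borel_measurable borel" using borel_measurable_integrable[OF D] by simp
  define g where "g = (\<lambda>\<omega> s. D s * (if R \<omega> \<le> h * s then 1 else 0 :: real))"
  have iD: "integrable (M \<Otimes>\<^sub>M lborel) (\<lambda>p. D (snd p))"
    by (rule P.Fubini_integrable) (use D in auto)
  have ig: "integrable (M \<Otimes>\<^sub>M lborel) (case_prod g)"
    by (rule Bochner_Integration.integrable_bound[OF iD]) (auto simp: g_def split_beta')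
  have inner: "(LINT s|lborel. g \<omega> s) = indicator {..h} (R \<omega>) * (f 1 - f (R \<omega> / h))" if \<omega>: "\<omega> \<in> space M" for \<omega>
  proof (cases "R \<omega> \<le> h")
    case True
    have "(LINT s|lborel. g \<omega> s) = (LINT s:{R \<omega> / h..1}|lborel. deriv01 f s)"
      unfolding set_lebesgue_integral_def
    proof (intro Bochner_Integration.integral_cong refl)
      fix s
      have "0 \<le> s" if "R \<omega> \<le> h * s" using order_trans[OF R0[OF \<omega>] that] h by (simp add: zero_le_mult_iff)
      moreover have "R \<omega> \<le> h * s \<longleftrightarrow> R \<omega> / h \<le> s" using h by (simp add: field_simps)
      ultimately show "g \<omega> s = indicator {R \<omega> / h..1} s *\<^sub>R deriv01 f s"
        by (auto simp: g_def D_def indicator_def)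
    qed
    also have "\<dots> = f 1 - f (R \<omega> / h)" using True h R0[OF \<omega>] by (intro LINT_deriv01 f int) auto
    finally show ?thesis using True by simp
  next
    case False
    have "g \<omega> s = 0" for s
    proof -
      have "h * s \<le> h" if "s \<le> 1" using that h by simp
      then show ?thesis using False by (auto simp: g_def D_def indicator_def)
    qed
    then show ?thesis using False by simp
  qed
  have "(LINT s:{0..1}|lborel. deriv01 f s * prob {\<omega> \<in> space M. R \<omega> \<le> h * s}) = (LINT s|lborel. (LINT \<omega>|M. g \<omega> s))"
    unfolding set_lebesgue_integral_def
  proof (intro Bochner_Integration.integral_cong refl)
    fix s
    have "(LINT \<omega>|M. g \<omega> s) = D s * (LINT \<omega>|M. indicator {\<omega> \<in> space M. R \<omega> \<le> h * s} \<omega>)"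
      unfolding g_def integral_mult_right_zero
      by (intro arg_cong2[where f="(*)"] refl Bochner_Integration.integral_cong) (auto simp: indicator_def)
    then show "indicator {0..1} s *\<^sub>R (deriv01 f s * prob {\<omega> \<in> space M. R \<omega> \<le> h * s}) = (LINT \<omega>|M. g \<omega> s)"
      by (simp add: D_def)
  qed
  also have "\<dots> = (LINT \<omega>|M. (LINT s|lborel. g \<omega> s))" by (rule P.Fubini_integral[OF ig])
  also have "\<dots> = (LINT \<omega>|M. indicator {..h} (R \<omega>) * (f 1 - f (R \<omega> / h)))"
    by (intro Bochner_Integration.integral_cong inner) auto
  finally have eq: "(LINT s:{0..1}|lborel. deriv01 f s * prob {\<omega> \<in> space M. R \<omega> \<le> h * s})
    = (LINT \<omega>|M. indicator {..h} (R \<omega>) * (f 1 - f (R \<omega> / h)))" .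
  have i1: "integrable M (\<lambda>\<omega>. indicator {..h} (R \<omega>) * (f 1 - f (R \<omega> / h)))"
    using P.integrable_fst'[OF ig] by (simp add: inner cong: Bochner_Integration.integrable_cong)
  have i2: "integrable M (\<lambda>\<omega>. indicator {..h} (R \<omega>) * f 1)"
    by (intro integrable_mult_left integrable_const_bound[where B=1]) (auto simp: indicator_def)
  have "(LINT \<omega>|M. indicator {..h} (R \<omega>) * f (R \<omega> / h))
    = (LINT \<omega>|M. indicator {..h} (R \<omega>) * f 1 - indicator {..h} (R \<omega>) * (f 1 - f (R \<omega> / h)))"
    by (intro Bochner_Integration.integral_cong) (auto simp: algebra_simps)
  also have "\<dots> = f 1 * (LINT \<omega>|M. indicator {..h} (R \<omega>)) - (LINT \<omega>|M. indicator {..h} (R \<omega>) * (f 1 - f (R \<omega> / h)))"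
    using i1 i2 by simp
  also have "(LINT \<omega>|M. indicator {..h} (R \<omega>)) = (LINT \<omega>|M. indicator {\<omega> \<in> space M. R \<omega> \<le> h} \<omega>)"
    by (intro Bochner_Integration.integral_cong) (auto simp: indicator_def)
  finally show ?thesis by (simp add: eq)
qed

text \<open>Dominated convergence in the formula of \<open>kernel_moment_eq\<close>. Monotonicity of
  \<open>F\<close> keeps \<open>F (h * s) / F h\<close> at most 1 for \<open>s\<close> in the unit
  interval, so the derivative itself is the dominating function.\<close>

lemma (in prob_space) kernel_moment_tendsto:
  fixes R :: "'a \<Rightarrow> real" and \<tau>\<^sub>0 :: "real \<Rightarrow> real" and h :: "nat \<Rightarrow> real"
  assumes [measurable]: "R \<in> borel_measurable M" and R0: "\<And>\<omega>. \<omega> \<in> space M \<Longrightarrow> 0 \<le> R \<omega>"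
    and f: "f differentiable_on {0..1}" and int: "set_integrable lborel {0..1} (deriv01 f)"
    and h: "\<And>n. 0 < h n" "h \<longlonglongrightarrow> 0"
    and F: "\<And>t. F t = prob {\<omega> \<in> space M. R \<omega> \<le> t}" "\<And>t. 0 < t \<Longrightarrow> 0 < F t"
    and \<tau>: "\<And>s. s \<in> {0..1} \<Longrightarrow> ((\<lambda>t. F (t * s) / F t) \<longlongrightarrow> \<tau>\<^sub>0 s) (at_right 0)"
  shows "(\<lambda>n. expectation (\<lambda>\<omega>. indicator {..h n} (R \<omega>) * f (R \<omega> / h n)) / F (h n))
    \<longlonglongrightarrow> f 1 - (LINT s:{0..1}|lborel. deriv01 f s * \<tau>\<^sub>0 s)"
proof -
  define D where "D = (\<lambda>s. indicator {0..1} s * deriv01 f s)"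
  have D: "integrable lborel D" using int by (simp add: D_def set_integrable_def)
  have [measurable]: "D \<in> borel_measurable borel" using borel_measurable_integrable[OF D] by simp
  have mono: "mono F" unfolding F by (intro monoI finite_measure_mono) auto
  have [measurable]: "F \<in> borel_measurable borel" by (rule borel_measurable_mono[OF mono])
  have h0: "filterlim h (at_right 0) sequentially"
    by (simp add: filterlim_at h less_imp_neq[OF h(1), symmetric])
  have lim: "(\<lambda>n. indicator {0..1} s * (F (h n * s) / F (h n))) \<longlonglongrightarrow> indicator {0..1} s * \<tau>\<^sub>0 s" for s
    using filterlim_compose[OF \<tau> h0, of s] by (cases "s \<in> {0..1}") auto
  \<comment> \<open>Nothing is assumed about the regularity of \<open>\<tau>\<^sub>0\<close>; its
    measurability on the unit interval is inherited from the monotone functions of which it is a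
    limit.\<close>
  have [measurable]: "(\<lambda>s. indicator {0..1} s * \<tau>\<^sub>0 s) \<in> borel_measurable borel"
    by (rule borel_measurable_LIMSEQ_real[OF lim]) auto
  have eq: "expectation (\<lambda>\<omega>. indicator {..h n} (R \<omega>) * f (R \<omega> / h n)) / F (h n)
    = f 1 - (LINT s|lborel. D s * (indicator {0..1} s * (F (h n * s) / F (h n))))" for n
  proof -
    have "(LINT s|lborel. D s * (indicator {0..1} s * (F (h n * s) / F (h n))))
      = (LINT s|lborel. (indicator {0..1} s *\<^sub>R (deriv01 f s * F (h n * s))) / F (h n))"
      by (intro Bochner_Integration.integral_cong) (auto simp: D_def indicator_def)
    also have "\<dots> = (LINT s:{0..1}|lborel. deriv01 f s * F (h n * s)) / F (h n)"
      by (simp add: set_lebesgue_integral_def)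
    finally show ?thesis
      using kernel_moment_eq[OF assms(1) R0 h(1) f int, of n, folded F(1)] F(2)[OF h(1), of n]
      by (simp add: field_simps)
  qed
  have "(\<lambda>n. LINT s|lborel. D s * (indicator {0..1} s * (F (h n * s) / F (h n))))
    \<longlonglongrightarrow> (LINT s|lborel. D s * (indicator {0..1} s * \<tau>\<^sub>0 s))"
  proof (rule integral_dominated_convergence[where w="\<lambda>s. \<bar>D s\<bar>"])
    show "AE s in lborel. (\<lambda>n. D s * (indicator {0..1} s * (F (h n * s) / F (h n)))) \<longlonglongrightarrow> D s * (indicator {0..1} s * \<tau>\<^sub>0 s)"
      by (intro AE_I2 tendsto_mult tendsto_const lim)
    fix n
    have "\<bar>indicator {0..1} s * (F (h n * s) / F (h n))\<bar> \<le> 1" for s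
    proof (cases "s \<in> {0..1}")
      case True
      then have "F (h n * s) \<le> F (h n)" using h(1)[of n] by (intro monoD[OF mono]) simp
      moreover have "0 \<le> F (h n * s)" by (simp add: F(1))
      ultimately show ?thesis using True F(2)[OF h(1), of n] by simp
    qed simp
    then show "AE s in lborel. norm (D s * (indicator {0..1} s * (F (h n * s) / F (h n)))) \<le> \<bar>D s\<bar>"
      unfolding real_norm_def abs_mult[of "D _"] by (intro AE_I2 mult_left_le abs_ge_zero)
  qed (use D in auto)
  also have "(LINT s|lborel. D s * (indicator {0..1} s * \<tau>\<^sub>0 s)) = (LINT s:{0..1}|lborel. deriv01 f s * \<tau>\<^sub>0 s)"
    unfolding set_lebesgue_integral_def by (intro Bochner_Integration.integral_cong) (auto simp: D_def indicator_def)
  finally show ?thesis unfolding eq by (intro tendsto_diff tendsto_const)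
qed

section \<open>Conditional expectations as integral identities, and continuity in the
  seminorm\<close>

lemma (in prob_space) sigma_finite_subalgebra_sigma_of:
  assumes Z: "Z \<in> measurable M N"
  shows "sigma_finite_subalgebra M (sigma_of M N Z)"
proof -
  have "Z \<in> space M \<rightarrow> space N" using measurable_space[OF Z] by auto
  then have "subalgebra M (sigma_of M N Z)"
    unfolding subalgebra_def using Z by (auto simp: sets_vimage_algebra2 measurable_sets)
  then interpret finite_measure_subalgebra M "sigma_of M N Z" by unfold_locales
  show ?thesis by (rule finite_measure_subalgebra_is_sigma_finite) unfold_locales
qed

lemma measurable_sigma_of:
  assumes "Z \<in> measurable M N" "k \<in> measurable N L"
  shows "(\<lambda>\<omega>. k (Z \<omega>)) \<in> measurable (sigma_of M N Z) L"
  using measurable_space[OF assms(1)]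
  by (intro measurable_compose[OF measurable_vimage_algebra1 assms(2)]) auto

text \<open>The defining property of the conditional expectation, tested against bounded functions
  of \<open>Z\<close>. Integrals do not see the choice of version, so the almost everywhere
  ambiguity of \<open>g\<close> does no harm.\<close>

lemma (in prob_space) regression_fun_integral:
  assumes reg: "regression_fun M N Z W g" and k: "k \<in> borel_measurable N" "\<And>z. \<bar>k z\<bar> \<le> c"
  shows "integrable M (\<lambda>\<omega>. k (Z \<omega>) * W \<omega>)" "integrable M (\<lambda>\<omega>. k (Z \<omega>) * g (Z \<omega>))"
    and "expectation (\<lambda>\<omega>. k (Z \<omega>) * W \<omega>) = expectation (\<lambda>\<omega>. k (Z \<omega>) * g (Z \<omega>))"
proof -
  have Z [measurable]: "Z \<in> measurable M N" and W: "integrable M W" and [measurable]: "g \<in> borel_measurable N"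
    and ae: "AE \<omega> in M. real_cond_exp M (sigma_of M N Z) W \<omega> = g (Z \<omega>)"
    using reg by (auto simp: regression_fun_def)
  note [measurable] = k(1) borel_measurable_integrable[OF W]
  interpret S: sigma_finite_subalgebra M "sigma_of M N Z"
    by (rule sigma_finite_subalgebra_sigma_of[OF Z])
  show i1: "integrable M (\<lambda>\<omega>. k (Z \<omega>) * W \<omega>)"
  proof (rule Bochner_Integration.integrable_bound[OF integrable_mult_right[OF W, of c]])
    show "AE \<omega> in M. norm (k (Z \<omega>) * W \<omega>) \<le> norm (c * W \<omega>)"
      using k(2) by (intro AE_I2) (auto simp: abs_mult intro!: mult_right_mono order_trans[OF k(2)])
  qed measurable
  note I = S.real_cond_exp_intg[OF i1 measurable_sigma_of[OF Z k(1)] borel_measurable_integrable[OF W]]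
  have ae': "AE \<omega> in M. k (Z \<omega>) * real_cond_exp M (sigma_of M N Z) W \<omega> = k (Z \<omega>) * g (Z \<omega>)"
    using ae by eventually_elim simp
  show "integrable M (\<lambda>\<omega>. k (Z \<omega>) * g (Z \<omega>))"
    by (rule integrable_cong_AE_imp[OF I(1)]) (use ae' in auto)
  show "expectation (\<lambda>\<omega>. k (Z \<omega>) * W \<omega>) = expectation (\<lambda>\<omega>. k (Z \<omega>) * g (Z \<omega>))"
    unfolding I(2)[symmetric] by (rule integral_cong_AE) (use ae' in auto)
qed

lemma seminorm_basic:
  assumes "is_seminorm p"
  shows "p 0 = 0" "p (- x) = p x" "0 \<le> p x" "p (x - y) = p (y - x)"
proof -
  have tri: "\<And>x y. p (x + y) \<le> p x + p y" and hom: "\<And>a x. p (a *\<^sub>R x) = \<bar>a\<bar> * p x"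
    using assms by (auto simp: is_seminorm_def)
  show 0: "p 0 = 0" using hom[of 0 0] by simp
  show neg: "p (- x) = p x" for x using hom[of "-1" x] by simp
  show "0 \<le> p x" using tri[of x "- x"] 0 neg[of x] by simp
  show "p (x - y) = p (y - x)" using neg[of "x - y"] by simp
qed

lemma seminorm_continuous_nearD:
  assumes "is_seminorm p" "seminorm_continuous_near p chi f" "0 < e"
  obtains d where "0 < d" "\<And>y. p (chi - y) < d \<Longrightarrow> \<bar>f y - f chi\<bar> < e"
proof -
  obtain U \<delta> where U: "0 < \<delta>" "{x. p (x - chi) < \<delta>} \<subseteq> U"
    "\<And>x e. x \<in> U \<Longrightarrow> 0 < e \<Longrightarrow> \<exists>d>0. \<forall>y\<in>U. p (y - x) < d \<longrightarrow> \<bar>f y - f x\<bar> < e"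
    using assms(2) unfolding seminorm_continuous_near_def by metis
  have "chi \<in> U" using U(1,2) seminorm_basic[OF assms(1)] by auto
  from U(3)[OF this assms(3)] obtain d where d: "0 < d" "\<And>y. y \<in> U \<Longrightarrow> p (y - chi) < d \<Longrightarrow> \<bar>f y - f chi\<bar> < e"
    by auto
  show ?thesis
  proof (rule that[of "min d \<delta>"])
    fix y assume "p (chi - y) < min d \<delta>"
    then have "p (y - chi) < d" "p (y - chi) < \<delta>" by (simp_all add: seminorm_basic(4)[OF assms(1), of y chi])
    then show "\<bar>f y - f chi\<bar> < e" using U(2) d(2) by auto
  qed (use d U in auto)
qed

section \<open>Kernels on the unit interval\<close>

locale unit_kernel =
  fixes K :: "real \<Rightarrow> real"
  assumes K_nonneg: "0 \<le> K t"
    and K_bounded: "bounded (range K)"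
    and K_support: "closure {t. K t \<noteq> 0} = {0..1}"
    and K_INF: "(INF t\<in>{0..1}. K t) > 0"
    and K_diff: "K differentiable_on {0..1}"
    and K_deriv: "set_integrable lborel {0..1} (deriv01 K)"
begin

definition "kmin = (INF t\<in>{0..1}. K t)"
definition "kmax = (SUP t. K t)"

lemma kmin_pos: "0 < kmin" using K_INF by (simp add: kmin_def)

lemma kmin_le: "t \<in> {0..1} \<Longrightarrow> kmin \<le> K t"
  unfolding kmin_def using K_nonneg by (intro cINF_lower bdd_belowI2[of _ 0])

lemma le_kmax: "K t \<le> kmax"
  unfolding kmax_def using bounded_imp_bdd_above[OF K_bounded] by (intro cSUP_upper) auto

lemma kmax_pos: "0 < kmax"
  using kmin_pos kmin_le[of 0] le_kmax[of 0] by simp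

lemma K_outside: "t \<notin> {0..1} \<Longrightarrow> K t = 0"
  using closure_subset[of "{t. K t \<noteq> 0}"] unfolding K_support by auto

lemma K_sq_le: "(K t)\<^sup>2 \<le> kmax\<^sup>2"
  using K_nonneg le_kmax by (intro power_mono)

text \<open>The kernel may jump at both end points, but it is continuous relative to
  \<open>{0..1}\<close> and vanishes elsewhere.\<close>

lemma K_measurable [measurable]: "K \<in> borel_measurable borel"
proof -
  have "(\<lambda>t. indicator {0..1} t *\<^sub>R K t) \<in> borel_measurable borel"
    using differentiable_imp_continuous_on[OF K_diff]
    by (intro borel_measurable_continuous_on_indicator) auto
  also have "(\<lambda>t. indicator {0..1} t *\<^sub>R K t) = K"
    using K_outside by (auto simp: fun_eq_iff indicator_def)
  finally show ?thesis .
qed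

lemma sq_diff: "(\<lambda>u. (K u)\<^sup>2) differentiable_on {0..1}"
  using K_diff unfolding power2_eq_square by (intro differentiable_on_mult)

lemma id_diff: "(\<lambda>u. u * K u) differentiable_on {0..1}"
  using K_diff by (intro differentiable_on_mult differentiable_on_ident)

lemma sq_deriv: "set_integrable lborel {0..1} (deriv01 (\<lambda>u. (K u)\<^sup>2))"
proof -
  have eq: "deriv01 (\<lambda>u. (K u)\<^sup>2) s = 2 * K s * deriv01 K s" if "s \<in> {0..1}" for s
    using deriv01_has_vector_derivative[OF K_diff that] that
    by (intro deriv01_eqI) (auto simp: power2_eq_square algebra_simps has_real_derivative_iff_has_vector_derivative[symmetric] intro!: derivative_eq_intros)
  have "integrable lborel (\<lambda>s. indicator {0..1} s *\<^sub>R (2 * K s * deriv01 K s))"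
  proof (rule Bochner_Integration.integrable_bound)
    show "integrable lborel (\<lambda>s. 2 * kmax * (indicator {0..1} s *\<^sub>R deriv01 K s))"
      using K_deriv unfolding set_integrable_def by (rule integrable_mult_right)
    have "(\<lambda>s. (indicator {0..1} s *\<^sub>R deriv01 K s) * (2 * K s)) \<in> borel_measurable lborel"
      using borel_measurable_integrable[OF K_deriv[unfolded set_integrable_def]] by (intro borel_measurable_times) auto
    then show "(\<lambda>s. indicator {0..1} s *\<^sub>R (2 * K s * deriv01 K s)) \<in> borel_measurable lborel"
      by (simp add: mult_ac)
    show "AE s in lborel. norm (indicator {0..1} s *\<^sub>R (2 * K s * deriv01 K s)) \<le> norm (2 * kmax * (indicator {0..1} s *\<^sub>R deriv01 K s))"
      using K_nonneg le_kmax kmax_pos by (intro AE_I2) (auto simp: indicator_def abs_mult intro!: mult_right_mono)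
  qed
  then have "set_integrable lborel {0..1} (\<lambda>s. 2 * K s * deriv01 K s)" by (simp add: set_integrable_def)
  also have "?this \<longleftrightarrow> ?thesis" by (intro set_integrable_cong refl) (simp add: eq)
  finally show ?thesis .
qed

lemma id_deriv: "set_integrable lborel {0..1} (deriv01 (\<lambda>u. u * K u))"
proof -
  have eq: "deriv01 (\<lambda>u. u * K u) s = K s + s * deriv01 K s" if "s \<in> {0..1}" for s
    using deriv01_has_vector_derivative[OF K_diff that] that
    by (intro deriv01_eqI) (auto simp: algebra_simps has_real_derivative_iff_has_vector_derivative[symmetric] intro!: derivative_eq_intros)
  have m: "(\<lambda>s. indicator {0..1} s *\<^sub>R deriv01 K s) \<in> borel_measurable borel"
    using borel_measurable_integrable[OF K_deriv[unfolded set_integrable_def]] by simp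
  have "integrable lborel (\<lambda>s. indicator {0..1} s *\<^sub>R (s * deriv01 K s))"
  proof (rule Bochner_Integration.integrable_bound)
    show "integrable lborel (\<lambda>s. indicator {0..1} s *\<^sub>R deriv01 K s)"
      using K_deriv unfolding set_integrable_def .
    have "(\<lambda>s. s * (indicator {0..1} s *\<^sub>R deriv01 K s)) \<in> borel_measurable lborel"
      using m by (intro borel_measurable_times) auto
    then show "(\<lambda>s. indicator {0..1} s *\<^sub>R (s * deriv01 K s)) \<in> borel_measurable lborel"
      by (simp add: mult_ac)
    show "AE s in lborel. norm (indicator {0..1} s *\<^sub>R (s * deriv01 K s)) \<le> norm (indicator {0..1} s *\<^sub>R deriv01 K s)"
      by (intro AE_I2) (auto simp: indicator_def abs_mult intro!: mult_left_le_one_le)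
  qed
  moreover have "integrable lborel (\<lambda>s. indicator {0..1} s *\<^sub>R K s)"
    using borel_integrable_atLeastAtMost'[OF differentiable_imp_continuous_on[OF K_diff]] unfolding set_integrable_def .
  ultimately have "integrable lborel (\<lambda>s. indicator {0..1} s *\<^sub>R K s + indicator {0..1} s *\<^sub>R (s * deriv01 K s))" by simp
  then have "set_integrable lborel {0..1} (\<lambda>s. K s + s * deriv01 K s)" by (simp add: set_integrable_def algebra_simps)
  also have "?this \<longleftrightarrow> ?thesis" by (intro set_integrable_cong refl) (simp add: eq)
  finally show ?thesis .
qed

end

text \<open>The random element is a parameter because two instances are required: the generic
  \<open>X\<close>, for which \<open>r\<close> and \<open>\<phi>\<close> are regression functions,
  and a copy, for which the noise is given.\<close>

locale small_ball_kernel = prob_space M + unit_kernel K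
  for M :: "'w measure" and K :: "real \<Rightarrow> real" +
  fixes p :: "'e::banach \<Rightarrow> real" and X :: "'w \<Rightarrow> 'e" and chi :: 'e and \<tau>\<^sub>0 :: "real \<Rightarrow> real"
  assumes seminorm: "is_seminorm p" and p_measurable [measurable]: "p \<in> borel_measurable borel"
    and X_measurable [measurable]: "X \<in> borel_measurable M"
    and small_ball_pos: "0 < t \<Longrightarrow> 0 < small_ball M p X chi t"
    and small_ball_ratio: "s \<in> {0..1} \<Longrightarrow>
      ((\<lambda>t. small_ball M p X chi (t * s) / small_ball M p X chi t) \<longlongrightarrow> \<tau>\<^sub>0 s) (at_right 0)"
begin

abbreviation "F \<equiv> small_ball M p X chi"
definition "R \<omega> = p (chi - X \<omega>)"

lemma p_dist_measurable [measurable]: "(\<lambda>x. p (chi - x)) \<in> borel_measurable borel"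
  by (rule measurable_compose[OF borel_measurable_continuous_onI p_measurable]) (intro continuous_intros)

lemma R_measurable [measurable]: "R \<in> borel_measurable M"
  unfolding R_def[abs_def] by measurable

lemma R_nonneg: "0 \<le> R \<omega>" unfolding R_def by (rule seminorm_basic(3)[OF seminorm])

lemma F_eq: "F t = prob {\<omega> \<in> space M. R \<omega> \<le> t}" by (simp add: small_ball_def R_def)

lemma K_ball: "0 < h \<Longrightarrow> indicator {..h} (R \<omega>) * K (R \<omega> / h) = K (R \<omega> / h)"
  using K_outside[of "R \<omega> / h"] by (auto simp: indicator_def)

lemma expectation_ball: "expectation (\<lambda>\<omega>. indicator {..h} (R \<omega>)) = F h"
proof -
  have "expectation (\<lambda>\<omega>. indicator {..h} (R \<omega>) :: real) = expectation (indicator {\<omega> \<in> space M. R \<omega> \<le> h})"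
    by (intro Bochner_Integration.integral_cong) (auto simp: indicator_def)
  then show ?thesis by (simp add: F_eq)
qed

lemma ball_integrable: "integrable M (\<lambda>\<omega>. indicator {..h} (R \<omega>) :: real)"
  by (intro integrable_const_bound[where B=1]) (auto simp: indicator_def)

lemma expectation_ball_bound:
  assumes [measurable]: "W \<in> borel_measurable M" and W: "\<And>\<omega>. \<omega> \<in> space M \<Longrightarrow> \<bar>W \<omega>\<bar> \<le> c * indicator {..h} (R \<omega>)"
  shows "integrable M W" and "\<bar>expectation W\<bar> \<le> c * F h"
proof -
  show i: "integrable M W"
    by (rule Bochner_Integration.integrable_bound[OF integrable_mult_right[OF ball_integrable[of h], of c]])
       (auto intro!: AE_I2 order_trans[OF W])
  have "\<bar>expectation W\<bar> \<le> expectation (\<lambda>\<omega>. \<bar>W \<omega>\<bar>)" by (rule integral_abs_bound)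
  also have "\<dots> \<le> expectation (\<lambda>\<omega>. c * indicator {..h} (R \<omega>))"
    using i W ball_integrable by (intro integral_mono) auto
  finally show "\<bar>expectation W\<bar> \<le> c * F h" by (simp add: expectation_ball)
qed

lemma kernel_limits:
  assumes h: "\<And>n. 0 < h n" "h \<longlonglongrightarrow> 0"
  shows "(\<lambda>n. expectation (\<lambda>\<omega>. K (R \<omega> / h n)) / F (h n)) \<longlonglongrightarrow> M1 K \<tau>\<^sub>0"
    and "(\<lambda>n. expectation (\<lambda>\<omega>. (K (R \<omega> / h n))\<^sup>2) / F (h n)) \<longlonglongrightarrow> M2 K \<tau>\<^sub>0"
    and "(\<lambda>n. expectation (\<lambda>\<omega>. R \<omega> / h n * K (R \<omega> / h n)) / F (h n)) \<longlonglongrightarrow> M0 K \<tau>\<^sub>0"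
proof -
  have sq: "indicator {..h n} (R \<omega>) * (K (R \<omega> / h n))\<^sup>2 = (K (R \<omega> / h n))\<^sup>2" for n \<omega>
    using K_ball[OF h(1), of n \<omega>] by (auto simp: indicator_def)
  have idd: "indicator {..h n} (R \<omega>) * (R \<omega> / h n * K (R \<omega> / h n)) = R \<omega> / h n * K (R \<omega> / h n)" for n \<omega>
    using K_ball[OF h(1), of n \<omega>] by (auto simp: indicator_def)
  note lim = kernel_moment_tendsto[OF R_measurable R_nonneg _ _ h F_eq small_ball_pos small_ball_ratio]
  show "(\<lambda>n. expectation (\<lambda>\<omega>. K (R \<omega> / h n)) / F (h n)) \<longlonglongrightarrow> M1 K \<tau>\<^sub>0"
    using lim[OF K_diff K_deriv] by (simp add: M1_def K_ball[OF h(1)])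
  show "(\<lambda>n. expectation (\<lambda>\<omega>. (K (R \<omega> / h n))\<^sup>2) / F (h n)) \<longlonglongrightarrow> M2 K \<tau>\<^sub>0"
    using lim[OF sq_diff sq_deriv] by (simp add: M2_def sq)
  show "(\<lambda>n. expectation (\<lambda>\<omega>. R \<omega> / h n * K (R \<omega> / h n)) / F (h n)) \<longlonglongrightarrow> M0 K \<tau>\<^sub>0"
    using lim[OF id_diff id_deriv] by (simp only: M0_def idd mult_1)
qed

text \<open>A version of the regression function need not be determined at the single point 0.
  Continuity there decides: the averages of \<open>r (X) - r chi\<close> and of
  \<open>\<phi> (R)\<close> over a small ball coincide, the former is near 0, the latter near
  \<open>\<phi> 0\<close>, and the ball has positive mass.\<close>

lemma regression_at_center:
  assumes cont: "seminorm_continuous_near p chi r"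
    and reg: "regression_fun M borel (\<lambda>\<omega>. p (X \<omega> - chi)) (\<lambda>\<omega>. r (X \<omega>) - r chi) \<phi>"
    and \<phi>: "continuous (at 0 within {0..}) \<phi>"
  shows "\<phi> 0 = 0"
proof (rule ccontr)
  assume "\<phi> 0 \<noteq> 0"
  \<comment> \<open>The two approximations cost \<open>e\<close> each, which would give
    \<open>\<bar>\<phi> 0\<bar> \<le> 2 * e\<close>; a third makes this a contradiction.\<close>
  define e where "e = \<bar>\<phi> 0\<bar> / 3"
  have e: "0 < e" using \<open>\<phi> 0 \<noteq> 0\<close> by (simp add: e_def)
  obtain d1 where d1: "0 < d1" "\<And>y. p (chi - y) < d1 \<Longrightarrow> \<bar>r y - r chi\<bar> < e"
    using seminorm_continuous_nearD[OF seminorm cont e] by blast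
  obtain d2 where d2: "0 < d2" "\<And>t. 0 \<le> t \<Longrightarrow> t < d2 \<Longrightarrow> \<bar>\<phi> t - \<phi> 0\<bar> < e"
    using \<phi> e unfolding continuous_within_eps_delta by (auto simp: dist_real_def)
  define t where "t = min d1 d2 / 2"
  have t: "0 < t" "t < d1" "t < d2" using d1 d2 by (auto simp: t_def min_def)
  have RX: "p (X \<omega> - chi) = R \<omega>" for \<omega> unfolding R_def by (rule seminorm_basic(4)[OF seminorm])
  note I = regression_fun_integral[OF reg, of "indicator {..t}" 1, unfolded RX]
  have \<phi>m [measurable]: "\<phi> \<in> borel_measurable borel" using reg by (simp add: regression_fun_def)
  have rm [measurable]: "(\<lambda>\<omega>. r (X \<omega>) - r chi) \<in> borel_measurable M"
    using reg by (auto simp: regression_fun_def)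
  have 1: "\<bar>expectation (\<lambda>\<omega>. indicator {..t} (R \<omega>) * (r (X \<omega>) - r chi))\<bar> \<le> e * F t"
    using t d1(2) by (intro expectation_ball_bound) (auto simp: indicator_def R_def less_imp_le)
  have 2: "\<bar>expectation (\<lambda>\<omega>. indicator {..t} (R \<omega>) * (\<phi> (R \<omega>) - \<phi> 0))\<bar> \<le> e * F t"
    using t d2(2) R_nonneg by (intro expectation_ball_bound) (auto simp: indicator_def less_imp_le)
  have "expectation (\<lambda>\<omega>. indicator {..t} (R \<omega>) * (\<phi> (R \<omega>) - \<phi> 0))
    = expectation (\<lambda>\<omega>. indicator {..t} (R \<omega>) * \<phi> (R \<omega>) - \<phi> 0 * indicator {..t} (R \<omega>))"
    by (simp add: algebra_simps)
  also have "\<dots> = expectation (\<lambda>\<omega>. indicator {..t} (R \<omega>) * \<phi> (R \<omega>)) - \<phi> 0 * F t"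
    using I(2) ball_integrable by (simp add: indicator_def expectation_ball[symmetric])
  also have "\<dots> = expectation (\<lambda>\<omega>. indicator {..t} (R \<omega>) * (r (X \<omega>) - r chi)) - \<phi> 0 * F t"
    using I(3) by (simp add: indicator_def)
  finally have "\<bar>\<phi> 0 * F t\<bar> \<le> 2 * (e * F t)" using 1 2 by linarith
  then have "\<bar>\<phi> 0\<bar> * F t \<le> (2 * e) * F t" using small_ball_pos[OF t(1)] by (simp add: abs_mult)
  then have "\<bar>\<phi> 0\<bar> \<le> 2 * e" using small_ball_pos[OF t(1)] by simp
  then show False using e by (simp add: e_def)
qed

text \<open>The tower property in two stages: conditioning on \<open>X\<close> replaces
  \<open>Y\<close> by \<open>r X\<close>, and since the kernel depends on \<open>X\<close> only
  through the distance, conditioning on the distance then produces \<open>\<phi>\<close>.\<close>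

lemma kernel_response_eq:
  assumes regY: "regression_fun M borel X Y r"
    and reg: "regression_fun M borel (\<lambda>\<omega>. p (X \<omega> - chi)) (\<lambda>\<omega>. r (X \<omega>) - r chi) \<phi>"
  shows "expectation (\<lambda>\<omega>. K (R \<omega> / h) * (Y \<omega> - r chi)) = expectation (\<lambda>\<omega>. K (R \<omega> / h) * \<phi> (R \<omega>))"
    and "integrable M (\<lambda>\<omega>. K (R \<omega> / h) * \<phi> (R \<omega>))"
proof -
  have RX: "p (X \<omega> - chi) = R \<omega>" for \<omega> unfolding R_def by (rule seminorm_basic(4)[OF seminorm])
  have Kb: "\<bar>K t\<bar> \<le> kmax" for t using K_nonneg le_kmax by simp
  have Ki: "integrable M (\<lambda>\<omega>. K (R \<omega> / h))"
    using Kb by (intro integrable_const_bound[where B=kmax]) auto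
  note I1 = regression_fun_integral[OF regY, of "\<lambda>x. K (p (chi - x) / h)" kmax, folded R_def]
  note I2 = regression_fun_integral[OF reg, of "\<lambda>t. K (t / h)" kmax, unfolded RX]
  have "expectation (\<lambda>\<omega>. K (R \<omega> / h) * (Y \<omega> - r chi)) = expectation (\<lambda>\<omega>. K (R \<omega> / h) * (r (X \<omega>) - r chi))"
    using I1 Ki Kb by (simp add: right_diff_distrib)
  also have "\<dots> = expectation (\<lambda>\<omega>. K (R \<omega> / h) * \<phi> (R \<omega>))" using I2 Kb by simp
  finally show "expectation (\<lambda>\<omega>. K (R \<omega> / h) * (Y \<omega> - r chi)) = expectation (\<lambda>\<omega>. K (R \<omega> / h) * \<phi> (R \<omega>))" .
  show "integrable M (\<lambda>\<omega>. K (R \<omega> / h) * \<phi> (R \<omega>))" using I2 Kb by simp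
qed

text \<open>Near 0, \<open>\<phi> t\<close> is \<open>d\<phi> * t\<close> up to
  \<open>\<eta> * t\<close>, and the kernel forces \<open>R \<le> h n\<close>. The linear part is
  \<open>d\<phi> * h n\<close> times the moment whose limit is \<open>M0\<close>; the remainder is
  of smaller order than \<open>h n * F (h n)\<close>.\<close>

lemma bias_limit:
  assumes cont: "seminorm_continuous_near p chi r"
    and regY: "regression_fun M borel X Y r"
    and reg: "regression_fun M borel (\<lambda>\<omega>. p (X \<omega> - chi)) (\<lambda>\<omega>. r (X \<omega>) - r chi) \<phi>"
    and \<phi>: "(\<phi> has_real_derivative d\<phi>) (at 0 within {0..})"
    and h: "\<And>n. 0 < h n" "h \<longlonglongrightarrow> 0"
  shows "(\<lambda>n. expectation (\<lambda>\<omega>. K (R \<omega> / h n) * (Y \<omega> - r chi)) / (h n * F (h n))) \<longlonglongrightarrow> d\<phi> * M0 K \<tau>\<^sub>0"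
proof -
  have \<phi>0: "\<phi> 0 = 0"
    using DERIV_continuous[OF \<phi>] by (rule regression_at_center[OF cont reg])
  have \<phi>m [measurable]: "\<phi> \<in> borel_measurable borel" using reg by (simp add: regression_fun_def)
  define a where "a = (\<lambda>n. expectation (\<lambda>\<omega>. K (R \<omega> / h n) * \<phi> (R \<omega>)) / (h n * F (h n)))"
  define b where "b = (\<lambda>n. d\<phi> * (expectation (\<lambda>\<omega>. R \<omega> / h n * K (R \<omega> / h n)) / F (h n)))"
  have "(\<lambda>n. a n - b n) \<longlonglongrightarrow> 0"
  proof (rule LIMSEQ_I)
    fix e :: real assume e: "0 < e"
    \<comment> \<open>The remainder is at most \<open>\<eta> * kmax\<close> after normalisation,
      that is \<open>e / 2\<close>.\<close>
    define \<eta> where "\<eta> = e / (2 * kmax)"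
    have \<eta>: "0 < \<eta>" using e kmax_pos by (simp add: \<eta>_def)
    have "eventually (\<lambda>t. dist ((\<phi> t - \<phi> 0) / (t - 0)) d\<phi> < \<eta>) (at 0 within {0..})"
      using \<phi> \<eta> unfolding has_field_derivative_iff by (rule tendstoD)
    then obtain d where d: "0 < d" "\<And>t. 0 \<le> t \<Longrightarrow> t \<noteq> 0 \<Longrightarrow> t < d \<Longrightarrow> \<bar>\<phi> t / t - d\<phi>\<bar> < \<eta>"
      unfolding eventually_at by (auto simp: dist_real_def \<phi>0)
    have \<phi>d: "\<bar>\<phi> t - d\<phi> * t\<bar> \<le> \<eta> * t" if "0 \<le> t" "t < d" for t
    proof (cases "t = 0")
      case False
      then have "\<phi> t - d\<phi> * t = (\<phi> t / t - d\<phi>) * t" by (simp add: field_simps)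
      then have "\<bar>\<phi> t - d\<phi> * t\<bar> = \<bar>\<phi> t / t - d\<phi>\<bar> * t"
        using that(1) by (simp add: abs_mult)
      then show ?thesis using d(2)[of t] that False by (simp add: mult_right_mono)
    qed (simp add: \<phi>0)
    have "eventually (\<lambda>n. h n < d) sequentially" by (rule order_tendstoD(2)[OF h(2) d(1)])
    then have "eventually (\<lambda>n. norm (a n - b n - 0) < e) sequentially"
    proof eventually_elim
      case (elim n)
      have Rb: "\<bar>R \<omega> / h n * K (R \<omega> / h n)\<bar> \<le> kmax * indicator {..h n} (R \<omega>)" for \<omega>
      proof (cases "R \<omega> \<le> h n")
        case True
        then have "R \<omega> / h n \<le> 1" using h(1)[of n] by simp
        then have "R \<omega> / h n * K (R \<omega> / h n) \<le> 1 * kmax"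
          using le_kmax K_nonneg by (intro mult_mono) auto
        moreover have "0 \<le> R \<omega> / h n * K (R \<omega> / h n)"
          using R_nonneg K_nonneg h(1)[of n] by simp
        ultimately show ?thesis using True by simp
      next
        case False
        then show ?thesis using K_ball[OF h(1), of n \<omega>] by simp
      qed
      have i: "integrable M (\<lambda>\<omega>. R \<omega> / h n * K (R \<omega> / h n))"
        by (rule expectation_ball_bound(1)[OF _ Rb]) measurable
      have "\<bar>expectation (\<lambda>\<omega>. K (R \<omega> / h n) * (\<phi> (R \<omega>) - d\<phi> * R \<omega>))\<bar> \<le> (\<eta> * h n * kmax) * F (h n)"
      proof (rule expectation_ball_bound)
        fix \<omega>
        show "\<bar>K (R \<omega> / h n) * (\<phi> (R \<omega>) - d\<phi> * R \<omega>)\<bar> \<le> \<eta> * h n * kmax * indicator {..h n} (R \<omega>)"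
        proof (cases "R \<omega> \<le> h n")
          case True
          have "\<bar>K (R \<omega> / h n)\<bar> * \<bar>\<phi> (R \<omega>) - d\<phi> * R \<omega>\<bar> \<le> kmax * (\<eta> * h n)"
            using le_kmax K_nonneg True elim \<eta> kmax_pos
            by (intro mult_mono order_trans[OF \<phi>d[OF R_nonneg]] mult_left_mono) auto
          then show ?thesis using True by (simp add: abs_mult mult_ac)
        next
          case False
          then show ?thesis using K_ball[OF h(1), of n \<omega>] by simp
        qed
      qed measurable
      moreover have "expectation (\<lambda>\<omega>. K (R \<omega> / h n) * (\<phi> (R \<omega>) - d\<phi> * R \<omega>)) = (a n - b n) * (h n * F (h n))"
      proof -
        have "expectation (\<lambda>\<omega>. K (R \<omega> / h n) * (\<phi> (R \<omega>) - d\<phi> * R \<omega>))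
          = expectation (\<lambda>\<omega>. K (R \<omega> / h n) * \<phi> (R \<omega>) - (d\<phi> * h n) * (R \<omega> / h n * K (R \<omega> / h n)))"
          using h(1)[of n] by (intro Bochner_Integration.integral_cong) (auto simp: field_simps)
        also have "\<dots> = expectation (\<lambda>\<omega>. K (R \<omega> / h n) * \<phi> (R \<omega>)) - (d\<phi> * h n) * expectation (\<lambda>\<omega>. R \<omega> / h n * K (R \<omega> / h n))"
          using i kernel_response_eq(2)[OF regY reg, of "h n"] by (simp only: Bochner_Integration.integral_diff integrable_mult_right integral_mult_right_zero)
        also have "\<dots> = (a n - b n) * (h n * F (h n))"
          using h(1)[of n] small_ball_pos[OF h(1), of n] by (simp add: a_def b_def field_simps)
        finally show ?thesis .
      qed
      ultimately have "\<bar>a n - b n\<bar> * (h n * F (h n)) \<le> (\<eta> * kmax) * (h n * F (h n))"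
        using h(1)[of n] small_ball_pos[OF h(1), of n] by (simp add: abs_mult mult_ac)
      then have "\<bar>a n - b n\<bar> \<le> \<eta> * kmax"
        using h(1)[of n] small_ball_pos[OF h(1), of n] by (subst (asm) mult_le_cancel_right_pos) auto
      also have "\<dots> < e" using e kmax_pos by (simp add: \<eta>_def)
      finally show ?case by simp
    qed
    then show "\<exists>no. \<forall>n\<ge>no. norm (a n - b n - 0) < e" by (simp add: eventually_sequentially)
  qed
  moreover have "b \<longlonglongrightarrow> d\<phi> * M0 K \<tau>\<^sub>0"
    unfolding b_def by (intro tendsto_mult_left kernel_limits(3) h)
  ultimately have "(\<lambda>n. (a n - b n) + b n) \<longlonglongrightarrow> 0 + d\<phi> * M0 K \<tau>\<^sub>0" by (rule tendsto_add)
  then show ?thesis by (simp add: a_def kernel_response_eq(1)[OF regY reg])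
qed

end

section \<open>Second moments of the weighted response\<close>

context small_ball_kernel begin

text \<open>The deviation \<open>Y - r chi\<close> is \<open>r X - r chi\<close> plus the noise. On
  the ball the first part is at most \<open>\<eta>\<close>, the cross term integrates to 0 because
  the noise is conditionally centred, and the squared noise may be replaced by \<open>v X\<close>,
  which is within \<open>\<eta>\<close> of \<open>v chi\<close>.\<close>

lemma variance_near_center:
  assumes Y: "\<And>\<omega>. \<omega> \<in> space M \<Longrightarrow> Y \<omega> = r (X \<omega>) + e \<omega>"
    and reg: "regression_fun M borel X e (\<lambda>_. 0)"
    and r [measurable]: "r \<in> borel_measurable borel" and \<sigma> [measurable]: "v \<in> borel_measurable borel"
    and v_nonneg: "\<And>x. 0 \<le> v x"
    and cv: "AE \<omega> in M. nn_cond_exp M (sigma_of M borel X) (\<lambda>\<omega>. ennreal ((e \<omega>)\<^sup>2)) \<omega> = ennreal (v (X \<omega>))"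
    and h: "0 < h" and \<eta>: "0 < \<eta>"
    and near: "\<And>y. p (chi - y) \<le> h \<Longrightarrow> \<bar>r y - r chi\<bar> \<le> \<eta>" "\<And>y. p (chi - y) \<le> h \<Longrightarrow> \<bar>v y - v chi\<bar> \<le> \<eta>"
  shows "\<bar>expectation (\<lambda>\<omega>. (K (R \<omega> / h) * (Y \<omega> - r chi))\<^sup>2) - v chi * expectation (\<lambda>\<omega>. (K (R \<omega> / h))\<^sup>2)\<bar>
    \<le> (\<eta>\<^sup>2 + \<eta>) * kmax\<^sup>2 * F h"
proof -
  define k where "k = (\<lambda>x. (K (p (chi - x) / h))\<^sup>2)"
  have [measurable]: "k \<in> borel_measurable borel" unfolding k_def by measurable
  have e [measurable]: "e \<in> borel_measurable M" using reg by (auto simp: regression_fun_def)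
  have kX: "k (X \<omega>) = (K (R \<omega> / h))\<^sup>2" for \<omega> by (simp add: k_def R_def)
  have k0: "0 \<le> k x" for x by (simp add: k_def)
  have k_le: "k x \<le> kmax\<^sup>2" for x by (simp add: k_def K_sq_le)
  have k_out: "k x = 0" if "\<not> p (chi - x) \<le> h" for x
    using K_outside[of "p (chi - x) / h"] that h by (simp add: k_def)
  have kb: "k x * b \<le> kmax\<^sup>2 * c * indicator {..h} (p (chi - x))" if "p (chi - x) \<le> h \<Longrightarrow> b \<le> c" "0 \<le> b" for x b c
    using that k_le[of x] k0[of x] k_out[of x] by (cases "p (chi - x) \<le> h") (auto intro!: mult_mono)
  interpret S: sigma_finite_subalgebra M "sigma_of M borel X"
    by (rule sigma_finite_subalgebra_sigma_of) measurable
  have t1: "integrable M (\<lambda>\<omega>. k (X \<omega>) * (r (X \<omega>) - r chi)\<^sup>2)"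
    "\<bar>expectation (\<lambda>\<omega>. k (X \<omega>) * (r (X \<omega>) - r chi)\<^sup>2)\<bar> \<le> (kmax\<^sup>2 * \<eta>\<^sup>2) * F h"
  proof -
    have "\<bar>k (X \<omega>) * (r (X \<omega>) - r chi)\<^sup>2\<bar> \<le> kmax\<^sup>2 * \<eta>\<^sup>2 * indicator {..h} (R \<omega>)" for \<omega>
      using kb[of "X \<omega>" "(r (X \<omega>) - r chi)\<^sup>2" "\<eta>\<^sup>2"] power_mono[OF near(1), of "X \<omega>" 2] k0[of "X \<omega>"]
      by (simp add: abs_mult R_def)
    from expectation_ball_bound[OF _ this]
    show "integrable M (\<lambda>\<omega>. k (X \<omega>) * (r (X \<omega>) - r chi)\<^sup>2)"
      "\<bar>expectation (\<lambda>\<omega>. k (X \<omega>) * (r (X \<omega>) - r chi)\<^sup>2)\<bar> \<le> (kmax\<^sup>2 * \<eta>\<^sup>2) * F h" by auto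
  qed
  have "\<bar>k x * (r x - r chi)\<bar> \<le> kmax\<^sup>2 * \<eta>" for x
  proof -
    have "\<bar>k x * (r x - r chi)\<bar> \<le> kmax\<^sup>2 * \<eta> * indicator {..h} (p (chi - x))"
      using kb[of x "\<bar>r x - r chi\<bar>" \<eta>] near(1)[of x] k0[of x] by (simp add: abs_mult)
    also have "\<dots> \<le> kmax\<^sup>2 * \<eta>" using \<eta> by (auto simp: indicator_def)
    finally show ?thesis .
  qed
  moreover have "(\<lambda>x. k x * (r x - r chi)) \<in> borel_measurable borel" by measurable
  ultimately have t2: "integrable M (\<lambda>\<omega>. k (X \<omega>) * (r (X \<omega>) - r chi) * e \<omega>)"
    "expectation (\<lambda>\<omega>. k (X \<omega>) * (r (X \<omega>) - r chi) * e \<omega>) = 0"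
    using regression_fun_integral[OF reg, of "\<lambda>x. k x * (r x - r chi)" "kmax\<^sup>2 * \<eta>"] by simp_all
  \<comment> \<open>The squared noise need not be integrable on the whole space, so the conditional
    variance is handled through the nonnegative integral.\<close>
  have fin: "(\<integral>\<^sup>+ \<omega>. ennreal (k (X \<omega>)) * ennreal ((e \<omega>)\<^sup>2) \<partial>M) = (\<integral>\<^sup>+ \<omega>. ennreal (k (X \<omega>) * v (X \<omega>)) \<partial>M)"
  proof -
    have "(\<lambda>\<omega>. ennreal (k (X \<omega>))) \<in> borel_measurable (sigma_of M borel X)"
      by (rule measurable_sigma_of[where N=borel]) measurable
    then have "(\<integral>\<^sup>+ \<omega>. ennreal (k (X \<omega>)) * ennreal ((e \<omega>)\<^sup>2) \<partial>M)
      = (\<integral>\<^sup>+ \<omega>. ennreal (k (X \<omega>)) * nn_cond_exp M (sigma_of M borel X) (\<lambda>\<omega>. ennreal ((e \<omega>)\<^sup>2)) \<omega> \<partial>M)"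
      by (intro S.nn_cond_exp_intg[symmetric]) auto
    also have "\<dots> = (\<integral>\<^sup>+ \<omega>. ennreal (k (X \<omega>) * v (X \<omega>)) \<partial>M)"
      using cv by (intro nn_integral_cong_AE) (auto simp: ennreal_mult k0 v_nonneg)
    finally show ?thesis .
  qed
  have t4: "integrable M (\<lambda>\<omega>. k (X \<omega>) * (v (X \<omega>) - v chi))"
    "\<bar>expectation (\<lambda>\<omega>. k (X \<omega>) * (v (X \<omega>) - v chi))\<bar> \<le> (kmax\<^sup>2 * \<eta>) * F h"
  proof -
    have "\<bar>k (X \<omega>) * (v (X \<omega>) - v chi)\<bar> \<le> kmax\<^sup>2 * \<eta> * indicator {..h} (R \<omega>)" for \<omega>
      using kb[of "X \<omega>" "\<bar>v (X \<omega>) - v chi\<bar>" \<eta>] near(2)[of "X \<omega>"] k0[of "X \<omega>"] by (simp add: abs_mult R_def)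
    from expectation_ball_bound[OF _ this]
    show "integrable M (\<lambda>\<omega>. k (X \<omega>) * (v (X \<omega>) - v chi))"
      "\<bar>expectation (\<lambda>\<omega>. k (X \<omega>) * (v (X \<omega>) - v chi))\<bar> \<le> (kmax\<^sup>2 * \<eta>) * F h" by auto
  qed
  have ik: "integrable M (\<lambda>\<omega>. k (X \<omega>))"
    using k0 k_le by (intro integrable_const_bound[where B="kmax\<^sup>2"]) auto
  have kv: "k (X \<omega>) * v (X \<omega>) = k (X \<omega>) * (v (X \<omega>) - v chi) + v chi * k (X \<omega>)" for \<omega>
    by (simp add: algebra_simps)
  have ikv: "integrable M (\<lambda>\<omega>. k (X \<omega>) * v (X \<omega>))"
    unfolding kv using ik t4 by simp
  \<comment> \<open>Integrability of the squared noise with the kernel weight is derived here: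
    \<open>v\<close> is bounded on the ball, which makes the right-hand side of \<open>fin\<close>
    finite.\<close>
  have "has_bochner_integral M (\<lambda>\<omega>. k (X \<omega>) * (e \<omega>)\<^sup>2) (expectation (\<lambda>\<omega>. k (X \<omega>) * v (X \<omega>)))"
  proof (rule has_bochner_integral_nn_integral)
    show "(\<integral>\<^sup>+ \<omega>. ennreal (k (X \<omega>) * (e \<omega>)\<^sup>2) \<partial>M) = ennreal (expectation (\<lambda>\<omega>. k (X \<omega>) * v (X \<omega>)))"
    proof -
      have "(\<integral>\<^sup>+ \<omega>. ennreal (k (X \<omega>) * (e \<omega>)\<^sup>2) \<partial>M) = (\<integral>\<^sup>+ \<omega>. ennreal (k (X \<omega>)) * ennreal ((e \<omega>)\<^sup>2) \<partial>M)"
        by (simp add: ennreal_mult k0)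
      also have "\<dots> = (\<integral>\<^sup>+ \<omega>. ennreal (k (X \<omega>) * v (X \<omega>)) \<partial>M)" by (rule fin)
      also have "\<dots> = ennreal (expectation (\<lambda>\<omega>. k (X \<omega>) * v (X \<omega>)))"
        using k0 v_nonneg by (intro nn_integral_eq_integral[OF ikv]) auto
      finally show ?thesis .
    qed
  qed (auto simp: k0 v_nonneg intro!: integral_nonneg_AE AE_I2)
  then have t3: "integrable M (\<lambda>\<omega>. k (X \<omega>) * (e \<omega>)\<^sup>2)"
    "expectation (\<lambda>\<omega>. k (X \<omega>) * (e \<omega>)\<^sup>2) = expectation (\<lambda>\<omega>. k (X \<omega>) * v (X \<omega>))"
    by (auto simp: has_bochner_integral_iff)
  have "expectation (\<lambda>\<omega>. (K (R \<omega> / h) * (Y \<omega> - r chi))\<^sup>2)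
    = expectation (\<lambda>\<omega>. k (X \<omega>) * (r (X \<omega>) - r chi)\<^sup>2 + 2 * (k (X \<omega>) * (r (X \<omega>) - r chi) * e \<omega>) + k (X \<omega>) * (e \<omega>)\<^sup>2)"
  proof (intro Bochner_Integration.integral_cong refl)
    fix \<omega> assume "\<omega> \<in> space M"
    then show "(K (R \<omega> / h) * (Y \<omega> - r chi))\<^sup>2
      = k (X \<omega>) * (r (X \<omega>) - r chi)\<^sup>2 + 2 * (k (X \<omega>) * (r (X \<omega>) - r chi) * e \<omega>) + k (X \<omega>) * (e \<omega>)\<^sup>2"
      unfolding kX by (simp add: Y power2_eq_square algebra_simps)
  qed
  also have "\<dots> = expectation (\<lambda>\<omega>. k (X \<omega>) * (r (X \<omega>) - r chi)\<^sup>2) + expectation (\<lambda>\<omega>. k (X \<omega>) * v (X \<omega>))"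
    using t1(1) t2 t3 by simp
  also have "expectation (\<lambda>\<omega>. k (X \<omega>) * v (X \<omega>))
    = expectation (\<lambda>\<omega>. k (X \<omega>) * (v (X \<omega>) - v chi)) + v chi * expectation (\<lambda>\<omega>. k (X \<omega>))"
    unfolding kv using ik t4 by simp
  finally have "expectation (\<lambda>\<omega>. (K (R \<omega> / h) * (Y \<omega> - r chi))\<^sup>2) - v chi * expectation (\<lambda>\<omega>. (K (R \<omega> / h))\<^sup>2)
    = expectation (\<lambda>\<omega>. k (X \<omega>) * (r (X \<omega>) - r chi)\<^sup>2) + expectation (\<lambda>\<omega>. k (X \<omega>) * (v (X \<omega>) - v chi))"
    by (simp add: kX)
  moreover have "(\<eta>\<^sup>2 + \<eta>) * kmax\<^sup>2 * F h = (kmax\<^sup>2 * \<eta>\<^sup>2) * F h + (kmax\<^sup>2 * \<eta>) * F h"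
    by (simp add: algebra_simps)
  ultimately show ?thesis using t1(2) t4(2) by linarith
qed

lemma variance_limit:
  assumes Y: "\<And>\<omega>. \<omega> \<in> space M \<Longrightarrow> Y \<omega> = r (X \<omega>) + e \<omega>"
    and reg: "regression_fun M borel X e (\<lambda>_. 0)"
    and r: "r \<in> borel_measurable borel" and v: "v \<in> borel_measurable borel" "\<And>x. 0 \<le> v x"
    and cv: "AE \<omega> in M. nn_cond_exp M (sigma_of M borel X) (\<lambda>\<omega>. ennreal ((e \<omega>)\<^sup>2)) \<omega> = ennreal (v (X \<omega>))"
    and cont: "seminorm_continuous_near p chi r" "seminorm_continuous_near p chi v"
    and h: "\<And>n. 0 < h n" "h \<longlonglongrightarrow> 0"
  shows "(\<lambda>n. expectation (\<lambda>\<omega>. (K (R \<omega> / h n) * (Y \<omega> - r chi))\<^sup>2) / F (h n)) \<longlonglongrightarrow> v chi * M2 K \<tau>\<^sub>0"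
proof -
  define a where "a = (\<lambda>n. expectation (\<lambda>\<omega>. (K (R \<omega> / h n) * (Y \<omega> - r chi))\<^sup>2) / F (h n))"
  define b where "b = (\<lambda>n. v chi * (expectation (\<lambda>\<omega>. (K (R \<omega> / h n))\<^sup>2) / F (h n)))"
  have "(\<lambda>n. a n - b n) \<longlonglongrightarrow> 0"
  proof (rule LIMSEQ_I)
    fix \<epsilon> :: real assume \<epsilon>: "0 < \<epsilon>"
    \<comment> \<open>The bound 1 gives \<open>\<eta>\<^sup>2 \<le> \<eta>\<close>, so that the
      error \<open>(\<eta>\<^sup>2 + \<eta>) * kmax\<^sup>2\<close> is at most half of
      \<open>\<epsilon>\<close>.\<close>
    define \<eta> where "\<eta> = min 1 (\<epsilon> / (4 * kmax\<^sup>2))"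
    have \<eta>: "0 < \<eta>" "\<eta> \<le> 1" "\<eta> \<le> \<epsilon> / (4 * kmax\<^sup>2)" using \<epsilon> kmax_pos by (auto simp: \<eta>_def)
    obtain d1 where d1: "0 < d1" "\<And>y. p (chi - y) < d1 \<Longrightarrow> \<bar>r y - r chi\<bar> < \<eta>"
      using seminorm_continuous_nearD[OF seminorm cont(1) \<eta>(1)] by blast
    obtain d2 where d2: "0 < d2" "\<And>y. p (chi - y) < d2 \<Longrightarrow> \<bar>v y - v chi\<bar> < \<eta>"
      using seminorm_continuous_nearD[OF seminorm cont(2) \<eta>(1)] by blast
    have "eventually (\<lambda>n. h n < min d1 d2) sequentially"
      using d1(1) d2(1) by (intro order_tendstoD(2)[OF h(2)]) auto
    then have "eventually (\<lambda>n. norm (a n - b n - 0) < \<epsilon>) sequentially"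
    proof eventually_elim
      case (elim n)
      have Fp: "0 < F (h n)" by (rule small_ball_pos[OF h(1)])
      have "\<bar>expectation (\<lambda>\<omega>. (K (R \<omega> / h n) * (Y \<omega> - r chi))\<^sup>2) - v chi * expectation (\<lambda>\<omega>. (K (R \<omega> / h n))\<^sup>2)\<bar>
        \<le> (\<eta>\<^sup>2 + \<eta>) * kmax\<^sup>2 * F (h n)"
        using elim d1(2) d2(2)
        by (intro variance_near_center[OF Y reg r v cv h(1) \<eta>(1)]) (auto simp: less_imp_le)
      moreover have "a n - b n = (expectation (\<lambda>\<omega>. (K (R \<omega> / h n) * (Y \<omega> - r chi))\<^sup>2) - v chi * expectation (\<lambda>\<omega>. (K (R \<omega> / h n))\<^sup>2)) / F (h n)"
        by (simp add: a_def b_def diff_divide_distrib)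
      ultimately have "\<bar>a n - b n\<bar> \<le> (\<eta>\<^sup>2 + \<eta>) * kmax\<^sup>2"
        using Fp by (simp only: abs_divide abs_of_pos pos_divide_le_eq)
      also have "\<dots> \<le> (2 * (\<epsilon> / (4 * kmax\<^sup>2))) * kmax\<^sup>2"
      proof (intro mult_right_mono)
        have "\<eta>\<^sup>2 \<le> \<eta>" using \<eta> by (simp add: power2_eq_square mult_left_le)
        then show "\<eta>\<^sup>2 + \<eta> \<le> 2 * (\<epsilon> / (4 * kmax\<^sup>2))" using \<eta>(3) by linarith
      qed auto
      also have "\<dots> < \<epsilon>" using \<epsilon> kmax_pos by (simp add: field_simps)
      finally show ?case by simp
    qed
    then show "\<exists>no. \<forall>n\<ge>no. norm (a n - b n - 0) < \<epsilon>" by (simp add: eventually_sequentially)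
  qed
  moreover have "b \<longlonglongrightarrow> v chi * M2 K \<tau>\<^sub>0"
    unfolding b_def by (intro tendsto_mult_left kernel_limits(2) h)
  ultimately have "(\<lambda>n. (a n - b n) + b n) \<longlonglongrightarrow> 0 + v chi * M2 K \<tau>\<^sub>0" by (rule tendsto_add)
  then show ?thesis by (simp add: a_def)
qed

end

section \<open>Asymptotics of the ratio\<close>

text \<open>Eventually \<open>b n\<close> exceeds \<open>\<gamma> / 2\<close>, and with
  \<open>y = \<gamma> * x / 2\<close> the claim reduces to \<open>y^2 / exp y\<close> tending to
  0.\<close>

lemma exp_decay_beats_square:
  fixes x b :: "nat \<Rightarrow> real"
  assumes x: "filterlim x at_top sequentially" and b: "b \<longlonglongrightarrow> \<gamma>" "0 < \<gamma>"
  shows "(\<lambda>n. (x n)\<^sup>2 * exp (- x n * b n)) \<longlonglongrightarrow> 0"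
proof (rule tendsto_sandwich[OF _ _ tendsto_const])
  have "((\<lambda>y. y ^ 2 / exp y) \<longlongrightarrow> 0) (at_top :: real filter)" by (rule tendsto_power_div_exp_0)
  moreover have "filterlim (\<lambda>n. \<gamma> / 2 * x n) at_top sequentially"
    using b(2) by (intro filterlim_tendsto_pos_mult_at_top[OF tendsto_const _ x]) auto
  ultimately have "(\<lambda>n. (\<gamma> / 2 * x n) ^ 2 / exp (\<gamma> / 2 * x n)) \<longlonglongrightarrow> 0" by (rule filterlim_compose)
  from tendsto_mult_left[OF this, of "4 / \<gamma>\<^sup>2"]
  show "(\<lambda>n. (x n)\<^sup>2 * exp (- x n * (\<gamma> / 2))) \<longlonglongrightarrow> 0"
    using b(2) by (simp add: power2_eq_square exp_minus field_simps)
  have "eventually (\<lambda>n. \<gamma> / 2 < b n) sequentially" using b by (intro order_tendstoD(1)[OF b(1)]) auto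
  moreover have "eventually (\<lambda>n. 0 < x n) sequentially" using x by (simp add: filterlim_at_top_dense)
  ultimately show "eventually (\<lambda>n. (x n)\<^sup>2 * exp (- x n * b n) \<le> (x n)\<^sup>2 * exp (- x n * (\<gamma> / 2))) sequentially"
    by eventually_elim (auto intro!: mult_left_mono)
qed (auto intro!: always_eventually)

text \<open>The probabilistic content after the kernel has been abstracted away: \<open>f i\<close>
  stands for \<open>F (h i)\<close>, \<open>k i\<close> for the kernel value and \<open>G i\<close>
  for the response deviation cut to the ball. The limits \<open>\<mu>\<close>, \<open>s\<close>,
  \<open>m\<close>, \<open>v\<close> will be \<open>M1\<close>, \<open>M2\<close>,
  \<open>\<phi>'(0)\<close> times \<open>M0\<close>, and the noise variance at the centre times
  \<open>M2\<close>.\<close>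

locale weighted_ratio_sequence = prob_space M for M :: "'a measure" +
  fixes k G :: "nat \<Rightarrow> 'a \<Rightarrow> real" and f h :: "nat \<Rightarrow> real" and l c kmax C \<mu> s m v \<alpha> :: real and \<beta> :: "real \<Rightarrow> real"
  assumes indep: "indep_vars (\<lambda>_. borel) (\<lambda>i \<omega>. (k i \<omega>, G i \<omega>)) {1..}"
    and k_bounds: "1 \<le> i \<Longrightarrow> \<omega> \<in> space M \<Longrightarrow> 0 \<le> k i \<omega> \<and> k i \<omega> \<le> kmax"
    and G_sq: "1 \<le> i \<Longrightarrow> integrable M (\<lambda>\<omega>. (G i \<omega>)\<^sup>2)"
    and f_pos: "1 \<le> i \<Longrightarrow> 0 < f i" and f_le_1: "1 \<le> i \<Longrightarrow> f i \<le> 1"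
    and h_pos: "1 \<le> i \<Longrightarrow> 0 < h i" and h_lim: "h \<longlonglongrightarrow> 0"
    and C_nonneg: "0 \<le> C"
    and mean_k_le: "1 \<le> i \<Longrightarrow> expectation (k i) \<le> C * f i"
    and mean_G_le: "1 \<le> i \<Longrightarrow> expectation (\<lambda>\<omega>. (G i \<omega>)\<^sup>2) \<le> C * f i"
    and lim_k: "(\<lambda>i. expectation (k i) / f i) \<longlonglongrightarrow> \<mu>"
    and lim_k2: "(\<lambda>i. expectation (\<lambda>\<omega>. (k i \<omega>)\<^sup>2) / f i) \<longlonglongrightarrow> s"
    and lim_kG: "(\<lambda>i. expectation (\<lambda>\<omega>. k i \<omega> * G i \<omega>) / (h i * f i)) \<longlonglongrightarrow> m"
    and lim_kG2: "(\<lambda>i. expectation (\<lambda>\<omega>. (k i \<omega> * G i \<omega>)\<^sup>2) / f i) \<longlonglongrightarrow> v"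
    and nf: "filterlim (\<lambda>n. real n * f n) at_top sequentially"
    and nfh: "(\<lambda>n. real n * f n * (h n)\<^sup>2) \<longlonglongrightarrow> c" and c_pos: "0 < c"
    and l: "0 \<le> l" "l \<le> 1"
    and A_lim: "(\<lambda>n. 1 / real n * (\<Sum>i=1..n. h i / h n * (f i / f n) powr (1 - l))) \<longlonglongrightarrow> \<alpha>"
    and B_lim: "\<And>q. q \<le> 1 \<Longrightarrow> (\<lambda>n. 1 / real n * (\<Sum>i=1..n. (f i / f n) powr q)) \<longlonglongrightarrow> \<beta> q"
    and \<mu>_pos: "0 < \<mu>" and \<beta>_pos: "0 < \<beta> (1 - l)"
begin

definition "N n = real n * f n"
definition "w q n i = 1 / real n * (f i / f n) powr q"
text \<open>The weight \<open>1 / f i powr l\<close> of the estimator times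
  \<open>f n powr l / N n\<close>. The added factor does not depend on \<open>i\<close>, so it
  cancels in the ratio; it normalises the mean of the denominator.\<close>

definition "a n i = (f i / f n) powr (- l) / N n"
definition "Z n i \<omega> = a n i * k i \<omega>"

lemma N_pos: "1 \<le> n \<Longrightarrow> 0 < N n" using f_pos by (simp add: N_def)

lemma N_lim: "filterlim N at_top sequentially" using nf by (simp add: N_def[abs_def])

lemma inverse_N_lim: "(\<lambda>n. 1 / N n) \<longlonglongrightarrow> 0"
  using tendsto_inverse_0_at_top[OF N_lim] by (simp add: inverse_eq_divide)

lemma w_nonneg: "0 \<le> w q n i" by (simp add: w_def)

lemma a_nonneg: "0 \<le> a n i"
proof (cases "n = 0")
  case False
  then show ?thesis using N_pos[of n] by (simp add: a_def)
qed (simp add: a_def N_def)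

text \<open>With \<open>u = f i / f n\<close> one has \<open>f i = u * N n / n\<close>, and the
  powers of \<open>N n\<close> cancel. This is why every moment sum becomes an average of the type
  controlled by the hypotheses: \<open>j = 0\<close> for means, \<open>j = 1\<close> for second
  moments, \<open>j = 3\<close> for the fourth power of the weights.\<close>

lemma a_power_f:
  assumes "1 \<le> n" "1 \<le> i"
  shows "N n ^ j * (a n i ^ Suc j * f i) = w (1 - real (Suc j) * l) n i"
proof -
  define u where "u = f i / f n"
  have u: "0 < u" using f_pos assms by (simp add: u_def)
  have fi: "f i = u * N n / real n" using f_pos[OF assms(1)] assms(1) by (simp add: u_def N_def)
  have A: "a n i ^ Suc j = u powr (- (real (Suc j) * l)) / N n ^ Suc j"
    unfolding a_def u_def[symmetric] power_divide using u by (simp add: powr_power mult.commute del: power_Suc)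
  have W: "u powr (1 - real (Suc j) * l) = u powr (- (real (Suc j) * l)) * u"
    using u powr_add[of u "- (real (Suc j) * l)" 1] by simp
  show ?thesis
    unfolding w_def A u_def[symmetric] W using N_pos[OF assms(1)] by (subst fi) simp
qed

lemma w_total: "q \<le> 1 \<Longrightarrow> (\<lambda>n. \<Sum>i=1..n. w q n i) \<longlonglongrightarrow> \<beta> q"
  using B_lim by (simp add: w_def sum_distrib_left)

text \<open>As \<open>f n\<close> is at most 1, \<open>f n \<le> f n powr q\<close> for every
  \<open>q \<le> 1\<close>. For fixed \<open>i\<close> the weight is thus of order
  \<open>1 / N n\<close>, which supplies the pointwise condition of the Toeplitz lemma.\<close>

lemma w_le:
  assumes "1 \<le> n" "1 \<le> i" "q \<le> 1"
  shows "w q n i \<le> f i powr q * (1 / N n)"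
proof -
  have "f n powr 1 \<le> f n powr q" using assms less_imp_le[OF f_pos[of n]] f_le_1 by (intro powr_mono') auto
  then have "f n \<le> f n powr q" using f_pos[OF assms(1)] by simp
  then have "f i powr q / (real n * f n powr q) \<le> f i powr q / (real n * f n)"
    using f_pos[OF assms(1)] assms(1) by (intro divide_left_mono mult_left_mono mult_pos_pos) auto
  then show ?thesis using f_pos assms by (simp add: w_def N_def powr_divide)
qed

lemma w_single:
  assumes "1 \<le> i" "q \<le> 1"
  shows "(\<lambda>n. w q n i) \<longlonglongrightarrow> 0"
proof (rule tendsto_sandwich[OF _ _ tendsto_const])
  show "(\<lambda>n. f i powr q * (1 / N n)) \<longlonglongrightarrow> 0"
    using tendsto_mult_left[OF inverse_N_lim, of "f i powr q"] by simp
  show "eventually (\<lambda>n. w q n i \<le> f i powr q * (1 / N n)) sequentially"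
    using eventually_ge_at_top[of 1] by eventually_elim (rule w_le[OF _ assms])
qed (simp add: w_nonneg)

lemma w_average: "q \<le> 1 \<Longrightarrow> x \<longlonglongrightarrow> L \<Longrightarrow> (\<lambda>n. \<Sum>i=1..n. w q n i * x i) \<longlonglongrightarrow> \<beta> q * L"
  by (rule weighted_average_tendsto[OF w_nonneg w_total w_single])

text \<open>Writing \<open>x i\<close> as \<open>f i\<close> times a convergent factor reduces the
  sum to a Toeplitz average. Since \<open>l\<close> is nonnegative, the exponent
  \<open>1 - real (Suc j) * l\<close> stays at most 1, where \<open>B_lim\<close> is
  available.\<close>

lemma scaled_sum_tendsto:
  assumes x: "(\<lambda>i. x i / f i) \<longlonglongrightarrow> L"
  shows "(\<lambda>n. N n ^ j * (\<Sum>i=1..n. a n i ^ Suc j * x i)) \<longlonglongrightarrow> \<beta> (1 - real (Suc j) * l) * L"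
proof (rule Lim_transform_eventually)
  show "(\<lambda>n. \<Sum>i=1..n. w (1 - real (Suc j) * l) n i * (x i / f i)) \<longlonglongrightarrow> \<beta> (1 - real (Suc j) * l) * L"
    using l by (intro w_average x) simp
  show "eventually (\<lambda>n. (\<Sum>i=1..n. w (1 - real (Suc j) * l) n i * (x i / f i)) = N n ^ j * (\<Sum>i=1..n. a n i ^ Suc j * x i)) sequentially"
    using eventually_ge_at_top[of 1]
  proof eventually_elim
    case (elim n)
    show ?case unfolding sum_distrib_left
    proof (intro sum.cong refl)
      fix i assume "i \<in> {1..n}"
      then show "w (1 - real (Suc j) * l) n i * (x i / f i) = N n ^ j * (a n i ^ Suc j * x i)"
        using a_power_f[OF elim, of i j, symmetric] f_pos[of i] by simp
    qed
  qed
qed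

lemma array: "bounded_weight_array M (Z n) G {1..n} (\<lambda>i. a n i * kmax)"
proof (unfold_locales, goal_cases)
  case 1 show ?case by simp
next
  case 2
  have "(\<lambda>p. (a n i * fst p, snd p)) \<in> borel_measurable (borel :: (real \<times> real) measure)" for i
    by (intro borel_measurable_continuous_onI continuous_intros)
  from indep_vars_compose2[OF indep_vars_subset[OF indep, of "{1..n}"], of "\<lambda>i p. (a n i * fst p, snd p)" "\<lambda>_. borel"] this
  show ?case by (auto simp: Z_def)
next
  case (3 i \<omega>)
  then show ?case using k_bounds[of i \<omega>] a_nonneg[of n i] by (simp add: Z_def mult_left_mono)
next
  case (4 i)
  then show ?case using G_sq by simp
qed

text \<open>These are the quantities of one row, with the deterministic weight pulled out of the
  expectations; this is the shape to which \<open>scaled_sum_tendsto\<close> applies.\<close>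

definition "num n \<omega> = (\<Sum>i=1..n. Z n i \<omega> * G i \<omega>)"
definition "den n \<omega> = (\<Sum>i=1..n. Z n i \<omega>)"
definition "mean_den n = (\<Sum>i=1..n. a n i * expectation (k i))"
definition "mean_num n = (\<Sum>i=1..n. a n i * expectation (\<lambda>\<omega>. k i \<omega> * G i \<omega>))"
definition "sq_num n = (\<Sum>i=1..n. (a n i)\<^sup>2 * expectation (\<lambda>\<omega>. (k i \<omega> * G i \<omega>)\<^sup>2))"
definition "sq_den n = (\<Sum>i=1..n. (a n i)\<^sup>2 * expectation (\<lambda>\<omega>. (k i \<omega>)\<^sup>2))"
definition "sq_mean_num n = (\<Sum>i=1..n. (a n i)\<^sup>2 * (expectation (\<lambda>\<omega>. k i \<omega> * G i \<omega>))\<^sup>2)"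
text \<open>The last sum in the bound of \<open>num_moments\<close>: the squared bound
  \<open>(a n i * kmax)^2\<close> meets the squared weight of the summand, which leaves a fourth
  power; \<open>kmax^2\<close> is kept outside.\<close>

definition "fourth n = (\<Sum>i=1..n. (a n i) ^ 4 * expectation (\<lambda>\<omega>. (k i \<omega> * G i \<omega>)\<^sup>2))"
definition "mixed n = expectation (\<lambda>\<omega>. (num n \<omega> * (den n \<omega> - mean_den n))\<^sup>2)"

lemma array_defs:
  "bounded_weight_array.num (Z n) G {1..n} = num n"
  "bounded_weight_array.den (Z n) {1..n} = den n"
  "bounded_weight_array.mean_den M (Z n) {1..n} = mean_den n"
  "bounded_weight_array.mean_num M (Z n) G {1..n} = mean_num n"
  "bounded_weight_array.sq_num M (Z n) G {1..n} = sq_num n"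
  "bounded_weight_array.sq_den M (Z n) {1..n} = sq_den n"
  by (simp_all only: fun_eq_iff bounded_weight_array.num_def[OF array] bounded_weight_array.den_def[OF array]
    bounded_weight_array.mean_den_def[OF array] bounded_weight_array.mean_num_def[OF array]
    bounded_weight_array.sq_num_def[OF array] bounded_weight_array.sq_den_def[OF array]
    num_def den_def mean_den_def mean_num_def sq_num_def sq_den_def)
    (simp_all add: Z_def[abs_def] power_mult_distrib mult.assoc)

lemmas array_facts =
  bounded_weight_array.num_moments[OF array, unfolded array_defs]
  bounded_weight_array.prob_den_small[OF array, unfolded array_defs]
  bounded_weight_array.ratio_second_moment[OF array, unfolded array_defs]

end

section \<open>Limits of the moments of numerator and denominator\<close>

context weighted_ratio_sequence begin

lemma mean_den_lim: "mean_den \<longlonglongrightarrow> \<beta> (1 - l) * \<mu>"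
  using scaled_sum_tendsto[OF lim_k, of 0] by (simp add: mean_den_def[abs_def])

lemma sq_den_lim: "(\<lambda>n. N n * sq_den n) \<longlonglongrightarrow> \<beta> (1 - 2 * l) * s"
  using scaled_sum_tendsto[OF lim_k2, of 1] by (simp add: sq_den_def numeral_2_eq_2)

lemma sq_num_lim: "(\<lambda>n. N n * sq_num n) \<longlonglongrightarrow> \<beta> (1 - 2 * l) * v"
  using scaled_sum_tendsto[OF lim_kG2, of 1] by (simp add: sq_num_def numeral_2_eq_2)

lemma fourth_lim: "(\<lambda>n. N n ^ 3 * fourth n) \<longlonglongrightarrow> \<beta> (1 - 4 * l) * v"
  using scaled_sum_tendsto[OF lim_kG2, of 3] by (simp add: fourth_def numeral_eq_Suc)

text \<open>This sum is the difference between second moments and variances. Each mean is of order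
  \<open>h i * f i\<close>, so its square divided by \<open>f i\<close> is of order
  \<open>(h i)^2 * f i\<close> and tends to 0.\<close>

lemma sq_mean_num_lim: "(\<lambda>n. N n * sq_mean_num n) \<longlonglongrightarrow> 0"
proof -
  let ?g = "\<lambda>i. expectation (\<lambda>\<omega>. k i \<omega> * G i \<omega>)"
  have "(\<lambda>i. (?g i)\<^sup>2 / f i) \<longlonglongrightarrow> 0"
  proof (rule tendsto_sandwich[OF _ _ tendsto_const])
    show "(\<lambda>i. (h i)\<^sup>2 * (?g i / (h i * f i))\<^sup>2) \<longlonglongrightarrow> 0"
      using tendsto_mult[OF tendsto_power[OF h_lim, of 2] tendsto_power[OF lim_kG, of 2]] by simp
    show "eventually (\<lambda>i. (?g i)\<^sup>2 / f i \<le> (h i)\<^sup>2 * (?g i / (h i * f i))\<^sup>2) sequentially"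
      using eventually_ge_at_top[of 1]
    proof eventually_elim
      case (elim i)
      have "(?g i)\<^sup>2 / f i = (?g i / f i)\<^sup>2 * f i" using f_pos[OF elim] by (simp add: power2_eq_square)
      also have "\<dots> \<le> (?g i / f i)\<^sup>2 * 1" using f_le_1[OF elim] by (intro mult_left_mono) auto
      also have "\<dots> = (h i)\<^sup>2 * (?g i / (h i * f i))\<^sup>2"
        using h_pos[OF elim] by (simp add: power2_eq_square field_simps)
      finally show ?case .
    qed
    show "eventually (\<lambda>i. 0 \<le> (?g i)\<^sup>2 / f i) sequentially"
      using eventually_ge_at_top[of 1] by eventually_elim (simp add: less_imp_le[OF f_pos])
  qed
  from scaled_sum_tendsto[OF this, of 1] show ?thesis by (simp add: sq_mean_num_def numeral_2_eq_2)
qed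

text \<open>The means are \<open>h i * f i\<close> times a convergent factor, so the ratio of
  bandwidths enters the Toeplitz weights and the total mass is the average \<open>A\<close> with
  limit \<open>\<alpha>\<close>.\<close>

lemma mean_num_lim: "(\<lambda>n. mean_num n / h n) \<longlonglongrightarrow> \<alpha> * m"
proof -
  \<comment> \<open>The bandwidths are positive from index 1 on only, whereas the Toeplitz lemma
    asks for nonnegative weights at all indices; the absolute value covers index 0.\<close>
  define W where "W = (\<lambda>n i. w (1 - l) n i * \<bar>h i / h n\<bar>)"
  have total: "(\<lambda>n. \<Sum>i=1..n. W n i) \<longlonglongrightarrow> \<alpha>"
  proof (rule Lim_transform_eventually[OF A_lim])
    show "eventually (\<lambda>n. 1 / real n * (\<Sum>i=1..n. h i / h n * (f i / f n) powr (1 - l)) = (\<Sum>i=1..n. W n i)) sequentially"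
      using eventually_ge_at_top[of 1]
    proof eventually_elim
      case (elim n)
      show ?case unfolding sum_distrib_left
      proof (intro sum.cong refl)
        fix i assume "i \<in> {1..n}"
        then show "1 / real n * (h i / h n * (f i / f n) powr (1 - l)) = W n i"
          using h_pos[of i] h_pos[OF elim] by (simp add: W_def w_def)
      qed
    qed
  qed
  \<comment> \<open>The quotient equals \<open>h n / (N n * (h n)^2)\<close>, where the denominator
    tends to the positive number \<open>c\<close>. It follows that \<open>N n * h n\<close> outgrows
    the division by \<open>h n\<close> in the weights.\<close>
  have Nh: "(\<lambda>n. 1 / (N n * h n)) \<longlonglongrightarrow> 0"
  proof (rule Lim_transform_eventually)
    have "(\<lambda>n. h n / (real n * f n * (h n)\<^sup>2)) \<longlonglongrightarrow> 0 / c"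
      using c_pos by (intro tendsto_divide h_lim nfh) auto
    then show "(\<lambda>n. h n / (real n * f n * (h n)\<^sup>2)) \<longlonglongrightarrow> 0" by simp
    show "eventually (\<lambda>n. h n / (real n * f n * (h n)\<^sup>2) = 1 / (N n * h n)) sequentially"
      using eventually_ge_at_top[of 1]
      by eventually_elim (simp add: N_def power2_eq_square less_imp_neq[OF h_pos, symmetric])
  qed
  have single: "(\<lambda>n. W n i) \<longlonglongrightarrow> 0" if i: "1 \<le> i" for i
  proof (rule tendsto_sandwich[OF _ _ tendsto_const])
    show "(\<lambda>n. f i powr (1 - l) * h i * (1 / (N n * h n))) \<longlonglongrightarrow> 0"
      using tendsto_mult_left[OF Nh, of "f i powr (1 - l) * h i"] by simp
    show "eventually (\<lambda>n. W n i \<le> f i powr (1 - l) * h i * (1 / (N n * h n))) sequentially"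
      using eventually_ge_at_top[of 1]
    proof eventually_elim
      case (elim n)
      have "W n i \<le> (f i powr (1 - l) * (1 / N n)) * \<bar>h i / h n\<bar>"
        unfolding W_def using l by (intro mult_right_mono w_le elim i) auto
      also have "\<dots> = f i powr (1 - l) * h i * (1 / (N n * h n))"
        using h_pos[OF elim] h_pos[OF i] by simp
      finally show ?case .
    qed
  qed (simp add: W_def w_nonneg)
  have "(\<lambda>n. \<Sum>i=1..n. W n i * (expectation (\<lambda>\<omega>. k i \<omega> * G i \<omega>) / (h i * f i))) \<longlonglongrightarrow> \<alpha> * m"
    by (rule weighted_average_tendsto[OF _ total single lim_kG]) (simp add: W_def w_nonneg)
  then show ?thesis
  proof (rule Lim_transform_eventually)
    show "eventually (\<lambda>n. (\<Sum>i=1..n. W n i * (expectation (\<lambda>\<omega>. k i \<omega> * G i \<omega>) / (h i * f i))) = mean_num n / h n) sequentially"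
      using eventually_ge_at_top[of 1]
    proof eventually_elim
      case (elim n)
      show ?case unfolding mean_num_def sum_divide_distrib
      proof (intro sum.cong refl)
        fix i assume i: "i \<in> {1..n}"
        then show "W n i * (expectation (\<lambda>\<omega>. k i \<omega> * G i \<omega>) / (h i * f i)) = a n i * expectation (\<lambda>\<omega>. k i \<omega> * G i \<omega>) / h n"
          using a_power_f[OF elim, of i 0, symmetric] h_pos[of i] f_pos[of i] h_pos[OF elim] by (simp add: W_def)
      qed
    qed
  qed
qed

lemma mean_num_sq_lim: "(\<lambda>n. N n * (mean_num n)\<^sup>2) \<longlonglongrightarrow> c * (\<alpha> * m)\<^sup>2"
proof (rule Lim_transform_eventually)
  show "(\<lambda>n. real n * f n * (h n)\<^sup>2 * (mean_num n / h n)\<^sup>2) \<longlonglongrightarrow> c * (\<alpha> * m)\<^sup>2"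
    by (intro tendsto_mult nfh tendsto_power mean_num_lim)
  show "eventually (\<lambda>n. real n * f n * (h n)\<^sup>2 * (mean_num n / h n)\<^sup>2 = N n * (mean_num n)\<^sup>2) sequentially"
    using eventually_ge_at_top[of 1]
    by eventually_elim (simp add: N_def power_divide less_imp_neq[OF h_pos, symmetric])
qed

lemma num_sq_lim:
  "(\<lambda>n. N n * expectation (\<lambda>\<omega>. (num n \<omega>)\<^sup>2)) \<longlonglongrightarrow> c * (\<alpha> * m)\<^sup>2 + \<beta> (1 - 2 * l) * v"
proof -
  have eq: "expectation (\<lambda>\<omega>. (num n \<omega>)\<^sup>2) = (mean_num n)\<^sup>2 + sq_num n - sq_mean_num n" for n
    unfolding array_facts(2) by (simp add: sq_mean_num_def Z_def mult.assoc power_mult_distrib)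
  have "(\<lambda>n. N n * expectation (\<lambda>\<omega>. (num n \<omega>)\<^sup>2)) = (\<lambda>n. N n * (mean_num n)\<^sup>2 + N n * sq_num n - N n * sq_mean_num n)"
    unfolding eq by (simp add: algebra_simps)
  then show ?thesis
    using tendsto_diff[OF tendsto_add[OF mean_num_sq_lim sq_num_lim] sq_mean_num_lim] by simp
qed

lemma mixed_nonneg: "0 \<le> mixed n"
  unfolding mixed_def by (intro integral_nonneg_AE) simp

text \<open>After multiplication by \<open>N n\<close>, each term of the bound in
  \<open>num_moments\<close> is a product of convergent sequences with at least one spare factor
  \<open>1 / N n\<close>.\<close>

lemma mixed_lim: "(\<lambda>n. N n * mixed n) \<longlonglongrightarrow> 0"
proof (rule tendsto_sandwich[OF _ _ tendsto_const])
  let ?u = "\<lambda>n. 2 * (N n * (mean_num n)\<^sup>2) * (N n * sq_den n) * (1 / N n) + 6 * (N n * sq_num n) * (N n * sq_den n) * (1 / N n)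
    + 2 * kmax\<^sup>2 * (N n ^ 3 * fourth n) * (1 / N n) * (1 / N n)"
  have "?u \<longlonglongrightarrow> 2 * (c * (\<alpha> * m)\<^sup>2) * (\<beta> (1 - 2 * l) * s) * 0 + 6 * (\<beta> (1 - 2 * l) * v) * (\<beta> (1 - 2 * l) * s) * 0
    + 2 * kmax\<^sup>2 * (\<beta> (1 - 4 * l) * v) * 0 * 0"
    by (intro tendsto_intros mean_num_sq_lim sq_den_lim sq_num_lim fourth_lim inverse_N_lim)
  then show "?u \<longlonglongrightarrow> 0" by simp
  show "eventually (\<lambda>n. N n * mixed n \<le> ?u n) sequentially"
    using eventually_ge_at_top[of 1]
  proof eventually_elim
    case (elim n)
    note N = N_pos[OF elim]
    have "(\<Sum>i=1..n. (a n i * kmax)\<^sup>2 * expectation (\<lambda>\<omega>. (Z n i \<omega> * G i \<omega>)\<^sup>2)) = kmax\<^sup>2 * fourth n"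
    proof -
      have 1: "(Z n i \<omega> * G i \<omega>)\<^sup>2 = (a n i)\<^sup>2 * (k i \<omega> * G i \<omega>)\<^sup>2" for i \<omega>
        by (simp add: Z_def power_mult_distrib)
      have 2: "(x * y)\<^sup>2 * (x\<^sup>2 * z) = y\<^sup>2 * (x ^ 4 * z)" for x y z :: real
        by (simp add: power2_eq_square power4_eq_xxxx)
      show ?thesis unfolding fourth_def sum_distrib_left 1 integral_mult_right_zero 2 ..
    qed
    then have "mixed n \<le> 2 * (mean_num n)\<^sup>2 * sq_den n + 6 * sq_num n * sq_den n + 2 * (kmax\<^sup>2 * fourth n)"
      using array_facts(4)[of n] by (simp add: mixed_def)
    then have "N n * mixed n \<le> N n * (2 * (mean_num n)\<^sup>2 * sq_den n + 6 * sq_num n * sq_den n + 2 * (kmax\<^sup>2 * fourth n))"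
      using N by (intro mult_left_mono) auto
    also have "\<dots> = ?u n" using N by (simp add: field_simps power3_eq_cube)
    finally show ?case .
  qed
  show "eventually (\<lambda>n. 0 \<le> N n * mixed n) sequentially"
    using eventually_ge_at_top[of 1] by eventually_elim (simp add: mixed_nonneg less_imp_le[OF N_pos])
qed

lemma sq_den_limit_nonneg: "0 \<le> \<beta> (1 - 2 * l) * s"
proof (rule tendsto_lowerbound[OF sq_den_lim])
  show "eventually (\<lambda>n. 0 \<le> N n * sq_den n) sequentially"
    using eventually_ge_at_top[of 1]
    by eventually_elim (auto simp: sq_den_def less_imp_le[OF N_pos] intro!: mult_nonneg_nonneg sum_nonneg integral_nonneg_AE)
qed simp

text \<open>The Laplace parameter of the lower tail bound is \<open>\<theta> * N n\<close>, with \<open>\<theta>\<close> small enough that the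
  quadratic term of the exponent does not outweigh the linear one.\<close>

definition "\<theta> = \<beta> (1 - l) * \<mu> / (2 * (\<beta> (1 - 2 * l) * s + 1))"
definition "rate n = \<theta> * mean_den n / 2 - \<theta>\<^sup>2 * (N n * sq_den n) / 2"

lemma \<theta>_pos: "0 < \<theta>"
  using sq_den_limit_nonneg \<mu>_pos \<beta>_pos by (simp add: \<theta>_def add_nonneg_pos)

text \<open>With \<open>d\<close> and \<open>S\<close> the limits of \<open>mean_den\<close> and
  \<open>N n * sq_den n\<close>, the choice of \<open>\<theta>\<close> gives
  \<open>\<theta> * S \<le> d / 2\<close>, so the limit of the rate is at least
  \<open>\<theta> * d / 4\<close>.\<close>

lemma rate_lim: "\<exists>\<gamma>>0. rate \<longlonglongrightarrow> \<gamma>"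
proof -
  define S where "S = \<beta> (1 - 2 * l) * s"
  define d where "d = \<beta> (1 - l) * \<mu>"
  have "0 \<le> S" "0 < d" using sq_den_limit_nonneg \<mu>_pos \<beta>_pos by (auto simp: S_def d_def)
  then have "\<theta> * S \<le> d / 2" unfolding \<theta>_def S_def[symmetric] d_def[symmetric] by (simp add: field_simps)
  then have "0 < \<theta> * (d / 2 - \<theta> * S / 2)" using \<theta>_pos \<open>0 < d\<close> by (intro mult_pos_pos) auto
  then have "0 < \<theta> * d / 2 - \<theta>\<^sup>2 * S / 2" by (simp add: algebra_simps power2_eq_square)
  moreover have "rate \<longlonglongrightarrow> \<theta> * d / 2 - \<theta>\<^sup>2 * S / 2"
    unfolding rate_def S_def d_def by (intro tendsto_intros mean_den_lim sq_den_lim) auto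
  ultimately show ?thesis by blast
qed

lemma tail_lim: "(\<lambda>n. (N n)\<^sup>2 * exp (- N n * rate n)) \<longlonglongrightarrow> 0"
  using rate_lim exp_decay_beats_square[OF N_lim] by blast

lemma laplace_exponent: "(\<theta> * N n)\<^sup>2 * sq_den n / 2 - \<theta> * N n * mean_den n / 2 = - N n * rate n"
  by (simp add: rate_def algebra_simps power2_eq_square)

text \<open>Once \<open>mean_den n\<close> is positive, a vanishing denominator lies in the lower
  tail of the Chernoff bound. The cruder factor \<open>(N n)^2\<close> lets \<open>tail_lim\<close>
  be reused.\<close>

lemma zero_den_lim: "(\<lambda>n. N n * prob {\<omega> \<in> space M. den n \<omega> = 0}) \<longlonglongrightarrow> 0"
proof (rule tendsto_sandwich[OF _ _ tendsto_const tail_lim])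
  have "eventually (\<lambda>n. 1 \<le> N n) sequentially" using N_lim by (simp add: filterlim_at_top)
  moreover have "eventually (\<lambda>n. 0 < mean_den n) sequentially"
    using \<mu>_pos \<beta>_pos by (intro order_tendstoD(1)[OF mean_den_lim]) simp
  ultimately show "eventually (\<lambda>n. N n * prob {\<omega> \<in> space M. den n \<omega> = 0} \<le> (N n)\<^sup>2 * exp (- N n * rate n)) sequentially"
    using eventually_ge_at_top[of 1]
  proof eventually_elim
    case (elim n)
    have [measurable]: "den n \<in> borel_measurable M"
      using bounded_weight_array.num_den_measurable(2)[OF array, of n] by (simp only: array_defs)
    have "prob {\<omega> \<in> space M. den n \<omega> = 0} \<le> prob {\<omega> \<in> space M. den n \<omega> \<le> mean_den n / 2}"
      using elim by (intro finite_measure_mono) auto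
    also have "\<dots> \<le> exp (- N n * rate n)"
      using array_facts(5)[of "\<theta> * N n" n] \<theta>_pos elim laplace_exponent[of n] by simp
    finally have "N n * prob {\<omega> \<in> space M. den n \<omega> = 0} \<le> N n * exp (- N n * rate n)"
      using elim by (intro mult_left_mono) auto
    also have "\<dots> \<le> (N n)\<^sup>2 * exp (- N n * rate n)"
      using elim by (intro mult_right_mono) (auto simp: power2_eq_square)
    finally show ?case .
  qed
  show "eventually (\<lambda>n. 0 \<le> N n * prob {\<omega> \<in> space M. den n \<omega> = 0}) sequentially"
    using eventually_ge_at_top[of 1] by eventually_elim (simp add: less_imp_le[OF N_pos])
qed

text \<open>Supplies the \<open>\<rho>\<close> of the leave-one-out estimate. With Laplace parameter
  \<open>\<theta> * N n\<close>, removing one weight costs the factor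
  \<open>exp (\<theta> * C)\<close>, which does not grow with \<open>n\<close>.\<close>

lemma mean_Z_le:
  assumes "1 \<le> n" "1 \<le> i"
  shows "expectation (Z n i) \<le> C / N n"
proof -
  have "expectation (Z n i) = a n i * expectation (k i)" by (simp add: Z_def[abs_def])
  also have "\<dots> \<le> a n i * (C * f i)" by (intro mult_left_mono mean_k_le a_nonneg assms)
  also have "\<dots> = C * w (1 - l) n i" using a_power_f[OF assms, of 0] by simp
  also have "\<dots> \<le> C * (f i powr (1 - l) * (1 / N n))"
    using l C_nonneg by (intro mult_left_mono w_le assms) auto
  also have "\<dots> \<le> C * (1 * (1 / N n))"
    using C_nonneg N_pos[OF assms(1)] f_le_1[OF assms(2)] less_imp_le[OF f_pos[OF assms(2)]] l
    by (intro mult_left_mono mult_right_mono powr_le1) auto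
  finally show ?thesis by simp
qed

lemma ratio_integrable: "eventually (\<lambda>n. integrable M (\<lambda>\<omega>. (num n \<omega> / den n \<omega>)\<^sup>2)) sequentially"
proof -
  have "eventually (\<lambda>n. 0 < mean_den n) sequentially"
    using \<mu>_pos \<beta>_pos by (intro order_tendstoD(1)[OF mean_den_lim]) simp
  then show ?thesis
    using eventually_ge_at_top[of 1]
  proof eventually_elim
    case (elim n)
    show ?case
      by (rule array_facts(6)[of n 1 "\<theta> * N n" "C / N n"]) (use elim \<theta>_pos N_pos[of n] mean_Z_le in auto)
  qed
qed

text \<open>The error terms of \<open>ratio_second_moment\<close>, multiplied by \<open>N n\<close>,
  are driven to 0 by letting \<open>\<eta>\<close> vanish slowly compared with the mixed moment and
  by the exponential decay of the lower tail.\<close>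

lemma ratio_deviation_lim:
  "(\<lambda>n. N n * expectation (\<lambda>\<omega>. (num n \<omega> / den n \<omega>)\<^sup>2) - N n * expectation (\<lambda>\<omega>. (num n \<omega>)\<^sup>2) / (mean_den n)\<^sup>2) \<longlonglongrightarrow> 0"
proof (rule Lim_null_comparison)
  define Y where "Y = (\<lambda>n. N n * expectation (\<lambda>\<omega>. (num n \<omega>)\<^sup>2))"
  define q where "q = (\<lambda>n. N n * mixed n)"
  define L where "L = c * (\<alpha> * m)\<^sup>2 + \<beta> (1 - 2 * l) * v"
  define d where "d = \<beta> (1 - l) * \<mu>"
  have d: "0 < d" using \<mu>_pos \<beta>_pos by (simp add: d_def)
  let ?u = "\<lambda>n. 6 / mean_den n ^ 3 * ((sqrt (q n) + 1 / N n) * Y n + sqrt (q n)) + 4 / mean_den n ^ 4 * q n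
      + C * (\<Sum>i=1..n. w 1 n i) * exp (\<theta> * C) * ((N n)\<^sup>2 * exp (- N n * rate n))"
  have "?u \<longlonglongrightarrow> 6 / d ^ 3 * ((sqrt 0 + 0) * L + sqrt 0) + 4 / d ^ 4 * 0 + C * \<beta> 1 * exp (\<theta> * C) * 0"
    unfolding Y_def q_def L_def d_def
    by (intro tendsto_intros mixed_lim num_sq_lim mean_den_lim inverse_N_lim w_total tail_lim) (use d in \<open>auto simp: d_def\<close>)
  then show "?u \<longlonglongrightarrow> 0" by simp
  have "eventually (\<lambda>n. 0 < mean_den n) sequentially"
    using \<mu>_pos \<beta>_pos by (intro order_tendstoD(1)[OF mean_den_lim]) simp
  then show "eventually (\<lambda>n. norm (N n * expectation (\<lambda>\<omega>. (num n \<omega> / den n \<omega>)\<^sup>2) - N n * expectation (\<lambda>\<omega>. (num n \<omega>)\<^sup>2) / (mean_den n)\<^sup>2) \<le> ?u n) sequentially"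
    using eventually_ge_at_top[of 1]
  proof eventually_elim
    case (elim n)
    note N = N_pos[OF elim(2)]
    \<comment> \<open>Balances \<open>\<eta> * Y n\<close> against \<open>q n / \<eta>\<close>: the
      parameter tends to 0, and the quotient is at most \<open>sqrt (q n)\<close>. The summand
      \<open>1 / N n\<close> keeps \<open>\<eta>\<close> positive when \<open>q n\<close> is
      0.\<close>
    define \<eta> where "\<eta> = sqrt (q n) + 1 / N n"
    have q0: "0 \<le> q n" using N mixed_nonneg by (simp add: q_def)
    have \<eta>: "0 < \<eta>" using q0 N by (simp add: \<eta>_def add_nonneg_pos)
    have q\<eta>: "q n / \<eta> \<le> sqrt (q n)"
    proof -
      have "q n = sqrt (q n) * sqrt (q n)" using q0 by simp
      also have "\<dots> \<le> sqrt (q n) * \<eta>" using q0 N by (intro mult_left_mono) (auto simp: \<eta>_def)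
      finally show ?thesis using \<eta> by (simp add: field_simps)
    qed
    \<comment> \<open>The cut responses have total second moment of order \<open>N n\<close>. With
      the outer factor \<open>N n\<close> this makes the square that the exponential has to
      beat.\<close>
    have gsum: "(\<Sum>i=1..n. expectation (\<lambda>\<omega>. (G i \<omega>)\<^sup>2)) \<le> C * (\<Sum>i=1..n. w 1 n i) * N n"
    proof -
      have "(\<Sum>i=1..n. expectation (\<lambda>\<omega>. (G i \<omega>)\<^sup>2)) \<le> (\<Sum>i=1..n. C * w 1 n i * N n)"
      proof (intro sum_mono)
        fix i assume "i \<in> {1..n}"
        then have i: "1 \<le> i" by simp
        have "w 1 n i * N n = f i" using f_pos[OF i] f_pos[OF elim(2)] elim(2) by (simp add: w_def N_def)
        then show "expectation (\<lambda>\<omega>. (G i \<omega>)\<^sup>2) \<le> C * w 1 n i * N n"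
          using mean_G_le[OF i] by (simp add: mult.assoc)
      qed
      then show ?thesis by (simp add: sum_distrib_left sum_distrib_right)
    qed
    have "\<bar>expectation (\<lambda>\<omega>. (num n \<omega> / den n \<omega>)\<^sup>2) - expectation (\<lambda>\<omega>. (num n \<omega>)\<^sup>2) / (mean_den n)\<^sup>2\<bar>
      \<le> 6 / mean_den n ^ 3 * (\<eta> * expectation (\<lambda>\<omega>. (num n \<omega>)\<^sup>2) + mixed n / \<eta>) + 4 / mean_den n ^ 4 * mixed n
        + (\<Sum>i=1..n. expectation (\<lambda>\<omega>. (G i \<omega>)\<^sup>2))
          * exp (\<theta> * N n * (C / N n) + (\<theta> * N n)\<^sup>2 * sq_den n / 2 - \<theta> * N n * mean_den n / 2)"
      unfolding mixed_def
      by (rule array_facts(7)) (use elim \<eta> \<theta>_pos N mean_Z_le in auto)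
    also have "\<theta> * N n * (C / N n) + (\<theta> * N n)\<^sup>2 * sq_den n / 2 - \<theta> * N n * mean_den n / 2 = \<theta> * C + - N n * rate n"
      using laplace_exponent[of n] N by simp
    also have "(\<Sum>i=1..n. expectation (\<lambda>\<omega>. (G i \<omega>)\<^sup>2)) * exp (\<theta> * C + - N n * rate n)
      \<le> C * (\<Sum>i=1..n. w 1 n i) * N n * exp (\<theta> * C + - N n * rate n)"
      by (intro mult_right_mono gsum) simp
    finally have "\<bar>expectation (\<lambda>\<omega>. (num n \<omega> / den n \<omega>)\<^sup>2) - expectation (\<lambda>\<omega>. (num n \<omega>)\<^sup>2) / (mean_den n)\<^sup>2\<bar>
      \<le> 6 / mean_den n ^ 3 * (\<eta> * expectation (\<lambda>\<omega>. (num n \<omega>)\<^sup>2) + mixed n / \<eta>) + 4 / mean_den n ^ 4 * mixed n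
        + C * (\<Sum>i=1..n. w 1 n i) * N n * exp (\<theta> * C + - N n * rate n)" by simp
    then have "N n * \<bar>expectation (\<lambda>\<omega>. (num n \<omega> / den n \<omega>)\<^sup>2) - expectation (\<lambda>\<omega>. (num n \<omega>)\<^sup>2) / (mean_den n)\<^sup>2\<bar>
      \<le> N n * (6 / mean_den n ^ 3 * (\<eta> * expectation (\<lambda>\<omega>. (num n \<omega>)\<^sup>2) + mixed n / \<eta>) + 4 / mean_den n ^ 4 * mixed n
        + C * (\<Sum>i=1..n. w 1 n i) * N n * exp (\<theta> * C + - N n * rate n))"
      using N by (intro mult_left_mono) auto
    also have "\<dots> = 6 / mean_den n ^ 3 * (\<eta> * Y n + q n / \<eta>) + 4 / mean_den n ^ 4 * q n
        + C * (\<Sum>i=1..n. w 1 n i) * exp (\<theta> * C) * ((N n)\<^sup>2 * exp (- N n * rate n))"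
      unfolding exp_add Y_def q_def power2_eq_square by (simp add: distrib_left mult_ac)
    also have "6 / mean_den n ^ 3 * (\<eta> * Y n + q n / \<eta>) \<le> 6 / mean_den n ^ 3 * (\<eta> * Y n + sqrt (q n))"
      using q\<eta> elim by (intro mult_left_mono add_left_mono) auto
    finally have le: "N n * \<bar>expectation (\<lambda>\<omega>. (num n \<omega> / den n \<omega>)\<^sup>2) - expectation (\<lambda>\<omega>. (num n \<omega>)\<^sup>2) / (mean_den n)\<^sup>2\<bar> \<le> ?u n"
      by (simp add: \<eta>_def)
    have "norm (N n * expectation (\<lambda>\<omega>. (num n \<omega> / den n \<omega>)\<^sup>2) - N n * expectation (\<lambda>\<omega>. (num n \<omega>)\<^sup>2) / (mean_den n)\<^sup>2)
      = N n * \<bar>expectation (\<lambda>\<omega>. (num n \<omega> / den n \<omega>)\<^sup>2) - expectation (\<lambda>\<omega>. (num n \<omega>)\<^sup>2) / (mean_den n)\<^sup>2\<bar>"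
      unfolding times_divide_eq_right[symmetric] right_diff_distrib[symmetric] using N by (simp add: abs_mult)
    then show ?case using le by simp
  qed
qed

theorem ratio_mean_square_lim:
  "(\<lambda>n. N n * expectation (\<lambda>\<omega>. (num n \<omega> / den n \<omega>)\<^sup>2))
    \<longlonglongrightarrow> (c * (\<alpha> * m)\<^sup>2 + \<beta> (1 - 2 * l) * v) / (\<beta> (1 - l) * \<mu>)\<^sup>2"
proof -
  have "(\<lambda>n. N n * expectation (\<lambda>\<omega>. (num n \<omega>)\<^sup>2) / (mean_den n)\<^sup>2)
    \<longlonglongrightarrow> (c * (\<alpha> * m)\<^sup>2 + \<beta> (1 - 2 * l) * v) / (\<beta> (1 - l) * \<mu>)\<^sup>2"
    using \<mu>_pos \<beta>_pos by (intro tendsto_divide num_sq_lim tendsto_power mean_den_lim) auto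
  from tendsto_add[OF ratio_deviation_lim this] show ?thesis by simp
qed

end

section \<open>The mean squared error of the recursive estimator\<close>

text \<open>By the Cauchy--Schwarz inequality the averages with exponents \<open>q\<close> and \<open>- q\<close> have product at least 1.\<close>

lemma B_seq_limit_pos:
  assumes F: "\<And>i. 1 \<le> i \<Longrightarrow> 0 < F (h i)"
    and lim: "B_seq F h q \<longlonglongrightarrow> b" "B_seq F h (- q) \<longlonglongrightarrow> b'"
  shows "0 < b"
proof -
  have "1 \<le> B_seq F h q n * B_seq F h (- q) n" if n: "1 \<le> n" for n
  proof -
    define u where "u = (\<lambda>i. F (h i) / F (h n))"
    have u: "0 < u i" if "i \<in> {1..n}" for i using F[of i] F[OF n] that by (simp add: u_def)
    have "(\<Sum>i=1..n. u i powr (q / 2) * u i powr (- q / 2)) = (\<Sum>i=1..n. 1)"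
      using u by (intro sum.cong refl) (simp flip: powr_add add: less_imp_neq[symmetric])
    then have "(real n)\<^sup>2 = (\<Sum>i=1..n. u i powr (q / 2) * u i powr (- q / 2))\<^sup>2" by simp
    also have "\<dots> \<le> (\<Sum>i=1..n. (u i powr (q / 2))\<^sup>2) * (\<Sum>i=1..n. (u i powr (- q / 2))\<^sup>2)"
      by (rule Cauchy_Schwarz_ineq_sum)
    also have "\<dots> = (\<Sum>i=1..n. u i powr q) * (\<Sum>i=1..n. u i powr (- q))"
      by (simp add: power2_eq_square flip: powr_add)
    finally show ?thesis
      using n by (simp add: B_seq_def u_def field_simps power2_eq_square)
  qed
  then have "1 \<le> b * b'"
    by (intro tendsto_lowerbound[OF tendsto_mult[OF lim]] eventually_mono[OF eventually_ge_at_top[of 1]]) auto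
  moreover have "0 \<le> b"
    by (rule tendsto_lowerbound[OF lim(1)]) (auto simp: B_seq_def intro!: always_eventually divide_nonneg_nonneg sum_nonneg)
  ultimately show ?thesis by (cases "b = 0") auto
qed

text \<open>Numerator and denominator of the estimator differ from the normalised ones by the common
  factor \<open>\<kappa>\<close>. If the denominator vanishes, both quotients are 0 by convention
  and the error is exactly \<open>y^2\<close>, which the second summand records.\<close>

lemma (in weighted_ratio_sequence) estimator_error:
  assumes n: "1 \<le> n"
    and Y: "\<And>i. 1 \<le> i \<Longrightarrow> k i \<omega> * G i \<omega> = k i \<omega> * (Y i - y)"
  shows "((\<Sum>i=1..n. Y i / f i powr l * k i \<omega>) / (\<Sum>i=1..n. 1 / f i powr l * k i \<omega>) - y)\<^sup>2
    = (num n \<omega> / den n \<omega>)\<^sup>2 + y\<^sup>2 * (if den n \<omega> = 0 then 1 else 0)"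
proof -
  define D where "D = (\<Sum>i=1..n. 1 / f i powr l * k i \<omega>)"
  define S where "S = (\<Sum>i=1..n. Y i / f i powr l * k i \<omega>)"
  define \<kappa> where "\<kappa> = f n powr l / N n"
  have \<kappa>: "0 < \<kappa>" using N_pos[OF n] f_pos[OF n] by (simp add: \<kappa>_def)
  have a: "a n i = \<kappa> * (1 / f i powr l)" if "i \<in> {1..n}" for i
    using f_pos[of i] f_pos[OF n] that by (simp add: a_def \<kappa>_def powr_minus powr_divide)
  have den: "den n \<omega> = \<kappa> * D"
    unfolding den_def D_def sum_distrib_left Z_def by (intro sum.cong refl) (simp add: a)
  have "num n \<omega> = (\<Sum>i=1..n. \<kappa> * (Y i / f i powr l * k i \<omega> - y * (1 / f i powr l * k i \<omega>)))"
    unfolding num_def Z_def mult.assoc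
  proof (intro sum.cong refl)
    fix i assume i: "i \<in> {1..n}"
    then have "a n i * (k i \<omega> * G i \<omega>) = \<kappa> * (1 / f i powr l) * (k i \<omega> * (Y i - y))" using a Y by simp
    also have "\<dots> = \<kappa> * (Y i / f i powr l * k i \<omega> - y * (1 / f i powr l * k i \<omega>))"
      by (simp add: algebra_simps diff_divide_distrib)
    finally show "a n i * (k i \<omega> * G i \<omega>) = \<kappa> * (Y i / f i powr l * k i \<omega> - y * (1 / f i powr l * k i \<omega>))" .
  qed
  also have "\<dots> = \<kappa> * (S - y * D)" by (simp add: S_def D_def sum_distrib_left sum_subtractf right_diff_distrib)
  finally have num: "num n \<omega> = \<kappa> * (S - y * D)" .
  show ?thesis
  proof (cases "D = 0")
    case False
    then have "S / D - y = num n \<omega> / den n \<omega>" using \<kappa> by (simp add: num den field_simps)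
    then show ?thesis unfolding S_def[symmetric] D_def[symmetric] using False \<kappa> by (simp add: den)
  next
    case True
    then show ?thesis unfolding S_def[symmetric] D_def[symmetric] by (simp add: den)
  qed
qed

lemma (in weighted_ratio_sequence) estimator_mean_square_lim:
  assumes Y: "\<And>i \<omega>. 1 \<le> i \<Longrightarrow> \<omega> \<in> space M \<Longrightarrow> k i \<omega> * G i \<omega> = k i \<omega> * (Y i \<omega> - y)"
  shows "(\<lambda>n. N n * expectation (\<lambda>\<omega>. ((\<Sum>i=1..n. Y i \<omega> / f i powr l * k i \<omega>) / (\<Sum>i=1..n. 1 / f i powr l * k i \<omega>) - y)\<^sup>2))
    \<longlonglongrightarrow> (c * (\<alpha> * m)\<^sup>2 + \<beta> (1 - 2 * l) * v) / (\<beta> (1 - l) * \<mu>)\<^sup>2"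
proof (rule Lim_transform_eventually)
  show "(\<lambda>n. N n * expectation (\<lambda>\<omega>. (num n \<omega> / den n \<omega>)\<^sup>2) + y\<^sup>2 * (N n * prob {\<omega> \<in> space M. den n \<omega> = 0}))
    \<longlonglongrightarrow> (c * (\<alpha> * m)\<^sup>2 + \<beta> (1 - 2 * l) * v) / (\<beta> (1 - l) * \<mu>)\<^sup>2"
    using tendsto_add[OF ratio_mean_square_lim tendsto_mult_left[OF zero_den_lim, of "y\<^sup>2"]] by simp
  show "eventually (\<lambda>n. N n * expectation (\<lambda>\<omega>. (num n \<omega> / den n \<omega>)\<^sup>2) + y\<^sup>2 * (N n * prob {\<omega> \<in> space M. den n \<omega> = 0})
    = N n * expectation (\<lambda>\<omega>. ((\<Sum>i=1..n. Y i \<omega> / f i powr l * k i \<omega>) / (\<Sum>i=1..n. 1 / f i powr l * k i \<omega>) - y)\<^sup>2)) sequentially"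
    using ratio_integrable eventually_ge_at_top[of 1]
  proof eventually_elim
    case (elim n)
    have [measurable]: "den n \<in> borel_measurable M"
      using bounded_weight_array.num_den_measurable(2)[OF array, of n] by (simp only: array_defs)
    let ?I = "\<lambda>\<omega>. if den n \<omega> = 0 then 1 else 0 :: real"
    have i: "integrable M ?I" by (intro integrable_const_bound[where B=1]) auto
    have "expectation ?I = expectation (indicator {\<omega> \<in> space M. den n \<omega> = 0})"
      by (intro Bochner_Integration.integral_cong) (auto simp: indicator_def)
    then have I: "expectation ?I = prob {\<omega> \<in> space M. den n \<omega> = 0}" by simp
    have "expectation (\<lambda>\<omega>. ((\<Sum>i=1..n. Y i \<omega> / f i powr l * k i \<omega>) / (\<Sum>i=1..n. 1 / f i powr l * k i \<omega>) - y)\<^sup>2)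
      = expectation (\<lambda>\<omega>. (num n \<omega> / den n \<omega>)\<^sup>2 + y\<^sup>2 * ?I \<omega>)"
      by (intro Bochner_Integration.integral_cong refl estimator_error elim(2) Y) auto
    also have "\<dots> = expectation (\<lambda>\<omega>. (num n \<omega> / den n \<omega>)\<^sup>2) + y\<^sup>2 * prob {\<omega> \<in> space M. den n \<omega> = 0}"
      using elim(1) i by (simp add: I)
    finally show ?case by (simp add: distrib_left)
  qed
qed

text \<open>Asymptotic equivalence counts the quotient of two zeros as 1; positivity of
  \<open>g\<close> excludes this case, so the plain quotient converges.\<close>

lemma asymp_equiv_tendsto_ratio:
  fixes F g :: "real \<Rightarrow> real"
  assumes "F \<sim>[at_right 0] g" and "\<And>t. 0 < t \<Longrightarrow> 0 < g t" and h: "filterlim h (at_right 0) sequentially"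
  shows "(\<lambda>n. F (h n) / g (h n)) \<longlonglongrightarrow> 1"
proof (rule filterlim_compose[OF _ h])
  have "eventually (\<lambda>t::real. 0 < t) (at_right 0)" by (simp add: eventually_at_filter)
  then have "eventually (\<lambda>t. (if F t = 0 \<and> g t = 0 then 1 else F t / g t) = F t / g t) (at_right 0)"
    by eventually_elim (auto dest: assms(2))
  then show "((\<lambda>t. F t / g t) \<longlongrightarrow> 1) (at_right 0)"
    using assms(1) unfolding asymp_equiv_def by (rule Lim_transform_eventually[rotated])
qed

theorem corollary1:
  fixes M :: "'w measure"
    and p :: "'e::banach \<Rightarrow> real"
    and X :: "'w \<Rightarrow> 'e" and Y :: "'w \<Rightarrow> real"
    and Xs :: "nat \<Rightarrow> 'w \<Rightarrow> 'e" and Ys \<epsilon> :: "nat \<Rightarrow> 'w \<Rightarrow> real"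
    and r \<sigma>\<^sub>\<epsilon> :: "'e \<Rightarrow> real"
    and chi :: 'e and l :: real
    and h :: "nat \<Rightarrow> real"
    and K \<tau>\<^sub>0 \<phi> F :: "real \<Rightarrow> real"
    and d\<phi> \<alpha> :: real and \<beta> :: "real \<Rightarrow> real"
  defines "F \<equiv> small_ball M p X chi"
  assumes "prob_space M"
    and "is_seminorm p" and "p \<in> borel_measurable borel"
    \<comment> \<open>the random pair and its i.i.d. copies\<close>
    and "(\<lambda>\<omega>. (X \<omega>, Y \<omega>)) \<in> measurable M (borel \<Otimes>\<^sub>M borel)"
    and "prob_space.indep_vars M (\<lambda>_. borel \<Otimes>\<^sub>M borel) (\<lambda>i \<omega>. (Xs i \<omega>, Ys i \<omega>)) {1..}"
    and "\<And>i. i \<ge> 1 \<Longrightarrow> distr M (borel \<Otimes>\<^sub>M borel) (\<lambda>\<omega>. (Xs i \<omega>, Ys i \<omega>))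
                       = distr M (borel \<Otimes>\<^sub>M borel) (\<lambda>\<omega>. (X \<omega>, Y \<omega>))"
    \<comment> \<open>the regression model\<close>
    and "regression_fun M borel X Y r"
    and "\<And>i \<omega>. i \<ge> 1 \<Longrightarrow> \<omega> \<in> space M \<Longrightarrow> Ys i \<omega> = r (Xs i \<omega>) + \<epsilon> i \<omega>"
    and "\<And>i. i \<ge> 1 \<Longrightarrow> regression_fun M borel (Xs i) (\<epsilon> i) (\<lambda>_. 0)"
    and "(\<lambda>x. (\<sigma>\<^sub>\<epsilon> x)\<^sup>2) \<in> borel_measurable borel"
    and "\<And>i. i \<ge> 1 \<Longrightarrow> AE \<omega> in M.
           nn_cond_exp M (sigma_of M borel (Xs i)) (\<lambda>\<omega>. ennreal ((\<epsilon> i \<omega>)\<^sup>2)) \<omega>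
             = ennreal ((\<sigma>\<^sub>\<epsilon> (Xs i \<omega>))\<^sup>2)"
    \<comment> \<open>finite second moment of the response on the balls seen by the estimator; if this fails
        for some i, the mean squared error is infinite for all n >= i\<close>
    and "\<And>i. i \<ge> 1 \<Longrightarrow> set_integrable M {\<omega> \<in> space M. p (chi - X \<omega>) \<le> h i} (\<lambda>\<omega>. (Y \<omega>)\<^sup>2)"
    and "0 \<le> l" "l \<le> 1"
    and "\<And>n. n \<ge> 1 \<Longrightarrow> h n > 0"
    \<comment> \<open>(1)\<close>
    and "seminorm_continuous_near p chi r"
    and "seminorm_continuous_near p chi (\<lambda>x. (\<sigma>\<^sub>\<epsilon> x)\<^sup>2)"
    and "F 0 = 0"
    and "regression_fun M borel (\<lambda>\<omega>. p (X \<omega> - chi)) (\<lambda>\<omega>. r (X \<omega>) - r chi) \<phi>"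
    and "(\<phi> has_real_derivative d\<phi>) (at 0 within {0..})"
    \<comment> \<open>(2)\<close>
    and "\<And>t. K t \<ge> 0" and "bounded (range K)" and "closure {t. K t \<noteq> 0} = {0..1}"
    and "(INF t\<in>{0..1}. K t) > 0"
    and "K differentiable_on {0..1}" and "set_integrable lborel {0..1} (deriv01 K)"
    \<comment> \<open>(3)\<close>
    and "\<And>s. s \<in> {0..1} \<Longrightarrow> ((\<lambda>t. F (t * s) / F t) \<longlongrightarrow> \<tau>\<^sub>0 s) (at_right 0)"
    \<comment> \<open>(4)\<close>
    and "h \<longlonglongrightarrow> 0"
    and "filterlim (\<lambda>n. real n * F (h n)) at_top sequentially"
    and "A_seq F h l \<longlonglongrightarrow> \<alpha>"
    and "\<And>q. q \<le> 2 \<Longrightarrow> B_seq F h q \<longlonglongrightarrow> \<beta> q"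
  shows "(\<forall>c>0. (\<lambda>n. real n * F (h n) * (h n)\<^sup>2) \<longlonglongrightarrow> c \<longrightarrow>
            (\<lambda>n. real n * F (h n) *
                 prob_space.expectation M (\<lambda>\<omega>. (rec_estimator K p F h l Xs Ys chi n \<omega> - r chi)\<^sup>2))
              \<longlonglongrightarrow>
                \<beta> (1 - 2 * l) / (\<beta> (1 - l))\<^sup>2 * (M2 K \<tau>\<^sub>0 * (\<sigma>\<^sub>\<epsilon> chi)\<^sup>2 / (M1 K \<tau>\<^sub>0)\<^sup>2)
                + c * \<alpha>\<^sup>2 / (\<beta> (1 - l))\<^sup>2 * (d\<phi>\<^sup>2 * (M0 K \<tau>\<^sub>0)\<^sup>2 / (M1 K \<tau>\<^sub>0)\<^sup>2))
       \<and> (\<forall>c' \<kappa> A. c' > 0 \<and> \<kappa> > 0 \<and> A > 0 \<and> F \<sim>[at_right 0] (\<lambda>t. c' * t powr \<kappa>)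
              \<and> (\<forall>n\<ge>1. h n = A * real n powr (- 1 / (\<kappa> + 2))) \<longrightarrow>
            (\<lambda>n. real n powr (2 / (2 + \<kappa>)) *
                 prob_space.expectation M (\<lambda>\<omega>. (rec_estimator K p F h l Xs Ys chi n \<omega> - r chi)\<^sup>2))
              \<longlonglongrightarrow>
                \<beta> (1 - 2 * l) / (\<beta> (1 - l))\<^sup>2
                  * (M2 K \<tau>\<^sub>0 * (\<sigma>\<^sub>\<epsilon> chi)\<^sup>2 / (c' * A powr \<kappa> * (M1 K \<tau>\<^sub>0)\<^sup>2))
                + \<alpha>\<^sup>2 / (\<beta> (1 - l))\<^sup>2 * (d\<phi>\<^sup>2 * (M0 K \<tau>\<^sub>0)\<^sup>2 * A\<^sup>2 / (M1 K \<tau>\<^sub>0)\<^sup>2))"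
proof -
  note Fdef = assms(1) and prob = assms(2) and semi = assms(3) and pm = assms(4) and XY = assms(5)
    and ind = assms(6) and dist = assms(7) and regY = assms(8) and model = assms(9) and reg\<epsilon> = assms(10)
    and \<sigma>m = assms(11) and cv = assms(12) and sqY = assms(13) and l = assms(14,15) and h_pos = assms(16)
    and contr = assms(17) and cont\<sigma> = assms(18) and reg\<phi> = assms(20) and d\<phi> = assms(21)
    and kernel = assms(22-27) and \<tau> = assms(28) and h_lim = assms(29) and nF = assms(30)
    and A_lim = assms(31) and B_lim = assms(32)
  interpret prob_space M by (rule prob)
  interpret unit_kernel K using kernel by unfold_locales

  \<comment> \<open>Transfer between the generic pair and its copies\<close>
  note [measurable] = pm
  have Xm [measurable]: "X \<in> borel_measurable M" and Ym [measurable]: "Y \<in> borel_measurable M"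
    using measurable_compose[OF XY measurable_fst] measurable_compose[OF XY measurable_snd] by simp_all
  have pair [measurable]: "(\<lambda>\<omega>. (Xs i \<omega>, Ys i \<omega>)) \<in> measurable M (borel \<Otimes>\<^sub>M borel)" if "1 \<le> i" for i
    using ind that by (auto simp: indep_vars_def)
  have Xsm: "Xs i \<in> borel_measurable M" and Ysm: "Ys i \<in> borel_measurable M" if "1 \<le> i" for i
    using measurable_compose[OF pair[OF that] measurable_fst] measurable_compose[OF pair[OF that] measurable_snd] by simp_all
  have dist_m [measurable]: "(\<lambda>x. p (chi - x)) \<in> borel_measurable borel"
    by (rule measurable_compose[OF borel_measurable_continuous_onI pm]) (intro continuous_intros)
  have rm [measurable]: "r \<in> borel_measurable borel" using regY by (simp add: regression_fun_def)
  have tr: "expectation (\<lambda>\<omega>. g (Xs i \<omega>) (Ys i \<omega>)) = expectation (\<lambda>\<omega>. g (X \<omega>) (Y \<omega>))"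
    and tri: "integrable M (\<lambda>\<omega>. g (Xs i \<omega>) (Ys i \<omega>)) \<longleftrightarrow> integrable M (\<lambda>\<omega>. g (X \<omega>) (Y \<omega>))"
    if i: "1 \<le> i" and g: "case_prod g \<in> borel_measurable (borel \<Otimes>\<^sub>M borel)" for i and g :: "'e \<Rightarrow> real \<Rightarrow> real"
    using integral_distr[OF pair[OF i] g] integral_distr[OF XY g]
      integrable_distr_eq[OF pair[OF i] g] integrable_distr_eq[OF XY g] dist[OF i] by simp_all
  have F_Xs: "small_ball M p (Xs i) chi = F" if i: "1 \<le> i" for i
  proof
    fix t
    have [measurable]: "Xs i \<in> borel_measurable M" by (rule Xsm[OF i])
    have eq: "expectation (\<lambda>\<omega>. indicator {..t} (p (chi - V \<omega>))) = small_ball M p V chi t"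
      if [measurable]: "V \<in> borel_measurable M" for V
    proof -
      have "expectation (\<lambda>\<omega>. indicator {..t} (p (chi - V \<omega>)) :: real)
        = expectation (indicator {\<omega> \<in> space M. p (chi - V \<omega>) \<le> t})"
        by (intro Bochner_Integration.integral_cong) (auto simp: indicator_def)
      then show ?thesis by (simp add: small_ball_def)
    qed
    have "expectation (\<lambda>\<omega>. indicator {..t} (p (chi - Xs i \<omega>)) :: real) = expectation (\<lambda>\<omega>. indicator {..t} (p (chi - X \<omega>)))"
      by (rule tr[OF i, of "\<lambda>x _. indicator {..t} (p (chi - x))"]) measurable
    then show "small_ball M p (Xs i) chi t = F t" by (simp add: eq Fdef Xsm[OF i])
  qed
  have F_mono: "F s \<le> F t" if "s \<le> t" for s t
    unfolding Fdef small_ball_def using that by (intro finite_measure_mono) auto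
  \<comment> \<open>As \<open>n * F (h n)\<close> diverges, \<open>F (h n)\<close> is positive for
    all large \<open>n\<close>; such radii become smaller than any \<open>t\<close>, and
    \<open>F\<close> is monotone.\<close>
  have F_pos: "0 < F t" if t: "0 < t" for t
  proof -
    have "eventually (\<lambda>n. 0 < real n * F (h n)) sequentially" using nF by (simp add: filterlim_at_top_dense)
    moreover have "eventually (\<lambda>n. h n < t) sequentially" by (rule order_tendstoD(2)[OF h_lim t])
    ultimately have "eventually (\<lambda>n. 0 < real n * F (h n) \<and> h n < t) sequentially" by (rule eventually_conj)
    then obtain n where n: "0 < real n * F (h n)" "h n < t" unfolding eventually_sequentially by auto
    then have "0 < F (h n)" by (simp add: zero_less_mult_iff)
    then show ?thesis using F_mono[of "h n" t] n(2) by linarith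
  qed
  interpret B: small_ball_kernel M K p X chi \<tau>\<^sub>0
    by unfold_locales (rule semi pm Xm F_pos[unfolded Fdef] \<tau>[unfolded Fdef]; assumption)+
  have one: "(1::nat) \<le> 1" by simp
  \<comment> \<open>The noise exists only for the copies, so the variance limit is computed at the
    first copy and carried to the generic pair by equality of laws.\<close>
  interpret B1: small_ball_kernel M K p "Xs 1" chi \<tau>\<^sub>0
    unfolding small_ball_kernel_def small_ball_kernel_axioms_def F_Xs[OF one]
    using semi pm Xsm[OF one] F_pos \<tau> prob_space_axioms unit_kernel_axioms by blast
  \<comment> \<open>The bandwidths are positive from index 1 on, while the kernel limits ask for
    positivity at every index; the shift is undone by \<open>LIMSEQ_imp_Suc\<close>.\<close>
  define h' where "h' n = h (Suc n)" for n
  have h'_pos: "0 < h' n" for n using h_pos by (simp add: h'_def)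
  have h'_lim: "h' \<longlonglongrightarrow> 0" unfolding h'_def by (rule LIMSEQ_Suc[OF h_lim])
  define k where "k i \<omega> = K (p (chi - Xs i \<omega>) / h i)" for i \<omega>
  \<comment> \<open>Cutting to the ball leaves \<open>k i * G i\<close> unchanged, because the
    kernel is 0 outside. It makes \<open>G i\<close> square integrable and its second moment of
    order \<open>F (h i)\<close>.\<close>
  define G where "G i \<omega> = indicator {..h i} (p (chi - Xs i \<omega>)) * (Ys i \<omega> - r chi)" for i \<omega>
  have kG: "k i \<omega> * G i \<omega> = k i \<omega> * (Ys i \<omega> - r chi)" if "1 \<le> i" for i \<omega>
    using K_outside[of "p (chi - Xs i \<omega>) / h i"] h_pos[OF that] by (auto simp: k_def G_def indicator_def)
  have Ek: "expectation (k i) = expectation (\<lambda>\<omega>. K (B.R \<omega> / h i))"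
    and Ek2: "expectation (\<lambda>\<omega>. (k i \<omega>)\<^sup>2) = expectation (\<lambda>\<omega>. (K (B.R \<omega> / h i))\<^sup>2)"
    and EkG: "expectation (\<lambda>\<omega>. k i \<omega> * G i \<omega>) = expectation (\<lambda>\<omega>. K (B.R \<omega> / h i) * (Y \<omega> - r chi))"
    and EkG2: "expectation (\<lambda>\<omega>. (k i \<omega> * G i \<omega>)\<^sup>2) = expectation (\<lambda>\<omega>. (K (B.R \<omega> / h i) * (Y \<omega> - r chi))\<^sup>2)"
    if i: "1 \<le> i" for i
    unfolding kG[OF i] unfolding k_def[abs_def] B.R_def
    using tr[OF i, of "\<lambda>x y. K (p (chi - x) / h i)"] tr[OF i, of "\<lambda>x y. (K (p (chi - x) / h i))\<^sup>2"]
      tr[OF i, of "\<lambda>x y. K (p (chi - x) / h i) * (y - r chi)"] tr[OF i, of "\<lambda>x y. (K (p (chi - x) / h i) * (y - r chi))\<^sup>2"]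
    by simp_all
  have EkG2': "expectation (\<lambda>\<omega>. (K (B1.R \<omega> / t) * (Ys 1 \<omega> - r chi))\<^sup>2) = expectation (\<lambda>\<omega>. (K (B.R \<omega> / t) * (Y \<omega> - r chi))\<^sup>2)" for t
    unfolding B.R_def B1.R_def by (rule tr[OF one, of "\<lambda>x y. (K (p (chi - x) / t) * (y - r chi))\<^sup>2"]) measurable
  have lim_k: "(\<lambda>i. expectation (k i) / F (h i)) \<longlonglongrightarrow> M1 K \<tau>\<^sub>0"
    by (rule LIMSEQ_imp_Suc, insert B.kernel_limits(1)[OF h'_pos h'_lim, folded Fdef]) (simp add: Ek h'_def)
  have lim_k2: "(\<lambda>i. expectation (\<lambda>\<omega>. (k i \<omega>)\<^sup>2) / F (h i)) \<longlonglongrightarrow> M2 K \<tau>\<^sub>0"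
    by (rule LIMSEQ_imp_Suc, insert B.kernel_limits(2)[OF h'_pos h'_lim, folded Fdef]) (simp add: Ek2 h'_def)
  have lim_kG: "(\<lambda>i. expectation (\<lambda>\<omega>. k i \<omega> * G i \<omega>) / (h i * F (h i))) \<longlonglongrightarrow> d\<phi> * M0 K \<tau>\<^sub>0"
    by (rule LIMSEQ_imp_Suc, insert B.bias_limit[OF contr regY reg\<phi> d\<phi> h'_pos h'_lim, folded Fdef]) (simp add: EkG h'_def)
  have lim_kG2: "(\<lambda>i. expectation (\<lambda>\<omega>. (k i \<omega> * G i \<omega>)\<^sup>2) / F (h i)) \<longlonglongrightarrow> (\<sigma>\<^sub>\<epsilon> chi)\<^sup>2 * M2 K \<tau>\<^sub>0"
    by (rule LIMSEQ_imp_Suc, insert B1.variance_limit[OF model[OF one] reg\<epsilon>[OF one] rm \<sigma>m _ cv[OF one] contr cont\<sigma> h'_pos h'_lim, unfolded F_Xs[OF one] EkG2']) (simp add: EkG2 h'_def)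
  obtain b where b: "\<And>i. \<bar>expectation (\<lambda>\<omega>. (k i \<omega> * G i \<omega>)\<^sup>2) / F (h i)\<bar> \<le> b"
    using convergent_imp_Bseq[OF convergentI[OF lim_kG2]] unfolding Bseq_def by auto
  \<comment> \<open>One constant for both bounds: \<open>kmax\<close> controls the mean of the
    kernel, and \<open>b / kmin\<^sup>2\<close> the second moment of the cut response.\<close>
  define C where "C = max kmax (b / kmin\<^sup>2)"
  have C_ge: "kmax \<le> C" "b / kmin\<^sup>2 \<le> C" by (simp_all add: C_def)
  have km: "k i \<in> borel_measurable M" and Gm: "G i \<in> borel_measurable M" if "1 \<le> i" for i
    using Xsm[OF that] Ysm[OF that] unfolding k_def[abs_def] G_def[abs_def] by measurable
  have kb: "0 \<le> k i \<omega> \<and> k i \<omega> \<le> kmax" for i \<omega> using K_nonneg le_kmax by (simp add: k_def)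
  have G2: "integrable M (\<lambda>\<omega>. (G i \<omega>)\<^sup>2)" if i: "1 \<le> i" for i
  proof -
    let ?g = "\<lambda>x y. (indicator {..h i} (p (chi - x)) * (y - r chi))\<^sup>2"
    have Y2: "integrable M (\<lambda>\<omega>. indicator {..h i} (B.R \<omega>) * (Y \<omega>)\<^sup>2)"
    proof -
      have "integrable M (\<lambda>\<omega>. indicator {\<omega> \<in> space M. p (chi - X \<omega>) \<le> h i} \<omega> *\<^sub>R (Y \<omega>)\<^sup>2)"
        using sqY[OF i] unfolding set_integrable_def .
      also have "?this \<longleftrightarrow> ?thesis"
        by (intro Bochner_Integration.integrable_cong) (auto simp: B.R_def indicator_def)
      finally show ?thesis .
    qed
    have "integrable M (\<lambda>\<omega>. ?g (X \<omega>) (Y \<omega>))"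
    proof (rule Bochner_Integration.integrable_bound)
      show "integrable M (\<lambda>\<omega>. 2 * (indicator {..h i} (B.R \<omega>) * (Y \<omega>)\<^sup>2) + 2 * (r chi)\<^sup>2)"
        using Y2 by simp
      have "(y - r chi)\<^sup>2 \<le> 2 * y\<^sup>2 + 2 * (r chi)\<^sup>2" for y :: real
        using zero_le_power2[of "y + r chi"] by (simp add: power2_eq_square algebra_simps)
      then show "AE \<omega> in M. norm (?g (X \<omega>) (Y \<omega>)) \<le> norm (2 * (indicator {..h i} (B.R \<omega>) * (Y \<omega>)\<^sup>2) + 2 * (r chi)\<^sup>2)"
        by (intro AE_I2) (auto simp: indicator_def B.R_def)
    qed measurable
    then show ?thesis unfolding G_def using tri[OF i, of ?g] by simp
  qed
  have mean_k: "expectation (k i) \<le> C * F (h i)" if i: "1 \<le> i" for i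
  proof -
    have "\<bar>expectation (\<lambda>\<omega>. K (B.R \<omega> / h i))\<bar> \<le> kmax * F (h i)"
      unfolding Fdef
    proof (rule B.expectation_ball_bound(2))
      show "\<bar>K (B.R \<omega> / h i)\<bar> \<le> kmax * indicator {..h i} (B.R \<omega>)" for \<omega>
        using B.K_ball[OF h_pos[OF i], of \<omega>] K_nonneg le_kmax by (auto simp: indicator_def split: if_splits)
    qed measurable
    then show ?thesis using Ek[OF i] mult_right_mono[OF C_ge(1), of "F (h i)"] F_pos[OF h_pos[OF i]] by linarith
  qed
  \<comment> \<open>On the ball the kernel is at least \<open>kmin\<close>, so
    \<open>kmin\<^sup>2 * (G i)\<^sup>2\<close> is at most the weighted square, whose expectation is
    at most \<open>b * F (h i)\<close> because the normalised sequence converges.\<close>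
  have mean_G: "expectation (\<lambda>\<omega>. (G i \<omega>)\<^sup>2) \<le> C * F (h i)" if i: "1 \<le> i" for i
  proof -
    note [measurable] = km[OF i] Gm[OF i]
    have ikG: "integrable M (\<lambda>\<omega>. (k i \<omega> * G i \<omega>)\<^sup>2)"
    proof -
      have "integrable M (\<lambda>\<omega>. (G i \<omega>)\<^sup>2 * (k i \<omega>)\<^sup>2)"
        using kb by (intro integrable_sq_mult_bounded[OF _ _ G2[OF i], where c="kmax\<^sup>2"]) (auto intro!: power_mono)
      then show ?thesis by (simp add: power_mult_distrib mult.commute)
    qed
    have "kmin\<^sup>2 * expectation (\<lambda>\<omega>. (G i \<omega>)\<^sup>2) = expectation (\<lambda>\<omega>. kmin\<^sup>2 * (G i \<omega>)\<^sup>2)" by simp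
    also have "\<dots> \<le> expectation (\<lambda>\<omega>. (k i \<omega> * G i \<omega>)\<^sup>2)"
    proof (intro integral_mono ikG integrable_mult_right G2 i)
      fix \<omega>
      show "kmin\<^sup>2 * (G i \<omega>)\<^sup>2 \<le> (k i \<omega> * G i \<omega>)\<^sup>2"
      proof (cases "p (chi - Xs i \<omega>) \<le> h i")
        case True
        then have "kmin \<le> k i \<omega>"
          unfolding k_def using h_pos[OF i] seminorm_basic(3)[OF semi] by (intro kmin_le) simp
        then show ?thesis unfolding power_mult_distrib using kmin_pos by (intro mult_right_mono power_mono) auto
      qed (simp add: G_def)
    qed
    also have "\<dots> \<le> b * F (h i)" using b[of i] F_pos[OF h_pos[OF i]] by (simp add: abs_le_iff field_simps)
    finally have "expectation (\<lambda>\<omega>. (G i \<omega>)\<^sup>2) \<le> b / kmin\<^sup>2 * F (h i)" using kmin_pos by (simp add: field_simps)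
    also have "\<dots> \<le> C * F (h i)" using C_ge(2) F_pos[OF h_pos[OF i]] by (intro mult_right_mono) auto
    finally show ?thesis .
  qed
  \<comment> \<open>The normalised kernel means are at least \<open>kmin\<close>, and the bound
    passes to the limit.\<close>
  have M1_pos: "0 < M1 K \<tau>\<^sub>0"
  proof -
    have "kmin \<le> M1 K \<tau>\<^sub>0"
    proof (rule tendsto_lowerbound[OF lim_k])
      show "eventually (\<lambda>i. kmin \<le> expectation (k i) / F (h i)) sequentially"
        using eventually_ge_at_top[of 1]
      proof eventually_elim
        case (elim i)
        have "kmin * F (h i) = expectation (\<lambda>\<omega>. kmin * indicator {..h i} (B.R \<omega>))"
          by (simp add: B.expectation_ball Fdef)
        also have "\<dots> \<le> expectation (\<lambda>\<omega>. K (B.R \<omega> / h i))"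
        proof (intro integral_mono integrable_mult_right B.ball_integrable)
          show "integrable M (\<lambda>\<omega>. K (B.R \<omega> / h i))"
            using K_nonneg le_kmax by (intro integrable_const_bound[where B=kmax]) auto
          show "kmin * indicator {..h i} (B.R \<omega>) \<le> K (B.R \<omega> / h i)" for \<omega>
            using kmin_le[of "B.R \<omega> / h i"] B.R_nonneg[of \<omega>] h_pos[OF elim] K_nonneg by (auto simp: indicator_def)
        qed
        finally show ?case using F_pos[OF h_pos[OF elim]] by (simp add: Ek[OF elim] field_simps)
      qed
    qed simp
    then show ?thesis using kmin_pos by simp
  qed
  \<comment> \<open>Both \<open>1 - l\<close> and its negative are admissible exponents, so the
    product of the two limits is at least 1.\<close>
  have \<beta>_pos: "0 < \<beta> (1 - l)"
    by (rule B_seq_limit_pos[where F=F and h=h and q="1 - l", OF F_pos[OF h_pos] B_lim B_lim]) (use l in auto)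
  have ind_kG: "indep_vars (\<lambda>_. borel) (\<lambda>i \<omega>. (k i \<omega>, G i \<omega>)) {1..}"
  proof -
    have "(\<lambda>z. (K (p (chi - fst z) / h i), indicator {..h i} (p (chi - fst z)) * (snd z - r chi))) \<in> borel_measurable (borel \<Otimes>\<^sub>M borel)" for i
      by measurable
    from indep_vars_compose2[OF ind, of "\<lambda>i z. (K (p (chi - fst z) / h i), indicator {..h i} (p (chi - fst z)) * (snd z - r chi))" "\<lambda>_. borel"] this
    show ?thesis by (simp add: k_def G_def)
  qed

  \<comment> \<open>The limit for a general bandwidth sequence\<close>
  have main: "(\<lambda>n. real n * F (h n) * expectation (\<lambda>\<omega>. (rec_estimator K p F h l Xs Ys chi n \<omega> - r chi)\<^sup>2))
    \<longlonglongrightarrow> \<beta> (1 - 2 * l) / (\<beta> (1 - l))\<^sup>2 * (M2 K \<tau>\<^sub>0 * (\<sigma>\<^sub>\<epsilon> chi)\<^sup>2 / (M1 K \<tau>\<^sub>0)\<^sup>2)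
      + c * \<alpha>\<^sup>2 / (\<beta> (1 - l))\<^sup>2 * (d\<phi>\<^sup>2 * (M0 K \<tau>\<^sub>0)\<^sup>2 / (M1 K \<tau>\<^sub>0)\<^sup>2)"
    if c: "0 < c" "(\<lambda>n. real n * F (h n) * (h n)\<^sup>2) \<longlonglongrightarrow> c" for c
  proof -
    interpret W: weighted_ratio_sequence M k G "\<lambda>i. F (h i)" h l c kmax C "M1 K \<tau>\<^sub>0" "M2 K \<tau>\<^sub>0" "d\<phi> * M0 K \<tau>\<^sub>0"
      "(\<sigma>\<^sub>\<epsilon> chi)\<^sup>2 * M2 K \<tau>\<^sub>0" \<alpha> \<beta>
    proof (unfold_locales, goal_cases)
      case (5 i) show ?case by (simp add: Fdef small_ball_def)
    next
      case 8 show ?case using C_ge(1) kmax_pos by simp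
    next
      case 20 show ?case using A_lim by (simp add: A_seq_def[abs_def])
    next
      case (21 q) show ?case using B_lim[of q] 21 by (simp add: B_seq_def[abs_def])
    qed (use ind_kG kb G2 F_pos h_pos h_lim mean_k mean_G lim_k lim_k2 lim_kG lim_kG2 nF c l M1_pos \<beta>_pos in auto)
    have "(\<lambda>n. real n * F (h n) * expectation (\<lambda>\<omega>. (rec_estimator K p F h l Xs Ys chi n \<omega> - r chi)\<^sup>2))
      \<longlonglongrightarrow> (c * (\<alpha> * (d\<phi> * M0 K \<tau>\<^sub>0))\<^sup>2 + \<beta> (1 - 2 * l) * ((\<sigma>\<^sub>\<epsilon> chi)\<^sup>2 * M2 K \<tau>\<^sub>0)) / (\<beta> (1 - l) * M1 K \<tau>\<^sub>0)\<^sup>2"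
      using W.estimator_mean_square_lim[OF kG] unfolding W.N_def rec_estimator_def k_def by simp
    then show ?thesis by (simp add: add_divide_distrib power_mult_distrib mult_ac add.commute)
  qed

  \<comment> \<open>Bandwidths for geometric processes\<close>
  show ?thesis
  proof (intro conjI allI impI)
    fix c' \<kappa> A
    assume as: "c' > 0 \<and> \<kappa> > 0 \<and> A > 0 \<and> F \<sim>[at_right 0] (\<lambda>t. c' * t powr \<kappa>)
      \<and> (\<forall>n\<ge>1. h n = A * real n powr (- 1 / (\<kappa> + 2)))"
    \<comment> \<open>The limit of \<open>q n\<close>, the ratio of the normalisation
      \<open>n * F (h n)\<close> to the power of \<open>n\<close> in the claim. Dividing the general
      limit by \<open>D\<close> therefore changes one normalisation into the other.\<close>
    define D where "D = c' * A powr \<kappa>"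
    have D: "0 < D" using as by (simp add: D_def)
    define q where "q n = real n * F (h n) / real n powr (2 / (2 + \<kappa>))" for n
    have h0: "filterlim h (at_right 0) sequentially"
      unfolding filterlim_at using h_lim h_pos
      by (auto intro!: eventually_mono[OF eventually_ge_at_top[of 1]] simp: less_imp_neq[symmetric])
    have ratio: "(\<lambda>n. F (h n) / (c' * h n powr \<kappa>)) \<longlonglongrightarrow> 1"
      using as by (intro asymp_equiv_tendsto_ratio[OF _ _ h0]) auto
    have q_lim: "q \<longlonglongrightarrow> D"
    proof (rule Lim_transform_eventually)
      show "(\<lambda>n. F (h n) / (c' * h n powr \<kappa>) * D) \<longlonglongrightarrow> D"
        using tendsto_mult_right[OF ratio, of D] by simp
      show "eventually (\<lambda>n. F (h n) / (c' * h n powr \<kappa>) * D = q n) sequentially"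
        using eventually_ge_at_top[of 1]
      proof eventually_elim
        case (elim n)
        have "h n powr \<kappa> = A powr \<kappa> * real n powr (- \<kappa> / (\<kappa> + 2))"
          using as elim by (simp add: powr_mult powr_powr)
        moreover have "real n powr (- \<kappa> / (\<kappa> + 2)) * real n = real n powr (2 / (2 + \<kappa>))"
        proof -
          have "- \<kappa> / (\<kappa> + 2) + 1 = 2 / (2 + \<kappa>)" using as by (simp add: field_simps)
          then show ?thesis using powr_add[of "real n" "- \<kappa> / (\<kappa> + 2)" 1] elim by simp
        qed
        ultimately have e: "real n powr (2 / (2 + \<kappa>)) * A powr \<kappa> = h n powr \<kappa> * real n" by (simp add: mult_ac)
        have "0 < h n powr \<kappa>" "0 < A powr \<kappa>" using h_pos[OF elim] as by simp_all
        then have "F (h n) / (c' * h n powr \<kappa>) * D = F (h n) * real n * (A powr \<kappa> / (h n powr \<kappa> * real n))"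
          using as elim by (simp add: D_def)
        also have "\<dots> = q n" unfolding e[symmetric] q_def using \<open>0 < A powr \<kappa>\<close> by simp
        finally show ?case .
      qed
    qed
    \<comment> \<open>The square of \<open>h n\<close> is \<open>A\<^sup>2\<close> divided by the
      same power of \<open>n\<close>, so the general limit applies with
      \<open>c = D * A\<^sup>2\<close>. After division by \<open>D\<close> the bias term keeps
      \<open>A\<^sup>2\<close> and the variance term acquires \<open>D\<close> in its
      denominator.\<close>
    have "(\<lambda>n. real n * F (h n) * (h n)\<^sup>2) \<longlonglongrightarrow> D * A\<^sup>2"
    proof (rule Lim_transform_eventually[OF tendsto_mult_right[OF q_lim, of "A\<^sup>2"]])
      show "eventually (\<lambda>n. q n * A\<^sup>2 = real n * F (h n) * (h n)\<^sup>2) sequentially"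
        using eventually_ge_at_top[of 1]
      proof eventually_elim
        case (elim n)
        have "(h n)\<^sup>2 = A\<^sup>2 * (real n powr (- 1 / (\<kappa> + 2)) * real n powr (- 1 / (\<kappa> + 2)))"
          using as elim by (simp add: power2_eq_square)
        also have "real n powr (- 1 / (\<kappa> + 2)) * real n powr (- 1 / (\<kappa> + 2)) = real n powr (- (2 / (2 + \<kappa>)))"
          by (simp add: powr_add[symmetric] add.commute flip: add_divide_distrib)
        finally show ?case by (simp add: q_def powr_minus field_simps)
      qed
    qed
    with D as have lim: "(\<lambda>n. real n * F (h n) * expectation (\<lambda>\<omega>. (rec_estimator K p F h l Xs Ys chi n \<omega> - r chi)\<^sup>2) / q n)
      \<longlonglongrightarrow> (\<beta> (1 - 2 * l) / (\<beta> (1 - l))\<^sup>2 * (M2 K \<tau>\<^sub>0 * (\<sigma>\<^sub>\<epsilon> chi)\<^sup>2 / (M1 K \<tau>\<^sub>0)\<^sup>2)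
        + D * A\<^sup>2 * \<alpha>\<^sup>2 / (\<beta> (1 - l))\<^sup>2 * (d\<phi>\<^sup>2 * (M0 K \<tau>\<^sub>0)\<^sup>2 / (M1 K \<tau>\<^sub>0)\<^sup>2)) / D"
      by (intro tendsto_divide main q_lim) auto
    have "(\<lambda>n. real n powr (2 / (2 + \<kappa>)) * expectation (\<lambda>\<omega>. (rec_estimator K p F h l Xs Ys chi n \<omega> - r chi)\<^sup>2))
      \<longlonglongrightarrow> (\<beta> (1 - 2 * l) / (\<beta> (1 - l))\<^sup>2 * (M2 K \<tau>\<^sub>0 * (\<sigma>\<^sub>\<epsilon> chi)\<^sup>2 / (M1 K \<tau>\<^sub>0)\<^sup>2)
        + D * A\<^sup>2 * \<alpha>\<^sup>2 / (\<beta> (1 - l))\<^sup>2 * (d\<phi>\<^sup>2 * (M0 K \<tau>\<^sub>0)\<^sup>2 / (M1 K \<tau>\<^sub>0)\<^sup>2)) / D"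
    proof (rule Lim_transform_eventually[OF lim])
      show "eventually (\<lambda>n. real n * F (h n) * expectation (\<lambda>\<omega>. (rec_estimator K p F h l Xs Ys chi n \<omega> - r chi)\<^sup>2) / q n
        = real n powr (2 / (2 + \<kappa>)) * expectation (\<lambda>\<omega>. (rec_estimator K p F h l Xs Ys chi n \<omega> - r chi)\<^sup>2)) sequentially"
        using eventually_ge_at_top[of 1]
        by eventually_elim (simp add: q_def less_imp_neq[OF F_pos[OF h_pos], symmetric])
    qed
    also have "(\<beta> (1 - 2 * l) / (\<beta> (1 - l))\<^sup>2 * (M2 K \<tau>\<^sub>0 * (\<sigma>\<^sub>\<epsilon> chi)\<^sup>2 / (M1 K \<tau>\<^sub>0)\<^sup>2)
        + D * A\<^sup>2 * \<alpha>\<^sup>2 / (\<beta> (1 - l))\<^sup>2 * (d\<phi>\<^sup>2 * (M0 K \<tau>\<^sub>0)\<^sup>2 / (M1 K \<tau>\<^sub>0)\<^sup>2)) / D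
      = \<beta> (1 - 2 * l) / (\<beta> (1 - l))\<^sup>2 * (M2 K \<tau>\<^sub>0 * (\<sigma>\<^sub>\<epsilon> chi)\<^sup>2 / (c' * A powr \<kappa> * (M1 K \<tau>\<^sub>0)\<^sup>2))
        + \<alpha>\<^sup>2 / (\<beta> (1 - l))\<^sup>2 * (d\<phi>\<^sup>2 * (M0 K \<tau>\<^sub>0)\<^sup>2 * A\<^sup>2 / (M1 K \<tau>\<^sub>0)\<^sup>2)"
      unfolding D_def[symmetric] using D by (simp add: add_divide_distrib mult_ac)
    finally show "(\<lambda>n. real n powr (2 / (2 + \<kappa>)) * expectation (\<lambda>\<omega>. (rec_estimator K p F h l Xs Ys chi n \<omega> - r chi)\<^sup>2))
      \<longlonglongrightarrow> \<beta> (1 - 2 * l) / (\<beta> (1 - l))\<^sup>2 * (M2 K \<tau>\<^sub>0 * (\<sigma>\<^sub>\<epsilon> chi)\<^sup>2 / (c' * A powr \<kappa> * (M1 K \<tau>\<^sub>0)\<^sup>2))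
        + \<alpha>\<^sup>2 / (\<beta> (1 - l))\<^sup>2 * (d\<phi>\<^sup>2 * (M0 K \<tau>\<^sub>0)\<^sup>2 * A\<^sup>2 / (M1 K \<tau>\<^sub>0)\<^sup>2)" .
  qed (use main in auto)
qed

end
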